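(* Let the model and the function $\mathcal L$ be as in the context, and let $\hat x^{\mathrm{lin}}=\frac1n\sum_{i=1}^n\mathcal L(y_i)a_i$. Then, almost surely, for $i\in\{1,2\}$, $$\lim_{d\to\infty}\frac{\langle\hat x^{\mathrm{lin}},x_i^*\rangle}{\|\hat x^{\mathrm{lin}}\|_2\|x_i^*\|_2}=\rho_i^{\mathrm{lin}},$$ where $$\rho_1^{\mathrm{lin}}=\frac{\alpha\,\mathbb E[G\mathcal L(Y)]}{n^{\mathrm{lin}}},\quad \rho_2^{\mathrm{lin}}=\frac{(1-\alpha)\,\mathbb E[G\mathcal L(Y)]}{n^{\mathrm{lin}}},\quad n^{\mathrm{lin}}=\Big((\alpha^2+(1-\alpha)^2)\,\mathbb E[G\mathcal L(Y)]^2+\frac{\mathbb E[\mathcal L(Y)^2]}\delta\Big)^{1/2}.$$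
   Context: Model. For each dimension $d$ let $n=n(d)$, with $n,d\to\infty$ and $n/d\to\delta\in(0,\infty)$. Let $q:\mathbb R^2\to\mathbb R$ be a known link function, $P_\varepsilon$ a distribution on $\mathbb R$ with finite second moment, and $\alpha\in(1/2,1)$. The signals $x_1^*,x_2^*$ are independent and uniform on the unit sphere $\mathbb S^{d-1}$; the covariates $a_1,\dots,a_n$ are i.i.d. $\mathcal N(0,I_d)$; the latent variables $\eta_1,\dots,\eta_n$ are i.i.d. Bernoulli$(\alpha)$; the noise variables $\varepsilon_1,\dots,\varepsilon_n$ are i.i.d. $P_\varepsilon$; all of these are mutually independent. The observations are $y_i=q(\langle a_i,\eta_ix_1^*+(1-\eta_i)x_2^*\rangle,\varepsilon_i)$, $i=1,\dots,n$. Let $(G,\varepsilon)\sim\mathcal N(0,1)\otimes P_\varepsilon$ and $Y=q(G,\varepsilon)$. The preprocessing function $\mathcal L:\mathbb R\to\mathbb R$ is Lipschitz with $\mathbb E[G\mathcal L(Y)]\ne0$ and $\mathbb E|G\mathcal L(Y)|<\infty$.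
   Formalization: The coupling across d is left open and the claim can fail (independent instances, heavy-tailed noise); here either the η_i, ε_i and predictors ⟨a_i, η_i x_1*+(1−η_i)x_2*⟩ are the same for all d, or E[L(Y)^4] is finite. If E[L(Y)^2] is infinite, ρ_i is 0. *)

theory Defs
  imports "HOL-Probability.Probability"
begin

(* The dimension d varies inside the statement, so a vector of R^d is a function on nat of which
   only the coordinates j < d matter; its norm is L2_set u {..<d}.
   (Random vectors take values in the extensional functions, the space of PiM {..<d}.) *)

definition ip :: "nat \<Rightarrow> (nat \<Rightarrow> real) \<Rightarrow> (nat \<Rightarrow> real) \<Rightarrow> real" where
  "ip d u v = (\<Sum>j<d. u j * v j)"

abbreviation vec_borel :: "nat \<Rightarrow> (nat \<Rightarrow> real) measure" where
  "vec_borel d \<equiv> PiM {..<d} (\<lambda>_. borel)"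

definition std_gaussian :: "nat \<Rightarrow> (nat \<Rightarrow> real) measure" where
  "std_gaussian d = PiM {..<d} (\<lambda>_. std_normal_distribution)"

definition orthogonal_mat :: "nat \<Rightarrow> (nat \<Rightarrow> nat \<Rightarrow> real) \<Rightarrow> bool" where
  "orthogonal_mat d Q \<longleftrightarrow>
     (\<forall>i<d. \<forall>j<d. (\<Sum>k<d. Q i k * Q j k) = (if i = j then 1 else 0))"

definition mat_apply :: "nat \<Rightarrow> (nat \<Rightarrow> nat \<Rightarrow> real) \<Rightarrow> (nat \<Rightarrow> real) \<Rightarrow> nat \<Rightarrow> real" where
  "mat_apply d Q u = (\<lambda>i\<in>{..<d}. \<Sum>j<d. Q i j * u j)"

(* The uniform distribution on the unit sphere of R^d: the (unique) probability measure carried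
   by the sphere that is invariant under the orthogonal group. *)
definition uniform_on_sphere :: "nat \<Rightarrow> (nat \<Rightarrow> real) measure \<Rightarrow> bool" where
  "uniform_on_sphere d \<mu> \<longleftrightarrow>
     prob_space \<mu> \<and> sets \<mu> = sets (vec_borel d) \<and>
     (AE u in \<mu>. L2_set u {..<d} = 1) \<and>
     (\<forall>Q. orthogonal_mat d Q \<longrightarrow> distr \<mu> (vec_borel d) (mat_apply d Q) = \<mu>)"

(* Joint law of (x1, x2, (a_i), (eta_i), (eps_i)), i < n, for one dimension d, \<mu> being the law of
   the signals. That the joint law is this product measure encodes both the marginals and the
   mutual independence. *)
definition instance_law ::
  "nat \<Rightarrow> nat \<Rightarrow> (nat \<Rightarrow> real) measure \<Rightarrow> real \<Rightarrow> real measure \<Rightarrow>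
   ((nat \<Rightarrow> real) \<times> (nat \<Rightarrow> real) \<times> (nat \<Rightarrow> nat \<Rightarrow> real) \<times> (nat \<Rightarrow> bool) \<times> (nat \<Rightarrow> real)) measure"
where
  "instance_law d n \<mu> \<alpha> P =
     \<mu> \<Otimes>\<^sub>M (\<mu> \<Otimes>\<^sub>M (PiM {..<n} (\<lambda>_. std_gaussian d) \<Otimes>\<^sub>M
       (PiM {..<n} (\<lambda>_. measure_pmf (bernoulli_pmf \<alpha>)) \<Otimes>\<^sub>M PiM {..<n} (\<lambda>_. P))))"

definition mixed_glm_instance ::
  "'w measure \<Rightarrow> nat \<Rightarrow> nat \<Rightarrow> real \<Rightarrow> real measure \<Rightarrow>
   ('w \<Rightarrow> nat \<Rightarrow> real) \<Rightarrow> ('w \<Rightarrow> nat \<Rightarrow> real) \<Rightarrow> (nat \<Rightarrow> 'w \<Rightarrow> nat \<Rightarrow> real) \<Rightarrow>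
   (nat \<Rightarrow> 'w \<Rightarrow> bool) \<Rightarrow> (nat \<Rightarrow> 'w \<Rightarrow> real) \<Rightarrow> bool"
where
  "mixed_glm_instance M d n \<alpha> P x1 x2 a \<eta> \<epsilon> \<longleftrightarrow>
     (\<exists>\<mu>. uniform_on_sphere d \<mu> \<and>
        (let T = (\<lambda>\<omega>. (x1 \<omega>, x2 \<omega>, \<lambda>i\<in>{..<n}. a i \<omega>, \<lambda>i\<in>{..<n}. \<eta> i \<omega>, \<lambda>i\<in>{..<n}. \<epsilon> i \<omega>))
         in T \<in> M \<rightarrow>\<^sub>M instance_law d n \<mu> \<alpha> P \<and>
            distr M (instance_law d n \<mu> \<alpha> P) T = instance_law d n \<mu> \<alpha> P))"

(* <a_i, eta_i x1 + (1 - eta_i) x2> *)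
definition predictor ::
  "nat \<Rightarrow> (nat \<Rightarrow> real) \<Rightarrow> (nat \<Rightarrow> real) \<Rightarrow> (nat \<Rightarrow> real) \<Rightarrow> bool \<Rightarrow> real"
where
  "predictor d u1 u2 v b = ip d v (\<lambda>j. of_bool b * u1 j + (1 - of_bool b) * u2 j)"

definition lin_estimator ::
  "nat \<Rightarrow> (real \<Rightarrow> real) \<Rightarrow> (nat \<Rightarrow> real) \<Rightarrow> (nat \<Rightarrow> nat \<Rightarrow> real) \<Rightarrow> nat \<Rightarrow> real"
where
  "lin_estimator n L y a = (\<lambda>j. (1 / real n) * (\<Sum>i<n. L (y i) * a i j))"

definition overlap :: "nat \<Rightarrow> (nat \<Rightarrow> real) \<Rightarrow> (nat \<Rightarrow> real) \<Rightarrow> real" where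
  "overlap d u v = ip d u v / (L2_set u {..<d} * L2_set v {..<d})"

abbreviation scalar_law :: "real measure \<Rightarrow> (real \<times> real) measure" where
  "scalar_law P \<equiv> std_normal_distribution \<Otimes>\<^sub>M P"

definition mean_GL :: "real measure \<Rightarrow> (real \<times> real \<Rightarrow> real) \<Rightarrow> (real \<Rightarrow> real) \<Rightarrow> real" where
  "mean_GL P q L = (LINT z|scalar_law P. fst z * L (q z))"

definition second_moment_L :: "real measure \<Rightarrow> (real \<times> real \<Rightarrow> real) \<Rightarrow> (real \<Rightarrow> real) \<Rightarrow> ennreal"
where
  "second_moment_L P q L = (\<integral>\<^sup>+ z. ennreal ((L (q z))\<^sup>2) \<partial>scalar_law P)"

(* No hypothesis makes E[L(Y)^2] finite; when it is infinite, n_lin is infinite as well and the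
   limits rho_i = (..)/n_lin below are 0. *)
definition n_lin ::
  "real \<Rightarrow> real \<Rightarrow> real measure \<Rightarrow> (real \<times> real \<Rightarrow> real) \<Rightarrow> (real \<Rightarrow> real) \<Rightarrow> ereal"
where
  "n_lin \<alpha> \<delta> P q L =
     (if second_moment_L P q L = \<infinity> then \<infinity>
      else ereal (sqrt ((\<alpha>\<^sup>2 + (1 - \<alpha>)\<^sup>2) * (mean_GL P q L)\<^sup>2
                        + enn2real (second_moment_L P q L) / \<delta>)))"

definition rho1_lin ::
  "real \<Rightarrow> real \<Rightarrow> real measure \<Rightarrow> (real \<times> real \<Rightarrow> real) \<Rightarrow> (real \<Rightarrow> real) \<Rightarrow> ereal"
where
  "rho1_lin \<alpha> \<delta> P q L = ereal (\<alpha> * mean_GL P q L) / n_lin \<alpha> \<delta> P q L"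

definition rho2_lin ::
  "real \<Rightarrow> real \<Rightarrow> real measure \<Rightarrow> (real \<times> real \<Rightarrow> real) \<Rightarrow> (real \<Rightarrow> real) \<Rightarrow> ereal"
where
  "rho2_lin \<alpha> \<delta> P q L = ereal ((1 - \<alpha>) * mean_GL P q L) / n_lin \<alpha> \<delta> P q L"

(* How the instances for different d are placed on one probability space. The model fixes the law
   of each instance only, whereas almost sure convergence as d grows depends on the joint law.
   In a coherent sequence of instances the i-th sample carries the same scalars (latent variable,
   linear predictor, noise), hence the same observation y_i, in all of them, so that y_1, y_2, ...
   is a single i.i.d. sequence. *)
definition coherent_samples ::
  "'w measure \<Rightarrow> (nat \<Rightarrow> nat) \<Rightarrow>
   (nat \<Rightarrow> 'w \<Rightarrow> nat \<Rightarrow> real) \<Rightarrow> (nat \<Rightarrow> 'w \<Rightarrow> nat \<Rightarrow> real) \<Rightarrow> (nat \<Rightarrow> nat \<Rightarrow> 'w \<Rightarrow> nat \<Rightarrow> real) \<Rightarrow>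
   (nat \<Rightarrow> nat \<Rightarrow> 'w \<Rightarrow> bool) \<Rightarrow> (nat \<Rightarrow> nat \<Rightarrow> 'w \<Rightarrow> real) \<Rightarrow> bool"
where
  "coherent_samples M n x1 x2 a \<eta> \<epsilon> \<longleftrightarrow>
     (AE \<omega> in M. \<forall>d>0. \<forall>d'>0. \<forall>i. i < n d \<and> i < n d' \<longrightarrow>
        \<eta> d i \<omega> = \<eta> d' i \<omega> \<and> \<epsilon> d i \<omega> = \<epsilon> d' i \<omega> \<and>
        predictor d (x1 d \<omega>) (x2 d \<omega>) (a d i \<omega>) (\<eta> d i \<omega>) =
        predictor d' (x1 d' \<omega>) (x2 d' \<omega>) (a d' i \<omega>) (\<eta> d' i \<omega>))"

end

theory Submission
  imports Defs
begin

text \<open>Let \<open>w\<^sub>i = L y\<^sub>i\<close>, let \<open>u\<^sub>i\<close> be the signal that generates sample \<open>i\<close> and let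
\<open>g\<^sub>i = \<langle>a\<^sub>i, u\<^sub>i\<rangle>\<close>. Splitting every covariate along its own signal gives
\<open>x\<^sup>l\<^sup>i\<^sup>n = A\<^sub>1 x\<^sub>1 + A\<^sub>2 x\<^sub>2 + r\<close>, where \<open>A\<^sub>k\<close> sums the products \<open>w\<^sub>i g\<^sub>i / n\<close>
over the samples of class \<open>k\<close> and \<open>r\<close> is the average of \<open>w\<^sub>i (a\<^sub>i - g\<^sub>i u\<^sub>i)\<close>. The part of \<open>a\<^sub>i\<close>
orthogonal to \<open>u\<^sub>i\<close> is independent of \<open>g\<^sub>i\<close>, hence of \<open>w\<^sub>i\<close>. So, given the weights, \<open>r\<close> is essentially
a Gaussian vector with covariance \<open>(V / n) I\<close>, where \<open>V\<close> is the average of the \<open>w\<^sub>i\<^sup>2\<close>: relative to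
\<open>sqrt V\<close> its inner products with the signals vanish and its norm tends to \<open>1 / sqrt \<delta>\<close>. The signals
become orthogonal, the law of large numbers gives \<open>A\<^sub>1 \<longrightarrow> \<alpha> m\<close>, \<open>A\<^sub>2 \<longrightarrow> (1 - \<alpha>) m\<close> with
\<open>m = E[G L(Y)]\<close>, and \<open>V \<longrightarrow> E[L(Y)\<^sup>2]\<close>, possibly infinite. Dividing numerator and denominator of the
overlap by \<open>sqrt V\<close> yields the limit in both cases (\<open>overlap_limit\<close>).

Independence of the two parts of a covariate is used in the form of \<open>distr_resample\<close>: a standard Gaussian
vector may be generated from a scalar \<open>\<xi>\<close>, which becomes its component along \<open>u\<close>, and an independent
Gaussian vector \<open>b\<close>, of which only the part orthogonal to \<open>u\<close> matters. This follows from the Cameron-Martin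
formula. After resampling all covariates (\<open>nn_integral_instance_resampled\<close>) the weights depend on the
\<open>\<xi>\<close>'s and on the noise only, and \<open>r\<close> is a linear image of the \<open>b\<close>'s.

The law of each instance says nothing about the joint law of the instances for different \<open>d\<close>, so that
almost sure convergence needs tail bounds that are summable over \<open>d\<close>. For the Gaussian quantities and for
the inner product of the signals, fourth moments give bounds of order \<open>d\<^sup>-\<^sup>2\<close>. For the averages of the scalar
samples there are two cases. If \<open>E[L(Y)\<^sup>4]\<close> is finite, the averages are taken of square integrable variables,
and these converge completely, by the theorem of Hsu and Robbins (\<open>complete_convergence_of_means\<close>). If the
samples are coherent, the averages are those of one i.i.d. sequence, and the strong law of large numbers
applies (\<open>strong_law\<close>, \<open>strong_law_infinite\<close>). Both theorems come from one bound for truncated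
variables (\<open>mean_tail_bound\<close>).\<close>

section \<open>Gaussian vectors: shifts and resampling of one component\<close>

abbreviation gauss :: "real measure" where "gauss \<equiv> std_normal_distribution"

lemma prob_space_gauss: "prob_space gauss"
  by (rule prob_space_normal_density) simp

lemma sets_std_gaussian [measurable_cong]: "sets (std_gaussian d) = sets (vec_borel d)"
  unfolding std_gaussian_def by (intro sets_PiM_cong) auto

lemma prob_space_std_gaussian: "prob_space (std_gaussian d)"
  unfolding std_gaussian_def by (intro prob_space_PiM prob_space_gauss)

lemma nn_integral_pair:
  assumes "prob_space N" and "f \<in> borel_measurable (M \<Otimes>\<^sub>M N)"
  shows "(\<integral>\<^sup>+z. f z \<partial>(M \<Otimes>\<^sub>M N)) = (\<integral>\<^sup>+x. \<integral>\<^sup>+y. f (x, y) \<partial>N \<partial>M)"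
proof -
  interpret prob_space N by fact
  show ?thesis using nn_integral_fst[OF assms(2)] by simp
qed

lemma nn_integral_swap:
  assumes "prob_space M" "prob_space N" and "case_prod f \<in> borel_measurable (M \<Otimes>\<^sub>M N)"
  shows "(\<integral>\<^sup>+x. \<integral>\<^sup>+y. f x y \<partial>N \<partial>M) = (\<integral>\<^sup>+y. \<integral>\<^sup>+x. f x y \<partial>M \<partial>N)"
proof -
  interpret M: prob_space M by fact
  interpret N: prob_space N by fact
  interpret pair_sigma_finite M N ..
  show ?thesis using Fubini'[OF assms(3)] by simp
qed

lemma emeasure_distr_indicator:
  assumes "f \<in> M \<rightarrow>\<^sub>M N" and "E \<in> sets N"
  shows "emeasure (distr M N f) E = (\<integral>\<^sup>+x. indicator E (f x) \<partial>M)"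
proof -
  have "(\<integral>\<^sup>+x. indicator E (f x) \<partial>M) = (\<integral>\<^sup>+x. indicator E x \<partial>distr M N f)"
    using assms by (subst nn_integral_distr) auto
  then show ?thesis using assms by simp
qed

text \<open>On rectangles the indicator factors over the index set, so that Fubini's theorem reduces the claim to a
single index.\<close>

lemma PiM_zip:
  fixes A :: "'i \<Rightarrow> 'a measure" and B :: "'i \<Rightarrow> 'b measure" and C :: "'i \<Rightarrow> 'c measure"
  assumes I: "finite I" and A: "\<And>i. prob_space (A i)" and B: "\<And>i. prob_space (B i)"
    and f: "\<And>i. f i \<in> A i \<Otimes>\<^sub>M B i \<rightarrow>\<^sub>M C i"
  shows "distr (PiM I A \<Otimes>\<^sub>M PiM I B) (PiM I C) (\<lambda>z. \<lambda>i\<in>I. f i (fst z i, snd z i)) =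
    PiM I (\<lambda>i. distr (A i \<Otimes>\<^sub>M B i) (C i) (f i))" (is "?L = PiM I ?D")
proof -
  note f[measurable]
  have D: "prob_space (?D i)" for i
    by (intro prob_space.prob_space_distr prob_space_pair A B f)
  interpret D: product_prob_space ?D by (intro product_prob_spaceI D)
  interpret A: product_prob_space A by (intro product_prob_spaceI A)
  interpret B: product_prob_space B by (intro product_prob_spaceI B)
  have PB: "prob_space (PiM I B)" by (intro prob_space_PiM B)
  show ?thesis
  proof (rule D.PiM_eqI[OF I])
    show "sets ?L = sets (PiM I ?D)" by (simp, intro sets_PiM_cong) auto
  next
    fix E assume "\<And>i. i \<in> I \<Longrightarrow> E i \<in> sets (?D i)"
    then have E: "E i \<in> sets (C i)" if "i \<in> I" for i using that by simp
    have m: "(\<lambda>z. \<lambda>i\<in>I. f i (fst z i, snd z i)) \<in> PiM I A \<Otimes>\<^sub>M PiM I B \<rightarrow>\<^sub>M PiM I C"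
      by measurable
    have ind: "(\<lambda>w. indicator (E i) (f i w)::ennreal) \<in> borel_measurable (A i \<Otimes>\<^sub>M B i)" if "i \<in> I" for i
      using E[OF that] by measurable
    have "emeasure ?L (Pi\<^sub>E I E) =
      (\<integral>\<^sup>+z. indicator (Pi\<^sub>E I E) (\<lambda>i\<in>I. f i (fst z i, snd z i)) \<partial>(PiM I A \<Otimes>\<^sub>M PiM I B))"
      using E by (intro emeasure_distr_indicator m) (auto intro!: sets_PiM_I_finite I)
    also have "\<dots> = (\<integral>\<^sup>+z. (\<Prod>i\<in>I. indicator (E i) (f i (fst z i, snd z i))) \<partial>(PiM I A \<Otimes>\<^sub>M PiM I B))"
      using I by (intro nn_integral_cong) (auto simp: indicator_def PiE_iff prod_zero_iff intro!: prod.neutral[symmetric])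
    also have "\<dots> = (\<integral>\<^sup>+x. \<integral>\<^sup>+y. (\<Prod>i\<in>I. indicator (E i) (f i (x i, y i))) \<partial>PiM I B \<partial>PiM I A)"
      using E by (subst nn_integral_pair[OF PB]) (auto simp del: indicator_simps)
    also have "\<dots> = (\<integral>\<^sup>+x. (\<Prod>i\<in>I. \<integral>\<^sup>+y. indicator (E i) (f i (x i, y)) \<partial>B i) \<partial>PiM I A)"
    proof (intro nn_integral_cong B.product_nn_integral_prod[OF I])
      fix x i assume "x \<in> space (PiM I A)" "i \<in> I"
      then have "x i \<in> space (A i)" by (auto simp: space_PiM)
      then show "(\<lambda>y. indicator (E i) (f i (x i, y))::ennreal) \<in> borel_measurable (B i)"
        using ind[OF \<open>i \<in> I\<close>] by measurable
    qed
    also have "\<dots> = (\<Prod>i\<in>I. \<integral>\<^sup>+x. \<integral>\<^sup>+y. indicator (E i) (f i (x, y)) \<partial>B i \<partial>A i)"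
      by (intro A.product_nn_integral_prod I ind
          sigma_finite_measure.borel_measurable_nn_integral_fst prob_space_imp_sigma_finite B)
    also have "\<dots> = (\<Prod>i\<in>I. emeasure (?D i) (E i))"
    proof (intro prod.cong refl)
      fix i assume i: "i \<in> I"
      have "(\<integral>\<^sup>+x. \<integral>\<^sup>+y. indicator (E i) (f i (x, y)) \<partial>B i \<partial>A i) = (\<integral>\<^sup>+w. indicator (E i) (f i w) \<partial>(A i \<Otimes>\<^sub>M B i))"
        by (rule nn_integral_pair[OF B ind[OF i], symmetric])
      also have "\<dots> = emeasure (?D i) (E i)"
        by (rule emeasure_distr_indicator[OF f E[OF i], symmetric])
      finally show "(\<integral>\<^sup>+x. \<integral>\<^sup>+y. indicator (E i) (f i (x, y)) \<partial>B i \<partial>A i) = emeasure (?D i) (E i)" .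
    qed
    finally show "emeasure ?L (Pi\<^sub>E I E) = (\<Prod>i\<in>I. emeasure (?D i) (E i))" .
  qed
qed

lemma nn_integral_PiM_zip:
  fixes A :: "'i \<Rightarrow> 'a measure" and B :: "'i \<Rightarrow> 'b measure" and C :: "'i \<Rightarrow> 'c measure"
  assumes I: "finite I" and A: "\<And>i. prob_space (A i)" and B: "\<And>i. prob_space (B i)"
    and f [measurable]: "\<And>i. f i \<in> A i \<Otimes>\<^sub>M B i \<rightarrow>\<^sub>M C i"
    and D: "\<And>i. i \<in> I \<Longrightarrow> distr (A i \<Otimes>\<^sub>M B i) (C i) (f i) = D i"
    and F [measurable]: "F \<in> borel_measurable (PiM I C)"
  shows "(\<integral>\<^sup>+x. F x \<partial>PiM I D) = (\<integral>\<^sup>+x. \<integral>\<^sup>+y. F (\<lambda>i\<in>I. f i (x i, y i)) \<partial>PiM I B \<partial>PiM I A)"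
proof -
  have PB: "prob_space (PiM I B)" by (intro prob_space_PiM B)
  have "PiM I D = PiM I (\<lambda>i. distr (A i \<Otimes>\<^sub>M B i) (C i) (f i))"
    by (intro PiM_cong) (auto simp: D)
  also have "\<dots> = distr (PiM I A \<Otimes>\<^sub>M PiM I B) (PiM I C) (\<lambda>z. \<lambda>i\<in>I. f i (fst z i, snd z i))"
    by (rule PiM_zip[symmetric, OF I A B f])
  finally show ?thesis
    by (simp add: nn_integral_distr nn_integral_pair[OF PB])
qed

text \<open>Completing the square: the density of the shifted standard normal law relative to the
unshifted one.\<close>

lemma nn_integral_gauss_shift:
  assumes [measurable]: "F \<in> borel_measurable borel"
  shows "(\<integral>\<^sup>+x. F (x + t) \<partial>gauss) = (\<integral>\<^sup>+x. ennreal (exp (t * x - t\<^sup>2 / 2)) * F x \<partial>gauss)"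
proof -
  have dens: "std_normal_density (x - t) = exp (t * x - t\<^sup>2 / 2) * std_normal_density x" for x
    unfolding std_normal_density_def
    by (simp add: mult_exp_exp power2_eq_square field_simps)
  have "(\<integral>\<^sup>+x. F (x + t) \<partial>gauss) = (\<integral>\<^sup>+x. ennreal (std_normal_density x) * F (x + t) \<partial>lborel)"
    by (simp add: nn_integral_density)
  also have "\<dots> = (\<integral>\<^sup>+x. ennreal (std_normal_density (x - t)) * F x \<partial>lborel)"
    by (subst (2) nn_integral_real_affine[where c=1 and t=t]) (auto simp: add.commute)
  also have "\<dots> = (\<integral>\<^sup>+x. ennreal (exp (t * x - t\<^sup>2 / 2)) * F x \<partial>gauss)"
    by (simp add: nn_integral_density dens ennreal_mult' mult_ac)
  finally show ?thesis .
qed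

lemma emeasure_gauss_shift:
  assumes [measurable]: "E \<in> sets borel"
  shows "emeasure (distr gauss borel (\<lambda>x. x + t)) E =
    emeasure (density gauss (\<lambda>x. ennreal (exp (t * x - t\<^sup>2 / 2)))) E"
proof -
  have "emeasure (distr gauss borel (\<lambda>x. x + t)) E = (\<integral>\<^sup>+x. indicator E (x + t) \<partial>gauss)"
    by (intro emeasure_distr_indicator) auto
  then show ?thesis by (simp add: nn_integral_gauss_shift emeasure_density)
qed

lemma measurable_ip [measurable]:
  assumes "\<And>j. j < d \<Longrightarrow> (\<lambda>x. u x j) \<in> borel_measurable M" "\<And>j. j < d \<Longrightarrow> (\<lambda>x. v x j) \<in> borel_measurable M"
  shows "(\<lambda>x. ip d (u x) (v x)) \<in> borel_measurable M"
  unfolding ip_def using assms by (intro borel_measurable_sum borel_measurable_times) auto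

lemma ip_scale_right: "ip d u (\<lambda>j. c * v j) = c * ip d u v"
  unfolding ip_def sum_distrib_left by (simp add: mult_ac)

lemma ip_scale_left: "ip d (\<lambda>j. c * u j) v = c * ip d u v"
  unfolding ip_def sum_distrib_left by (simp add: mult_ac)

text \<open>The Cameron-Martin formula. Read as an equality of measures, both sides are the product
over the coordinates of the one-dimensional shifted laws; this can be checked on rectangles.\<close>

lemma nn_integral_std_gaussian_shift:
  assumes [measurable]: "F \<in> borel_measurable (vec_borel d)"
  shows "(\<integral>\<^sup>+b. F (\<lambda>j\<in>{..<d}. b j + t j) \<partial>std_gaussian d) =
    (\<integral>\<^sup>+b. ennreal (exp (ip d b t - ip d t t / 2)) * F b \<partial>std_gaussian d)"
proof -
  define Q where "Q j = distr gauss borel (\<lambda>x. x + t j)" for j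
  interpret G: product_prob_space "\<lambda>_::nat. gauss" by (intro product_prob_spaceI prob_space_gauss)
  have Q: "prob_space (Q j)" for j
    unfolding Q_def by (intro prob_space.prob_space_distr prob_space_gauss) simp
  interpret Q: product_prob_space Q by (intro product_prob_spaceI Q)
  have sQ: "sets (PiM {..<d} Q) = sets (vec_borel d)"
    by (intro sets_PiM_cong) (auto simp: Q_def)
  have 1: "distr (std_gaussian d) (vec_borel d) (\<lambda>b. \<lambda>j\<in>{..<d}. b j + t j) = PiM {..<d} Q" (is "?L = _")
  proof (rule Q.PiM_eqI)
    fix E assume "\<And>i. i \<in> {..<d} \<Longrightarrow> E i \<in> sets (Q i)"
    then have E: "E i \<in> sets borel" if "i < d" for i using that by (simp add: Q_def)
    have "emeasure ?L (Pi\<^sub>E {..<d} E) =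
      (\<integral>\<^sup>+b. indicator (Pi\<^sub>E {..<d} E) (\<lambda>j\<in>{..<d}. b j + t j) \<partial>std_gaussian d)"
      using E by (intro emeasure_distr_indicator) (auto intro!: sets_PiM_I_finite)
    also have "\<dots> = (\<integral>\<^sup>+b. (\<Prod>j<d. indicator (E j) (b j + t j)) \<partial>std_gaussian d)"
      by (intro nn_integral_cong) (auto simp: indicator_def PiE_iff prod_zero_iff intro!: prod.neutral[symmetric])
    also have "\<dots> = (\<Prod>j<d. \<integral>\<^sup>+x. indicator (E j) (x + t j) \<partial>gauss)"
      unfolding std_gaussian_def using E by (intro G.product_nn_integral_prod) auto
    also have "\<dots> = (\<Prod>j<d. emeasure (Q j) (E j))"
      unfolding Q_def using E
      by (intro prod.cong refl emeasure_distr_indicator[symmetric]) auto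
    finally show "emeasure ?L (Pi\<^sub>E {..<d} E) = (\<Prod>j\<in>{..<d}. emeasure (Q j) (E j))" .
  qed (simp_all add: sQ)
  have ex: "ennreal (exp (ip d b t - ip d t t / 2)) = (\<Prod>j<d. ennreal (exp (t j * b j - (t j)\<^sup>2 / 2)))" for b
    by (simp add: prod_ennreal exp_sum[symmetric] ip_def sum_subtractf sum_divide_distrib power2_eq_square mult_ac)
  have 2: "density (std_gaussian d) (\<lambda>b. ennreal (exp (ip d b t - ip d t t / 2))) = PiM {..<d} Q" (is "?R = _")
  proof (rule Q.PiM_eqI)
    fix E assume "\<And>i. i \<in> {..<d} \<Longrightarrow> E i \<in> sets (Q i)"
    then have E: "E i \<in> sets borel" if "i < d" for i using that by (simp add: Q_def)
    have "emeasure ?R (Pi\<^sub>E {..<d} E) =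
      (\<integral>\<^sup>+b. (\<Prod>j<d. ennreal (exp (t j * b j - (t j)\<^sup>2 / 2))) * indicator (Pi\<^sub>E {..<d} E) b \<partial>std_gaussian d)"
      unfolding ex using E by (subst emeasure_density) (auto intro!: sets_PiM_I_finite simp: sets_std_gaussian)
    also have "\<dots> = (\<integral>\<^sup>+b. (\<Prod>j<d. ennreal (exp (t j * b j - (t j)\<^sup>2 / 2)) * indicator (E j) (b j)) \<partial>std_gaussian d)"
    proof (rule nn_integral_cong)
      fix b assume "b \<in> space (std_gaussian d)"
      then have "indicator (Pi\<^sub>E {..<d} E) b = (\<Prod>j<d. indicator (E j) (b j)::ennreal)"
        by (auto simp: indicator_def PiE_iff prod_zero_iff std_gaussian_def space_PiM intro!: prod.neutral[symmetric])
      then show "(\<Prod>j<d. ennreal (exp (t j * b j - (t j)\<^sup>2 / 2))) * indicator (Pi\<^sub>E {..<d} E) b =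
        (\<Prod>j<d. ennreal (exp (t j * b j - (t j)\<^sup>2 / 2)) * indicator (E j) (b j))"
        by (simp add: prod.distrib)
    qed
    also have "\<dots> = (\<Prod>j<d. \<integral>\<^sup>+x. ennreal (exp (t j * x - (t j)\<^sup>2 / 2)) * indicator (E j) x \<partial>gauss)"
      unfolding std_gaussian_def using E by (intro G.product_nn_integral_prod) auto
    also have "\<dots> = (\<Prod>j<d. emeasure (Q j) (E j))"
      unfolding Q_def using E by (intro prod.cong refl) (simp add: emeasure_gauss_shift emeasure_density)
    finally show "emeasure ?R (Pi\<^sub>E {..<d} E) = (\<Prod>j\<in>{..<d}. emeasure (Q j) (E j))" .
  qed (simp_all add: sQ sets_std_gaussian)
  have [measurable]: "(\<lambda>b. ennreal (exp (ip d b t - ip d t t / 2))) \<in> borel_measurable (std_gaussian d)"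
    by measurable
  have "(\<integral>\<^sup>+b. F (\<lambda>j\<in>{..<d}. b j + t j) \<partial>std_gaussian d) = (\<integral>\<^sup>+b. F b \<partial>PiM {..<d} Q)"
    unfolding 1[symmetric] by (subst nn_integral_distr) auto
  also have "\<dots> = (\<integral>\<^sup>+b. ennreal (exp (ip d b t - ip d t t / 2)) * F b \<partial>std_gaussian d)"
    unfolding 2[symmetric] by (subst nn_integral_density) auto
  finally show ?thesis .
qed

lemma nn_integral_gauss_exp: "(\<integral>\<^sup>+x. ennreal (exp (t * x - t\<^sup>2 / 2)) \<partial>gauss) = 1"
  using nn_integral_gauss_shift[of "\<lambda>_. 1" t] prob_space.emeasure_space_1[OF prob_space_gauss] by simp

text \<open>For a unit vector \<open>u\<close>, the component of \<open>b\<close> along \<open>u\<close> is exchanged for \<open>\<xi>\<close>.\<close>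

definition resample :: "nat \<Rightarrow> (nat \<Rightarrow> real) \<Rightarrow> (nat \<Rightarrow> real) \<Rightarrow> real \<Rightarrow> nat \<Rightarrow> real" where
  "resample d u b \<xi> = (\<lambda>j\<in>{..<d}. b j + (\<xi> - ip d b u) * u j)"

lemma measurable_resample [measurable]:
  "(\<lambda>z. resample d u (fst z) (snd z)) \<in> std_gaussian d \<Otimes>\<^sub>M gauss \<rightarrow>\<^sub>M vec_borel d"
  unfolding resample_def by measurable

lemma ip_resample: "ip d u u = 1 \<Longrightarrow> ip d (resample d u b \<xi>) u = \<xi>"
proof -
  assume u: "ip d u u = 1"
  have "ip d (resample d u b \<xi>) u = (\<Sum>j<d. b j * u j + (\<xi> - ip d b u) * (u j * u j))"
    unfolding ip_def[of d "resample d u b \<xi>"] by (intro sum.cong) (auto simp: resample_def algebra_simps)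
  also have "\<dots> = ip d b u + (\<xi> - ip d b u) * ip d u u"
    by (simp add: sum.distrib sum_distrib_left ip_def)
  finally show ?thesis by (simp add: u)
qed

text \<open>This is how the independence of \<open>\<langle>a, u\<rangle>\<close> and of the part of \<open>a\<close> orthogonal to \<open>u\<close> is used: the left
hand side generates \<open>a\<close> from an independent pair \<open>(b, \<xi>)\<close> such that \<open>\<langle>a, u\<rangle> = \<xi>\<close>. For the proof, shift
first \<open>\<xi>\<close> by \<open>\<langle>b, u\<rangle>\<close> and then \<open>b\<close> by \<open>\<xi> u\<close>. The two densities that arise combine to
\<open>exp (\<xi> \<langle>b, u\<rangle> - \<langle>b, u\<rangle>\<^sup>2 / 2)\<close>, whose integral over \<open>\<xi>\<close> is \<open>1\<close>.\<close>

lemma distr_resample: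
  assumes u: "ip d u u = 1"
  shows "distr (std_gaussian d \<Otimes>\<^sub>M gauss) (vec_borel d) (\<lambda>z. resample d u (fst z) (snd z)) = std_gaussian d"
    (is "?L = ?R")
proof (rule measure_eqI)
  show "sets ?L = sets ?R" by (simp add: sets_std_gaussian)
  fix E assume "E \<in> sets ?L"
  then have E [measurable]: "E \<in> sets (vec_borel d)" by simp
  let ?G = "std_gaussian d" and ?F = "indicator E :: (nat \<Rightarrow> real) \<Rightarrow> ennreal"
  let ?s = "\<lambda>b \<xi>. \<lambda>j\<in>{..<d}. b j + \<xi> * u j"
  note pg = prob_space_gauss and pG = prob_space_std_gaussian[of d]
  have Fs [measurable]: "(\<lambda>z. ?F (?s (fst z) (snd z))) \<in> borel_measurable (?G \<Otimes>\<^sub>M gauss)"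
    by measurable
  have [measurable]: "(\<lambda>z. ?F (resample d u (fst z) (snd z))) \<in> borel_measurable (?G \<Otimes>\<^sub>M gauss)"
    by measurable
  have "emeasure ?L E = (\<integral>\<^sup>+z. ?F (resample d u (fst z) (snd z)) \<partial>(?G \<Otimes>\<^sub>M gauss))"
    by (intro emeasure_distr_indicator) auto
  also have "\<dots> = (\<integral>\<^sup>+b. \<integral>\<^sup>+\<xi>. ?F (?s b (\<xi> + (- ip d b u))) \<partial>gauss \<partial>?G)"
    by (subst nn_integral_pair[OF pg]) (auto simp: resample_def)
  also have "\<dots> = (\<integral>\<^sup>+b. \<integral>\<^sup>+\<xi>. ennreal (exp (- ip d b u * \<xi> - (ip d b u)\<^sup>2 / 2)) * ?F (?s b \<xi>) \<partial>gauss \<partial>?G)"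
  proof (rule nn_integral_cong)
    fix b assume b: "b \<in> space ?G"
    have m: "(\<lambda>\<xi>. ?F (?s b \<xi>)) \<in> borel_measurable borel"
      using measurable_Pair2[OF Fs b] by simp
    show "(\<integral>\<^sup>+\<xi>. ?F (?s b (\<xi> + (- ip d b u))) \<partial>gauss) =
      (\<integral>\<^sup>+\<xi>. ennreal (exp (- ip d b u * \<xi> - (ip d b u)\<^sup>2 / 2)) * ?F (?s b \<xi>) \<partial>gauss)"
      using nn_integral_gauss_shift[OF m, of "- ip d b u"] unfolding power2_minus .
  qed
  also have "\<dots> = (\<integral>\<^sup>+\<xi>. \<integral>\<^sup>+b. ennreal (exp (- ip d b u * \<xi> - (ip d b u)\<^sup>2 / 2)) * ?F (?s b \<xi>) \<partial>?G \<partial>gauss)"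
    by (rule nn_integral_swap[OF pG pg]) measurable
  also have "\<dots> = (\<integral>\<^sup>+\<xi>. \<integral>\<^sup>+b. ennreal (exp (ip d b u * \<xi> - (ip d b u)\<^sup>2 / 2)) * ?F b \<partial>?G \<partial>gauss)"
  proof (rule nn_integral_cong)
    fix \<xi> :: real
    \<comment> \<open>\<open>H\<close> is the integrand as a function of \<open>b' = b + \<xi> u\<close>, for which \<open>\<langle>b, u\<rangle> = \<langle>b', u\<rangle> - \<xi>\<close>.\<close>
    define H where "H b = ennreal (exp (- (ip d b u - \<xi>) * \<xi> - (ip d b u - \<xi>)\<^sup>2 / 2)) * ?F b" for b
    have [measurable]: "H \<in> borel_measurable (vec_borel d)" unfolding H_def by measurable
    have ips: "ip d (?s b \<xi>) u = ip d b u + \<xi>" for b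
    proof -
      have "ip d (?s b \<xi>) u = (\<Sum>j<d. b j * u j + \<xi> * (u j * u j))"
        unfolding ip_def by (intro sum.cong) (auto simp: algebra_simps)
      also have "\<dots> = ip d b u + \<xi> * ip d u u" by (simp add: sum.distrib sum_distrib_left ip_def)
      finally show ?thesis by (simp add: u)
    qed
    have "(\<integral>\<^sup>+b. ennreal (exp (- ip d b u * \<xi> - (ip d b u)\<^sup>2 / 2)) * ?F (?s b \<xi>) \<partial>?G) = (\<integral>\<^sup>+b. H (?s b \<xi>) \<partial>?G)"
      unfolding H_def ips by simp
    also have "\<dots> = (\<integral>\<^sup>+b. ennreal (exp (\<xi> * ip d b u - \<xi>\<^sup>2 / 2)) * H b \<partial>?G)"
      by (subst nn_integral_std_gaussian_shift) (auto simp: ip_scale_left ip_scale_right u power2_eq_square)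
    also have "\<dots> = (\<integral>\<^sup>+b. ennreal (exp (ip d b u * \<xi> - (ip d b u)\<^sup>2 / 2)) * ?F b \<partial>?G)"
    proof (rule nn_integral_cong)
      fix b
      have "exp (\<xi> * ip d b u - \<xi>\<^sup>2 / 2) * exp (- (ip d b u - \<xi>) * \<xi> - (ip d b u - \<xi>)\<^sup>2 / 2) =
        exp (ip d b u * \<xi> - (ip d b u)\<^sup>2 / 2)"
        by (simp add: mult_exp_exp power2_eq_square field_simps)
      then show "ennreal (exp (\<xi> * ip d b u - \<xi>\<^sup>2 / 2)) * H b = ennreal (exp (ip d b u * \<xi> - (ip d b u)\<^sup>2 / 2)) * ?F b"
        by (simp add: H_def flip: mult.assoc ennreal_mult')
    qed
    finally show "(\<integral>\<^sup>+b. ennreal (exp (- ip d b u * \<xi> - (ip d b u)\<^sup>2 / 2)) * ?F (?s b \<xi>) \<partial>?G) =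
      (\<integral>\<^sup>+b. ennreal (exp (ip d b u * \<xi> - (ip d b u)\<^sup>2 / 2)) * ?F b \<partial>?G)" .
  qed
  also have "\<dots> = (\<integral>\<^sup>+b. \<integral>\<^sup>+\<xi>. ennreal (exp (ip d b u * \<xi> - (ip d b u)\<^sup>2 / 2)) * ?F b \<partial>gauss \<partial>?G)"
    by (rule nn_integral_swap[OF pg pG]) measurable
  also have "\<dots> = (\<integral>\<^sup>+b. ?F b \<partial>?G)"
    by (intro nn_integral_cong) (simp add: nn_integral_multc nn_integral_gauss_exp)
  also have "\<dots> = emeasure ?R E" by (simp add: sets_std_gaussian)
  finally show "emeasure ?L E = emeasure ?R E" .
qed

section \<open>Linear combinations of Gaussian vectors\<close>

lemma nn_integral_ip_std_gaussian:
  assumes u: "ip d u u = 1" and F [measurable]: "F \<in> borel_measurable borel"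
  shows "(\<integral>\<^sup>+a. F (ip d a u) \<partial>std_gaussian d) = (\<integral>\<^sup>+x. F x \<partial>gauss)"
proof -
  have "(\<integral>\<^sup>+a. F (ip d a u) \<partial>std_gaussian d) =
    (\<integral>\<^sup>+z. F (ip d (resample d u (fst z) (snd z)) u) \<partial>(std_gaussian d \<Otimes>\<^sub>M gauss))"
    by (subst distr_resample[OF u, symmetric], subst nn_integral_distr) auto
  also have "\<dots> = (\<integral>\<^sup>+b. \<integral>\<^sup>+\<xi>. F \<xi> \<partial>gauss \<partial>std_gaussian d)"
    by (subst nn_integral_pair[OF prob_space_gauss]) (auto simp: ip_resample[OF u])
  also have "\<dots> = (\<integral>\<^sup>+x. F x \<partial>gauss)"
    using prob_space.emeasure_space_1[OF prob_space_std_gaussian] by simp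
  finally show ?thesis .
qed

text \<open>The unit vector proportional to \<open>(s, t)\<close> turns this into the statement that the component
of a Gaussian vector in \<open>\<real>\<^sup>2\<close> along a unit vector is standard normal.\<close>

lemma nn_integral_gauss_combination:
  assumes F [measurable]: "F \<in> borel_measurable borel"
  shows "(\<integral>\<^sup>+z. F (s * fst z + t * snd z) \<partial>(gauss \<Otimes>\<^sub>M gauss)) = (\<integral>\<^sup>+x. F (sqrt (s\<^sup>2 + t\<^sup>2) * x) \<partial>gauss)"
proof (cases "s\<^sup>2 + t\<^sup>2 = 0")
  case True
  then have "s = 0" "t = 0" by (simp_all add: sum_power2_eq_zero_iff)
  interpret prob_space "gauss \<Otimes>\<^sub>M gauss" by (intro prob_space_pair prob_space_gauss)
  show ?thesis using \<open>s = 0\<close> \<open>t = 0\<close> emeasure_space_1 prob_space.emeasure_space_1[OF prob_space_gauss] by simp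
next
  case False
  define \<sigma> where "\<sigma> = sqrt (s\<^sup>2 + t\<^sup>2)"
  define u where "u = (\<lambda>j::nat. (if j = 0 then s else t) / \<sigma>)"
  have \<sigma>: "\<sigma>\<^sup>2 = s\<^sup>2 + t\<^sup>2" "\<sigma> \<noteq> 0" using False by (simp_all add: \<sigma>_def)
  have lt2: "{..<2} = {0, Suc 0}" by auto
  have "ip 2 u u = (s\<^sup>2 + t\<^sup>2) / \<sigma>\<^sup>2"
    by (simp add: ip_def lt2 u_def power2_eq_square add_divide_distrib)
  then have u: "ip 2 u u = 1" using \<sigma> False by simp
  interpret G: product_prob_space "\<lambda>_::nat. gauss" by (intro product_prob_spaceI prob_space_gauss)
  have "(\<integral>\<^sup>+x. F (\<sigma> * x) \<partial>gauss) = (\<integral>\<^sup>+a. F (\<sigma> * ip 2 a u) \<partial>std_gaussian 2)"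
    using nn_integral_ip_std_gaussian[OF u, of "\<lambda>x. F (\<sigma> * x)"] by simp
  also have "\<dots> = (\<integral>\<^sup>+a. F (s * a 0 + t * a (Suc 0)) \<partial>PiM {0, Suc 0} (\<lambda>_. gauss))"
    using \<sigma> by (simp add: ip_def lt2 u_def std_gaussian_def distrib_left mult.commute)
  also have "\<dots> = (\<integral>\<^sup>+z. F (s * fst z + t * snd z) \<partial>(gauss \<Otimes>\<^sub>M gauss))"
    using G.product_nn_integral_pair[of "\<lambda>x y. F (s * x + t * y)" 0 "Suc 0"] by simp
  finally show ?thesis by (simp add: \<sigma>_def)
qed

lemma nn_integral_std_gaussian_combination:
  assumes F [measurable]: "F \<in> borel_measurable (vec_borel d)"
  shows "(\<integral>\<^sup>+x. \<integral>\<^sup>+y. F (\<lambda>j\<in>{..<d}. s * x j + t * y j) \<partial>std_gaussian d \<partial>std_gaussian d) =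
    (\<integral>\<^sup>+z. F (\<lambda>j\<in>{..<d}. sqrt (s\<^sup>2 + t\<^sup>2) * z j) \<partial>std_gaussian d)"
proof -
  let ?\<sigma> = "sqrt (s\<^sup>2 + t\<^sup>2)"
  define D where "D = distr gauss borel (\<lambda>x. ?\<sigma> * x)"
  have D1: "distr (gauss \<Otimes>\<^sub>M gauss) borel (\<lambda>z. s * fst z + t * snd z) = D"
    by (rule measure_eqI) (auto simp: D_def emeasure_distr_indicator nn_integral_gauss_combination)
  have D2: "distr (gauss \<Otimes>\<^sub>M gauss) borel (\<lambda>z. ?\<sigma> * fst z) = D"
    unfolding D1[symmetric]
  proof (rule measure_eqI)
    fix E assume "E \<in> sets (distr (gauss \<Otimes>\<^sub>M gauss) borel (\<lambda>z. ?\<sigma> * fst z))"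
    then have [measurable]: "E \<in> sets borel" by simp
    show "emeasure (distr (gauss \<Otimes>\<^sub>M gauss) borel (\<lambda>z. ?\<sigma> * fst z)) E =
      emeasure (distr (gauss \<Otimes>\<^sub>M gauss) borel (\<lambda>z. s * fst z + t * snd z)) E"
      using nn_integral_gauss_combination[of "indicator E" ?\<sigma> 0] nn_integral_gauss_combination[of "indicator E" s t]
      by (simp add: emeasure_distr_indicator)
  qed simp
  note zip = nn_integral_PiM_zip[where A="\<lambda>_. gauss" and B="\<lambda>_. gauss" and C="\<lambda>_. borel" and I="{..<d}" and D="\<lambda>_. D",
      OF _ prob_space_gauss prob_space_gauss]
  have "(\<integral>\<^sup>+x. \<integral>\<^sup>+y. F (\<lambda>j\<in>{..<d}. s * x j + t * y j) \<partial>std_gaussian d \<partial>std_gaussian d) =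
    (\<integral>\<^sup>+w. F w \<partial>PiM {..<d} (\<lambda>_. D))"
    unfolding std_gaussian_def
    by (subst zip[where f="\<lambda>_ z. s * fst z + t * snd z"]) (auto simp: D1)
  also have "\<dots> = (\<integral>\<^sup>+x. \<integral>\<^sup>+y. F (\<lambda>j\<in>{..<d}. ?\<sigma> * x j) \<partial>std_gaussian d \<partial>std_gaussian d)"
    unfolding std_gaussian_def
    by (subst zip[where f="\<lambda>_ z. ?\<sigma> * fst z"]) (auto simp: D2)
  also have "\<dots> = (\<integral>\<^sup>+z. F (\<lambda>j\<in>{..<d}. ?\<sigma> * z j) \<partial>std_gaussian d)"
    using prob_space.emeasure_space_1[OF prob_space_std_gaussian] by simp
  finally show ?thesis .
qed

text \<open>The variances add up, one row at a time.\<close>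

lemma nn_integral_gaussian_rows_combination:
  fixes n :: nat
  assumes F: "F \<in> borel_measurable (vec_borel d)"
  shows "(\<integral>\<^sup>+b. F (\<lambda>j\<in>{..<d}. \<Sum>i<n. v i * b i j) \<partial>PiM {..<n} (\<lambda>_. std_gaussian d)) =
    (\<integral>\<^sup>+z. F (\<lambda>j\<in>{..<d}. sqrt (\<Sum>i<n. (v i)\<^sup>2) * z j) \<partial>std_gaussian d)"
  using F
proof (induction n arbitrary: F)
  case 0
  show ?case
    using prob_space.emeasure_space_1[OF prob_space_std_gaussian]
    by (simp add: PiM_empty nn_integral_count_space_finite)
next
  case (Suc n)
  note [measurable] = Suc.prems
  let ?G = "std_gaussian d"
  let ?s = "sqrt (\<Sum>i<n. (v i)\<^sup>2)"
  interpret G: product_prob_space "\<lambda>_::nat. ?G" by (intro product_prob_spaceI prob_space_std_gaussian)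
  have ins: "{..<Suc n} = insert n {..<n}" by auto
  have "(\<integral>\<^sup>+b. F (\<lambda>j\<in>{..<d}. \<Sum>i<Suc n. v i * b i j) \<partial>PiM {..<Suc n} (\<lambda>_. ?G)) =
    (\<integral>\<^sup>+y. \<integral>\<^sup>+x. F (\<lambda>j\<in>{..<d}. \<Sum>i\<in>insert n {..<n}. v i * (x(n := y)) i j) \<partial>PiM {..<n} (\<lambda>_. ?G) \<partial>?G)"
    unfolding ins
  proof (rule G.product_nn_integral_insert_rev)
    have "(\<lambda>b. b i j) \<in> borel_measurable (PiM (insert n {..<n}) (\<lambda>_. ?G))" if "i \<in> insert n {..<n}" "j < d" for i j
    proof -
      have "(\<lambda>w. w j) \<in> borel_measurable ?G"
        using that(2) by (simp add: std_gaussian_def measurable_component_singleton)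
      then show ?thesis by (rule measurable_compose[OF measurable_component_singleton[OF that(1)]])
    qed
    then have "(\<lambda>b. \<lambda>j\<in>{..<d}. \<Sum>i\<in>insert n {..<n}. v i * b i j) \<in> PiM (insert n {..<n}) (\<lambda>_. ?G) \<rightarrow>\<^sub>M vec_borel d"
      by (intro measurable_restrict borel_measurable_sum borel_measurable_times) auto
    then show "(\<lambda>b. F (\<lambda>j\<in>{..<d}. \<Sum>i\<in>insert n {..<n}. v i * b i j)) \<in> borel_measurable (PiM (insert n {..<n}) (\<lambda>_. ?G))"
      by measurable
  qed auto
  also have "\<dots> = (\<integral>\<^sup>+y. \<integral>\<^sup>+x. F (\<lambda>j\<in>{..<d}. (\<lambda>j\<in>{..<d}. \<Sum>i<n. v i * x i j) j + v n * y j) \<partial>PiM {..<n} (\<lambda>_. ?G) \<partial>?G)"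
    by (intro nn_integral_cong arg_cong[where f=F] restrict_ext) (auto simp: add.commute)
  also have "\<dots> = (\<integral>\<^sup>+y. \<integral>\<^sup>+z. F (\<lambda>j\<in>{..<d}. (\<lambda>j\<in>{..<d}. ?s * z j) j + v n * y j) \<partial>?G \<partial>?G)"
    by (intro nn_integral_cong Suc.IH[where F="\<lambda>w. F (\<lambda>j\<in>{..<d}. w j + v n * _ j)"]) measurable
  also have "\<dots> = (\<integral>\<^sup>+y. \<integral>\<^sup>+z. F (\<lambda>j\<in>{..<d}. v n * y j + ?s * z j) \<partial>?G \<partial>?G)"
    by (intro nn_integral_cong arg_cong[where f=F] restrict_ext) auto
  also have "\<dots> = (\<integral>\<^sup>+z. F (\<lambda>j\<in>{..<d}. sqrt ((v n)\<^sup>2 + ?s\<^sup>2) * z j) \<partial>?G)"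
    by (rule nn_integral_std_gaussian_combination) fact
  also have "(v n)\<^sup>2 + ?s\<^sup>2 = (\<Sum>i<Suc n. (v i)\<^sup>2)"
    by (simp add: sum_nonneg)
  finally show ?case .
qed

section \<open>Fourth moments\<close>

lemma (in prob_space) integrable_power_le_4:
  fixes X :: "'a \<Rightarrow> real"
  assumes [measurable]: "X \<in> borel_measurable M" and "integrable M (\<lambda>x. X x ^ 4)" and "k \<le> 4"
  shows "integrable M (\<lambda>x. X x ^ k)"
proof (rule Bochner_Integration.integrable_bound)
  show "integrable M (\<lambda>x. 1 + X x ^ 4)" using assms by simp
  have "\<bar>y ^ k\<bar> \<le> 1 + y ^ 4" for y :: real
  proof (cases "\<bar>y\<bar> \<le> 1")
    case True
    then have "\<bar>y\<bar> ^ k \<le> 1" by (intro power_le_one) auto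
    then show ?thesis by (simp add: power_abs add_increasing2)
  next
    case False
    then have "\<bar>y\<bar> ^ k \<le> \<bar>y\<bar> ^ 4" using assms by (intro power_increasing) auto
    then show ?thesis by (simp add: power_abs)
  qed
  then show "AE x in M. norm (X x ^ k) \<le> norm (1 + X x ^ 4)" by (simp add: abs_of_nonneg)
qed simp

lemma (in prob_space) fourth_moment_add:
  fixes X S :: "'a \<Rightarrow> real"
  assumes ind: "indep_var borel X borel S"
    and X4: "integrable M (\<lambda>x. X x ^ 4)" and S4: "integrable M (\<lambda>x. S x ^ 4)"
    and X1: "expectation X = 0" and S1: "expectation S = 0"
  shows "integrable M (\<lambda>x. (X x + S x) ^ 4)" "expectation (\<lambda>x. X x + S x) = 0"
    "expectation (\<lambda>x. (X x + S x)\<^sup>2) = expectation (\<lambda>x. (X x)\<^sup>2) + expectation (\<lambda>x. (S x)\<^sup>2)"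
    "expectation (\<lambda>x. (X x + S x) ^ 4) = expectation (\<lambda>x. X x ^ 4) +
      6 * expectation (\<lambda>x. (X x)\<^sup>2) * expectation (\<lambda>x. (S x)\<^sup>2) + expectation (\<lambda>x. S x ^ 4)"
proof -
  have [measurable]: "X \<in> borel_measurable M" "S \<in> borel_measurable M"
    using ind indep_var_rv1 indep_var_rv2 by blast+
  note iX = integrable_power_le_4[OF _ X4] and iS = integrable_power_le_4[OF _ S4]
  have ind': "indep_var borel (\<lambda>x. X x ^ k) borel (\<lambda>x. S x ^ l)" for k l
    using indep_var_compose[OF ind, of "\<lambda>x. x ^ k" borel "\<lambda>x. x ^ l" borel] by (simp add: comp_def)
  have int: "integrable M (\<lambda>x. X x ^ k * S x ^ l)" if "k \<le> 4" "l \<le> 4" for k l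
    using that by (intro indep_var_integrable[OF ind'] iX iS) auto
  have ex: "expectation (\<lambda>x. X x ^ k * S x ^ l) = expectation (\<lambda>x. X x ^ k) * expectation (\<lambda>x. S x ^ l)"
    if "k \<le> 4" "l \<le> 4" for k l
    using that by (intro indep_var_lebesgue_integral[OF ind'] iX iS) auto
  have e4: "(X x + S x) ^ 4 = X x ^ 4 + (4 * (X x ^ 3 * S x ^ 1) + (6 * (X x ^ 2 * S x ^ 2) + (4 * (X x ^ 1 * S x ^ 3) + S x ^ 4)))" for x
    by (simp add: power4_eq_xxxx power3_eq_cube power2_eq_square algebra_simps)
  have e2: "(X x + S x)\<^sup>2 = (X x)\<^sup>2 + (2 * (X x ^ 1 * S x ^ 1) + (S x)\<^sup>2)" for x
    by (simp add: power2_eq_square algebra_simps)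
  show "integrable M (\<lambda>x. (X x + S x) ^ 4)"
    unfolding e4 using X4 S4 by (intro Bochner_Integration.integrable_add integrable_mult_right int) auto
  show "expectation (\<lambda>x. X x + S x) = 0"
    using X1 S1 iX[of 1] iS[of 1] by simp
  show "expectation (\<lambda>x. (X x + S x)\<^sup>2) = expectation (\<lambda>x. (X x)\<^sup>2) + expectation (\<lambda>x. (S x)\<^sup>2)"
    unfolding e2 using iX[of 2] iS[of 2] int[of 1 1] ex[of 1 1] X1 S1 by simp
  show "expectation (\<lambda>x. (X x + S x) ^ 4) = expectation (\<lambda>x. X x ^ 4) +
      6 * expectation (\<lambda>x. (X x)\<^sup>2) * expectation (\<lambda>x. (S x)\<^sup>2) + expectation (\<lambda>x. S x ^ 4)"
    unfolding e4 using X4 S4 int[of 3 1] int[of 2 2] int[of 1 3] ex[of 3 1] ex[of 2 2] ex[of 1 3] X1 S1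
    by simp
qed

text \<open>Because of centring, adding an independent \<open>X\<close> to a sum \<open>S\<close> adds \<open>6 E[X\<^sup>2] E[S\<^sup>2] + E[X\<^sup>4]\<close> to the
fourth moment. The bound \<open>3 s\<^sup>2 + k\<close> on fourth moments is stable under this, with \<open>s\<close> and \<open>k\<close> additive. Gaussian
variables satisfy it with \<open>k = 0\<close>.\<close>

lemma (in prob_space) indep_sum_fourth_moment:
  fixes X :: "'i \<Rightarrow> 'a \<Rightarrow> real"
  assumes "finite I" "indep_vars (\<lambda>_. borel) X I"
    and "\<And>i. i \<in> I \<Longrightarrow> integrable M (\<lambda>x. X i x ^ 4)" "\<And>i. i \<in> I \<Longrightarrow> expectation (X i) = 0"
    and "\<And>i. i \<in> I \<Longrightarrow> expectation (\<lambda>x. (X i x)\<^sup>2) = s i"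
    and "\<And>i. i \<in> I \<Longrightarrow> expectation (\<lambda>x. X i x ^ 4) \<le> 3 * (s i)\<^sup>2 + k i"
  shows "integrable M (\<lambda>x. (\<Sum>i\<in>I. X i x) ^ 4)" (is "?int I")
    "expectation (\<lambda>x. (\<Sum>i\<in>I. X i x) ^ 4) \<le> 3 * (\<Sum>i\<in>I. s i)\<^sup>2 + (\<Sum>i\<in>I. k i)" (is "?le I")
proof -
  let ?e1 = "\<lambda>I. expectation (\<lambda>x. \<Sum>i\<in>I. X i x) = 0"
  let ?e2 = "\<lambda>I. expectation (\<lambda>x. (\<Sum>i\<in>I. X i x)\<^sup>2) = (\<Sum>i\<in>I. s i)"
  have "?int I \<and> ?e1 I \<and> ?e2 I \<and> ?le I"
    using assms
  proof (induction I rule: finite_induct)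
    case (insert i I)
    have IH: "?int I" "?e1 I" "?e2 I" "?le I"
      using insert.IH indep_vars_subset[OF insert.prems(1), of I] insert.prems by auto
    have ind: "indep_var borel (X i) borel (\<lambda>x. \<Sum>i\<in>I. X i x)"
      using insert.hyps insert.prems(1) by (rule indep_vars_sum)
    note add = fourth_moment_add[OF ind insert.prems(2)[OF insertI1] IH(1) insert.prems(3)[OF insertI1] IH(2)]
    have "(3 * (s i)\<^sup>2 + k i) + 6 * s i * (\<Sum>i\<in>I. s i) + (3 * (\<Sum>i\<in>I. s i)\<^sup>2 + (\<Sum>i\<in>I. k i)) =
      3 * (s i + (\<Sum>i\<in>I. s i))\<^sup>2 + (k i + (\<Sum>i\<in>I. k i))"
      by (simp add: power2_eq_square algebra_simps)
    then show ?case
      using add IH insert.hyps insert.prems(4)[OF insertI1] insert.prems(5)[OF insertI1] by simp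
  qed simp
  then show "?int I" "?le I" by auto
qed

lemma indep_vars_PiM_components:
  assumes "finite I" and N: "\<And>i. prob_space (N i)" and f: "\<And>i. i \<in> I \<Longrightarrow> f i \<in> N i \<rightarrow>\<^sub>M C i"
  shows "prob_space.indep_vars (PiM I N) C (\<lambda>i x. f i (x i)) I"
proof -
  interpret P: prob_space "PiM I N" by (intro prob_space_PiM N)
  have "P.indep_vars N (\<lambda>i x. x i) I"
  proof (cases "I = {}")
    case True then show ?thesis unfolding P.indep_vars_def P.indep_sets_def by auto
  next
    case False
    have "distr (PiM I N) (PiM I N) (\<lambda>x. \<lambda>i\<in>I. x i) = distr (PiM I N) (PiM I N) (\<lambda>x. x)"
      by (intro distr_cong) (auto simp: space_PiM)
    moreover have "PiM I (\<lambda>i. distr (PiM I N) (N i) (\<lambda>x. x i)) = PiM I N"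
      by (intro PiM_cong refl distr_PiM_component N \<open>finite I\<close>)
    ultimately show ?thesis
      using False by (subst P.indep_vars_iff_distr_eq_PiM') (auto simp: distr_id2)
  qed
  from P.indep_vars_compose2[OF this f] show ?thesis .
qed

lemma integral_PiM_component:
  fixes g :: "'a \<Rightarrow> real"
  assumes "finite I" "\<And>i. prob_space (N i)" "i \<in> I" "g \<in> borel_measurable (N i)"
  shows "(LINT x|PiM I N. g (x i)) = (LINT y|N i. g y)" "integrable (PiM I N) (\<lambda>x. g (x i)) \<longleftrightarrow> integrable (N i) g"
proof -
  have D: "distr (PiM I N) (N i) (\<lambda>x. x i) = N i"
    by (rule distr_PiM_component) (use assms in auto)
  have m: "(\<lambda>x. x i) \<in> PiM I N \<rightarrow>\<^sub>M N i" using assms by measurable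
  show "(LINT x|PiM I N. g (x i)) = (LINT y|N i. g y)"
    using integral_distr[OF m, of g] assms by (simp add: D)
  show "integrable (PiM I N) (\<lambda>x. g (x i)) \<longleftrightarrow> integrable (N i) g"
    using integrable_distr_eq[OF m, of g] assms by (simp add: D)
qed

lemma PiM_sum_fourth_moment:
  fixes f :: "'i \<Rightarrow> 'a \<Rightarrow> real"
  assumes I: "finite I" and N: "\<And>i. prob_space (N i)" and f: "\<And>i. i \<in> I \<Longrightarrow> f i \<in> borel_measurable (N i)"
    and f4: "\<And>i. i \<in> I \<Longrightarrow> integrable (N i) (\<lambda>x. f i x ^ 4)" and f1: "\<And>i. i \<in> I \<Longrightarrow> (LINT x|N i. f i x) = 0"
    and f2: "\<And>i. i \<in> I \<Longrightarrow> (LINT x|N i. (f i x)\<^sup>2) = s i"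
    and "\<And>i. i \<in> I \<Longrightarrow> (LINT x|N i. f i x ^ 4) \<le> 3 * (s i)\<^sup>2 + k i"
  shows "integrable (PiM I N) (\<lambda>x. (\<Sum>i\<in>I. f i (x i)) ^ 4)"
    "(LINT x|PiM I N. (\<Sum>i\<in>I. f i (x i)) ^ 4) \<le> 3 * (\<Sum>i\<in>I. s i)\<^sup>2 + (\<Sum>i\<in>I. k i)"
proof -
  interpret P: prob_space "PiM I N" by (intro prob_space_PiM N)
  note c = integral_PiM_component[OF I N]
  have e: "(LINT x|PiM I N. (f i (x i)) ^ m) = (LINT y|N i. f i y ^ m)"
    "integrable (PiM I N) (\<lambda>x. f i (x i) ^ m) \<longleftrightarrow> integrable (N i) (\<lambda>y. f i y ^ m)" if "i \<in> I" for i m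
    using c[OF that, of "\<lambda>y. f i y ^ m"] f[OF that] by auto
  note * = P.indep_sum_fourth_moment[OF I indep_vars_PiM_components[OF I N f], where s=s and k=k]
  show "integrable (PiM I N) (\<lambda>x. (\<Sum>i\<in>I. f i (x i)) ^ 4)"
    "(LINT x|PiM I N. (\<Sum>i\<in>I. f i (x i)) ^ 4) \<le> 3 * (\<Sum>i\<in>I. s i)\<^sup>2 + (\<Sum>i\<in>I. k i)"
    using assms e e(1)[of _ 1, unfolded power_one_right] by (auto intro!: *)
qed

lemma
  shows integrable_gauss_power: "integrable gauss (\<lambda>x. x ^ k)"
    and gauss_odd: "odd k \<Longrightarrow> (LINT x|gauss. x ^ k) = 0"
    and gauss_even: "(LINT x|gauss. x ^ (2 * j)) = fact (2 * j) / (2 ^ j * fact j)"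
proof -
  have i: "integrable lborel (\<lambda>x. std_normal_density x * x ^ k)" for k
    using integrable_normal_moment[of 1 0 k] by simp
  then show "integrable gauss (\<lambda>x. x ^ k)" by (subst integrable_density) auto
  show "(LINT x|gauss. x ^ k) = 0" if "odd k"
    using that integral_normal_moment_odd[of 1 0 "k div 2"] by (subst integral_density) auto
  show "(LINT x|gauss. x ^ (2 * j)) = fact (2 * j) / (2 ^ j * fact j)"
    using integral_normal_moment_even[of 1 0 j] by (subst integral_density) auto
qed

lemma gauss_moments:
  "(LINT x|gauss. x) = 0" "(LINT x|gauss. x\<^sup>2) = 1" "(LINT x|gauss. x ^ 4) = 3"
  "(LINT x|gauss. x ^ 6) = 15" "(LINT x|gauss. x ^ 8) = 105"
  using gauss_odd[of 1] gauss_even[of 1] gauss_even[of 2] gauss_even[of 3] gauss_even[of 4]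
  by (simp_all add: fact_numeral)

lemma ip_self_eq_0_iff: "ip d c c = 0 \<longleftrightarrow> (\<forall>j<d. c j = 0)"
  unfolding ip_def by (subst sum_nonneg_eq_0_iff) auto

text \<open>For \<open>c \<noteq> 0\<close> normalise \<open>c\<close> and use the law of the component along a unit vector.\<close>

lemma distr_ip_std_gaussian:
  "distr (std_gaussian d) borel (\<lambda>b. ip d b c) = distr gauss borel (\<lambda>x. sqrt (ip d c c) * x)"
proof (rule measure_eqI)
  fix E assume "E \<in> sets (distr (std_gaussian d) borel (\<lambda>b. ip d b c))"
  then have E [measurable]: "E \<in> sets borel" by simp
  let ?s = "sqrt (ip d c c)"
  have nn: "0 \<le> ip d c c" unfolding ip_def by (intro sum_nonneg) auto
  have "(\<integral>\<^sup>+b. indicator E (ip d b c) \<partial>std_gaussian d) = (\<integral>\<^sup>+x. indicator E (?s * x) \<partial>gauss)"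
  proof (cases "?s = 0")
    case True
    then have "\<forall>j<d. c j = 0" by (simp add: ip_self_eq_0_iff)
    then have "ip d b c = 0" for b by (simp add: ip_def)
    with True show ?thesis
      using prob_space.emeasure_space_1[OF prob_space_std_gaussian] prob_space.emeasure_space_1[OF prob_space_gauss] by simp
  next
    case False
    define u where "u = (\<lambda>j. (1 / ?s) * c j)"
    have "ip d u u = ip d c c / ?s\<^sup>2"
      unfolding u_def ip_scale_left ip_scale_right by (simp add: power2_eq_square)
    then have u: "ip d u u = 1" using False nn by simp
    have su: "?s * ip d b u = ip d b c" for b unfolding u_def ip_scale_right using False by simp
    have "(\<lambda>x. indicator E (?s * x) :: ennreal) \<in> borel_measurable borel" by measurable
    from nn_integral_ip_std_gaussian[OF u this] show ?thesis unfolding su .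
  qed
  then show "emeasure (distr (std_gaussian d) borel (\<lambda>b. ip d b c)) E = emeasure (distr gauss borel (\<lambda>x. ?s * x)) E"
    by (simp add: emeasure_distr_indicator)
qed simp

lemma ip_std_gaussian_moments:
  shows integrable_ip_std_gaussian: "integrable (std_gaussian d) (\<lambda>b. ip d b c ^ k)"
    and "(LINT b|std_gaussian d. ip d b c) = 0"
    and "(LINT b|std_gaussian d. (ip d b c)\<^sup>2) = ip d c c"
    and "(LINT b|std_gaussian d. ip d b c ^ 4) = 3 * (ip d c c)\<^sup>2"
proof -
  let ?s = "sqrt (ip d c c)"
  have nn: "0 \<le> ip d c c" unfolding ip_def by (intro sum_nonneg) auto
  have [measurable]: "(\<lambda>b. ip d b c) \<in> borel_measurable (std_gaussian d)" by measurable
  have e: "(LINT b|std_gaussian d. ip d b c ^ k) = ?s ^ k * (LINT x|gauss. x ^ k)" for k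
  proof -
    have "(LINT b|std_gaussian d. ip d b c ^ k) = (LINT x|distr (std_gaussian d) borel (\<lambda>b. ip d b c). x ^ k)"
      by (subst integral_distr) auto
    also have "\<dots> = ?s ^ k * (LINT x|gauss. x ^ k)"
      unfolding distr_ip_std_gaussian by (subst integral_distr) (auto simp: power_mult_distrib)
    finally show ?thesis .
  qed
  have "integrable (distr gauss borel (\<lambda>x. ?s * x)) (\<lambda>x. x ^ k)"
    by (subst integrable_distr_eq) (auto simp: power_mult_distrib integrable_gauss_power)
  then show "integrable (std_gaussian d) (\<lambda>b. ip d b c ^ k)"
    unfolding distr_ip_std_gaussian[symmetric] by (subst (asm) integrable_distr_eq) auto
  show "(LINT b|std_gaussian d. ip d b c) = 0" using e[of 1] by (simp add: gauss_moments)
  show "(LINT b|std_gaussian d. (ip d b c)\<^sup>2) = ip d c c"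
    unfolding e[of 2] gauss_moments using nn by simp
  have "?s ^ 4 = (ip d c c)\<^sup>2" using nn by (simp add: power4_eq_xxxx power2_eq_square)
  then show "(LINT b|std_gaussian d. ip d b c ^ 4) = 3 * (ip d c c)\<^sup>2"
    unfolding e[of 4] gauss_moments by simp
qed

lemma gauss_square_deviation_moments:
  "(LINT x|gauss. x\<^sup>2 - 1) = 0" "(LINT x|gauss. (x\<^sup>2 - 1)\<^sup>2) = 2" "(LINT x|gauss. (x\<^sup>2 - 1) ^ 4) = 60"
  "integrable gauss (\<lambda>x. (x\<^sup>2 - 1) ^ 4)"
proof -
  have prob_space: "measure gauss UNIV = 1" using prob_space.prob_space[OF prob_space_gauss] by simp
  note i = integrable_gauss_power
  have c: "integrable gauss (\<lambda>_. c)" for c :: real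
    by (intro finite_measure.integrable_const prob_space.finite_measure prob_space_gauss)
  have e2: "(x\<^sup>2 - 1)\<^sup>2 = x ^ 4 - 2 * x\<^sup>2 + 1" for x :: real
    by (simp add: power2_eq_square power4_eq_xxxx algebra_simps)
  have e4: "(x\<^sup>2 - 1) ^ 4 = x ^ 8 - 4 * x ^ 6 + 6 * x ^ 4 - 4 * x\<^sup>2 + 1" for x :: real
  proof -
    have "(y - 1) ^ 4 = y ^ 4 - 4 * y ^ 3 + 6 * y\<^sup>2 - 4 * y + 1" for y :: real
      by (simp add: power4_eq_xxxx power3_eq_cube power2_eq_square algebra_simps)
    from this[of "x\<^sup>2"] show ?thesis unfolding power_mult[symmetric] by simp
  qed
  show "(LINT x|gauss. x\<^sup>2 - 1) = 0" using prob_space by (simp add: i c gauss_moments)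
  show "(LINT x|gauss. (x\<^sup>2 - 1)\<^sup>2) = 2" unfolding e2 using prob_space by (simp add: i c gauss_moments)
  show "(LINT x|gauss. (x\<^sup>2 - 1) ^ 4) = 60" unfolding e4 using prob_space by (simp add: i c gauss_moments)
  show "integrable gauss (\<lambda>x. (x\<^sup>2 - 1) ^ 4)" unfolding e4 by (simp add: i c)
qed

text \<open>The squared norm exceeds \<open>d\<close> by a sum of the centred variables \<open>z\<^sub>j\<^sup>2 - 1\<close>, which have variance \<open>2\<close> and
fourth moment \<open>60 = 3 \<cdot> 2\<^sup>2 + 48\<close>.\<close>

lemma std_gaussian_norm_moment:
  shows "integrable (std_gaussian d) (\<lambda>z. (ip d z z - d) ^ 4)"
    and "(LINT z|std_gaussian d. (ip d z z - d) ^ 4) \<le> 60 * (real d)\<^sup>2"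
proof -
  note m = PiM_sum_fourth_moment[where I="{..<d}" and N="\<lambda>_. gauss" and f="\<lambda>j x. x\<^sup>2 - 1" and s="\<lambda>j. 2"
      and k="\<lambda>_. 48", OF _ prob_space_gauss]
  have e: "ip d z z - d = (\<Sum>j<d. (z j)\<^sup>2 - 1)" for z
    by (simp add: ip_def power2_eq_square sum_subtractf)
  show "integrable (std_gaussian d) (\<lambda>z. (ip d z z - d) ^ 4)"
    unfolding std_gaussian_def e by (rule m) (simp_all add: gauss_square_deviation_moments)
  have "(LINT z|std_gaussian d. (ip d z z - d) ^ 4) \<le> 3 * (\<Sum>j<d. 2)\<^sup>2 + (\<Sum>j<d. 48)"
    unfolding std_gaussian_def e by (rule m) (simp_all add: gauss_square_deviation_moments)
  also have "\<dots> \<le> 60 * (real d)\<^sup>2"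
    by (cases d) (simp_all add: power2_eq_square algebra_simps)
  finally show "(LINT z|std_gaussian d. (ip d z z - d) ^ 4) \<le> 60 * (real d)\<^sup>2" .
qed

lemma gaussian_rows_linear_form_moment:
  fixes n :: nat and c :: "nat \<Rightarrow> nat \<Rightarrow> real"
  shows "integrable (PiM {..<n} (\<lambda>_. std_gaussian d)) (\<lambda>b. (\<Sum>i<n. ip d (b i) (c i)) ^ 4)"
    and "(LINT b|PiM {..<n} (\<lambda>_. std_gaussian d). (\<Sum>i<n. ip d (b i) (c i)) ^ 4) \<le> 3 * (\<Sum>i<n. ip d (c i) (c i))\<^sup>2"
proof -
  note m = PiM_sum_fourth_moment[where I="{..<n}" and N="\<lambda>_. std_gaussian d" and f="\<lambda>i b. ip d b (c i)"
      and s="\<lambda>i. ip d (c i) (c i)" and k="\<lambda>_. 0", OF _ prob_space_std_gaussian]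
  show "integrable (PiM {..<n} (\<lambda>_. std_gaussian d)) (\<lambda>b. (\<Sum>i<n. ip d (b i) (c i)) ^ 4)"
    by (rule m) (auto simp: ip_std_gaussian_moments)
  have "(LINT b|PiM {..<n} (\<lambda>_. std_gaussian d). (\<Sum>i<n. ip d (b i) (c i)) ^ 4) \<le>
    3 * (\<Sum>i<n. ip d (c i) (c i))\<^sup>2 + (\<Sum>i<n. 0)"
    by (rule m) (auto simp: ip_std_gaussian_moments)
  then show "(LINT b|PiM {..<n} (\<lambda>_. std_gaussian d). (\<Sum>i<n. ip d (b i) (c i)) ^ 4) \<le> 3 * (\<Sum>i<n. ip d (c i) (c i))\<^sup>2"
    by simp
qed

section \<open>Tails of averages of independent variables\<close>

text \<open>The Borel-Cantelli lemma, applied for every \<open>e = 1 / Suc k\<close>. Index \<open>0\<close> is left out because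
nothing is known about an instance of dimension \<open>0\<close>.\<close>

lemma (in prob_space) AE_tendsto_zero_if_tails_summable:
  fixes Y :: "nat \<Rightarrow> 'a \<Rightarrow> real"
  assumes Y: "\<And>d. 0 < d \<Longrightarrow> Y d \<in> borel_measurable M"
    and p: "\<And>e. 0 < e \<Longrightarrow> \<exists>p. summable p \<and> (\<forall>\<^sub>F d in sequentially. prob {\<omega>\<in>space M. e < \<bar>Y d \<omega>\<bar>} \<le> p d)"
  shows "AE \<omega> in M. (\<lambda>d. Y d \<omega>) \<longlonglongrightarrow> 0"
proof -
  have "AE \<omega> in M. \<forall>\<^sub>F d in sequentially. \<bar>Y d \<omega>\<bar> \<le> 1 / Suc k" for k
  proof -
    define A where "A d = (if d = 0 then {} else {\<omega>\<in>space M. 1 / Suc k < \<bar>Y d \<omega>\<bar>})" for d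
    have A: "A d \<in> events" for d
      using Y[of d] by (auto simp: A_def intro!: measurable_sets_Collect)
    obtain p where p: "summable p" "\<forall>\<^sub>F d in sequentially. prob {\<omega>\<in>space M. 1 / Suc k < \<bar>Y d \<omega>\<bar>} \<le> p d"
      using p[of "1 / Suc k"] by auto
    have "summable (\<lambda>d. prob (A d))"
    proof (rule summable_comparison_test_ev[OF _ p(1)])
      show "\<forall>\<^sub>F d in sequentially. norm (prob (A d)) \<le> p d"
        using p(2) eventually_gt_at_top[of 0] by eventually_elim (simp add: A_def)
    qed
    then have "AE \<omega> in M. \<forall>\<^sub>F d in sequentially. \<omega> \<in> space M - A d"
      by (intro borel_cantelli_AE1 A) (simp_all add: emeasure_eq_measure)
    then show ?thesis
    proof (rule AE_mp, intro AE_I2 impI)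
      fix \<omega> assume "\<forall>\<^sub>F d in sequentially. \<omega> \<in> space M - A d"
      then show "\<forall>\<^sub>F d in sequentially. \<bar>Y d \<omega>\<bar> \<le> 1 / Suc k"
        using eventually_gt_at_top[of 0] by eventually_elim (auto simp: A_def)
    qed
  qed
  then have "AE \<omega> in M. \<forall>k. \<forall>\<^sub>F d in sequentially. \<bar>Y d \<omega>\<bar> \<le> 1 / Suc k"
    by (simp add: AE_all_countable)
  then show ?thesis
  proof (rule AE_mp, intro AE_I2 impI)
    fix \<omega> assume *: "\<forall>k. \<forall>\<^sub>F d in sequentially. \<bar>Y d \<omega>\<bar> \<le> 1 / Suc k"
    show "(\<lambda>d. Y d \<omega>) \<longlonglongrightarrow> 0"
    proof (rule tendstoI)
      fix e :: real assume "0 < e"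
      then obtain k where k: "1 / Suc k < e" using reals_Archimedean[of e] by (auto simp: inverse_eq_divide)
      from *[rule_format, of k] show "\<forall>\<^sub>F d in sequentially. dist (Y d \<omega>) 0 < e"
        by eventually_elim (use k in auto)
    qed
  qed
qed

definition truncated :: "real \<Rightarrow> ('b \<Rightarrow> real) \<Rightarrow> 'b \<Rightarrow> real" where
  "truncated T F t = (if \<bar>F t\<bar> \<le> T then F t else 0)"

lemma measurable_truncated [measurable]:
  assumes [measurable]: "F \<in> borel_measurable N"
  shows "truncated T F \<in> borel_measurable N"
  unfolding truncated_def[abs_def] by measurable

lemma (in prob_space) integral_square_le:
  fixes f :: "'a \<Rightarrow> real"
  assumes "integrable M f" "integrable M (\<lambda>x. (f x)\<^sup>2)"
  shows "(expectation f)\<^sup>2 \<le> expectation (\<lambda>x. (f x)\<^sup>2)"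
  using variance_positive[of f] variance_eq[OF assms] by simp

lemma (in prob_space) fourth_power_markov:
  fixes S :: "'a \<Rightarrow> real"
  assumes [measurable]: "S \<in> borel_measurable M" and "integrable M (\<lambda>x. S x ^ 4)" and "0 < c"
  shows "prob {x\<in>space M. c < \<bar>S x\<bar>} \<le> expectation (\<lambda>x. S x ^ 4) / c ^ 4"
proof -
  have "prob {x\<in>space M. c < \<bar>S x\<bar>} \<le> prob {x\<in>space M. c ^ 4 \<le> S x ^ 4}"
  proof (rule finite_measure_mono)
    show "{x\<in>space M. c < \<bar>S x\<bar>} \<subseteq> {x\<in>space M. c ^ 4 \<le> S x ^ 4}"
    proof safe
      fix x assume "c < \<bar>S x\<bar>"
      then have "c ^ 4 \<le> \<bar>S x\<bar> ^ 4" using \<open>0 < c\<close> by (intro power_mono) auto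
      then show "c ^ 4 \<le> S x ^ 4" by simp
    qed
  qed measurable
  also have "\<dots> \<le> expectation (\<lambda>x. S x ^ 4) / c ^ 4"
    using assms by (intro integral_Markov_inequality_measure[where A="{}"]) auto
  finally show ?thesis .
qed

text \<open>Outside of an event of probability at most \<open>n P(\<bar>F\<bar> > T)\<close> the truncation at level \<open>T\<close> changes none of the
\<open>n\<close> terms. The centred average of the truncated terms is treated by Markov's inequality for the fourth power, since
bounds by second moments, of order \<open>1 / n\<close>, would not be summable.\<close>

lemma mean_tail_bound:
  fixes F :: "'b \<Rightarrow> real"
  assumes N: "prob_space N" and F [measurable]: "F \<in> borel_measurable N" and n: "0 < n" and T: "0 < T" and e: "0 < e"
  shows "measure (PiM {..<n} (\<lambda>_. N)) {t\<in>space (PiM {..<n} (\<lambda>_. N)).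
      e < \<bar>(\<Sum>i<n. F (t i)) / real n - (LINT t|N. truncated T F t)\<bar>} \<le>
    real n * measure N {t\<in>space N. T < \<bar>F t\<bar>} +
    (16 * (LINT t|N. truncated T F t ^ 4) / real n ^ 3 + 3 * (LINT t|N. (truncated T F t)\<^sup>2)\<^sup>2 / (real n)\<^sup>2) / e ^ 4"
proof -
  interpret N: prob_space N by fact
  let ?P = "PiM {..<n} (\<lambda>_. N)"
  interpret P: prob_space ?P by (intro prob_space_PiM N)
  let ?f = "truncated T F"
  define m where "m = N.expectation ?f"
  define g where "g t = ?f t - m" for t
  have [measurable]: "g \<in> borel_measurable N" unfolding g_def by measurable
  have bf: "\<bar>?f t\<bar> \<le> T" for t using T by (simp add: truncated_def)
  have if_: "integrable N (\<lambda>t. ?f t ^ k)" for k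
    by (rule N.integrable_const_bound[where B="T ^ k"]) (auto simp: power_abs bf intro!: power_mono AE_I2)
  have bm: "\<bar>g t\<bar> \<le> T + \<bar>m\<bar>" for t using bf[of t] by (simp add: g_def)
  have ig: "integrable N (\<lambda>t. g t ^ k)" for k
    by (rule N.integrable_const_bound[where B="(T + \<bar>m\<bar>) ^ k"]) (auto simp: power_abs bm intro!: power_mono AE_I2)
  have if1: "integrable N ?f" using if_[of 1] by simp
  have g1: "N.expectation g = 0" unfolding g_def using if1 N.prob_space by (simp add: m_def)
  have "N.expectation (\<lambda>t. (g t)\<^sup>2) = N.expectation (\<lambda>t. (?f t)\<^sup>2) - m\<^sup>2"
    using N.variance_eq[OF if1 if_[of 2]] by (simp add: g_def m_def)
  then have g2: "N.expectation (\<lambda>t. (g t)\<^sup>2) \<le> N.expectation (\<lambda>t. (?f t)\<^sup>2)" by simp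
  have "m ^ 4 = (m\<^sup>2)\<^sup>2" by simp
  also have "\<dots> \<le> (N.expectation (\<lambda>t. (?f t)\<^sup>2))\<^sup>2"
    using N.integral_square_le[OF if1 if_[of 2]] by (intro power_mono) (auto simp: m_def)
  also have "\<dots> \<le> N.expectation (\<lambda>t. ((?f t)\<^sup>2)\<^sup>2)"
    using if_[of 4] by (intro N.integral_square_le if_) simp
  finally have m4: "m ^ 4 \<le> N.expectation (\<lambda>t. ?f t ^ 4)" by simp
  have pow: "(a - b) ^ 4 \<le> 8 * (a ^ 4 + b ^ 4)" for a b :: real
  proof -
    have 1: "(a - b)\<^sup>2 \<le> 2 * (a\<^sup>2 + b\<^sup>2)"
      using zero_le_power2[of "a + b"] by (simp add: power2_eq_square algebra_simps)
    have 2: "(a\<^sup>2 + b\<^sup>2)\<^sup>2 \<le> 2 * (a ^ 4 + b ^ 4)"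
      using zero_le_power2[of "a\<^sup>2 - b\<^sup>2"] by (simp add: power2_eq_square power4_eq_xxxx algebra_simps)
    have "((a - b)\<^sup>2)\<^sup>2 \<le> (2 * (a\<^sup>2 + b\<^sup>2))\<^sup>2" using 1 by (intro power_mono) auto
    then have "(a - b) ^ 4 \<le> 4 * (a\<^sup>2 + b\<^sup>2)\<^sup>2" unfolding power_mult_distrib[of 2] by simp
    then show ?thesis using 2 by simp
  qed
  have "N.expectation (\<lambda>t. g t ^ 4) \<le> N.expectation (\<lambda>t. 8 * (?f t ^ 4 + m ^ 4))"
    by (intro integral_mono ig integrable_mult_right Bochner_Integration.integrable_add if_ N.integrable_const)
       (unfold g_def, rule pow)
  also have "\<dots> \<le> 16 * N.expectation (\<lambda>t. ?f t ^ 4)"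
    using if_ N.prob_space m4 by simp
  finally have g4: "N.expectation (\<lambda>t. g t ^ 4) \<le> 16 * N.expectation (\<lambda>t. ?f t ^ 4)" .
  note mom = PiM_sum_fourth_moment[where I="{..<n}" and N="\<lambda>_. N" and f="\<lambda>_. g" and s="\<lambda>_. N.expectation (\<lambda>t. (g t)\<^sup>2)"
    and k="\<lambda>_. 16 * N.expectation (\<lambda>t. ?f t ^ 4)", OF _ N]
  have S4i: "integrable ?P (\<lambda>t. (\<Sum>i<n. g (t i)) ^ 4)"
    using g1 g4 by (intro mom) (auto simp: ig add_increasing)
  have "P.expectation (\<lambda>t. (\<Sum>i<n. g (t i)) ^ 4) \<le>
    3 * (\<Sum>i<n. N.expectation (\<lambda>t. (g t)\<^sup>2))\<^sup>2 + (\<Sum>i<n. 16 * N.expectation (\<lambda>t. ?f t ^ 4))"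
    using g1 g4 by (intro mom) (auto simp: ig add_increasing)
  also have "\<dots> \<le> 3 * (real n * N.expectation (\<lambda>t. (?f t)\<^sup>2))\<^sup>2 + real n * (16 * N.expectation (\<lambda>t. ?f t ^ 4))"
    using g2 by (auto intro!: power_mono mult_left_mono)
  finally have S4: "P.expectation (\<lambda>t. (\<Sum>i<n. g (t i)) ^ 4) \<le>
    3 * (real n * N.expectation (\<lambda>t. (?f t)\<^sup>2))\<^sup>2 + real n * (16 * N.expectation (\<lambda>t. ?f t ^ 4))" .
  have Fi [measurable]: "(\<lambda>t. F (t i)) \<in> borel_measurable ?P" "(\<lambda>t. g (t i)) \<in> borel_measurable ?P" if "i < n" for i
    using measurable_compose[OF measurable_component_singleton[of i "{..<n}" "\<lambda>_. N"]] F \<open>g \<in> borel_measurable N\<close> that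
    by auto
  have Ai: "{t\<in>space ?P. T < \<bar>F (t i)\<bar>} \<in> P.events" if "i < n" for i using Fi(1)[OF that] by measurable
  have [measurable]: "(\<lambda>t. \<Sum>i<n. g (t i)) \<in> borel_measurable ?P" by (intro borel_measurable_sum Fi) auto
  have pA: "P.prob {t\<in>space ?P. T < \<bar>F (t i)\<bar>} = N.prob {t\<in>space N. T < \<bar>F t\<bar>}" if "i < n" for i
  proof -
    have D: "distr ?P N (\<lambda>x. x i) = N"
      by (rule distr_PiM_component[of "{..<n}" "\<lambda>_. N"]) (use N that in auto)
    have "N.prob {t\<in>space N. T < \<bar>F t\<bar>} = measure (distr ?P N (\<lambda>x. x i)) {t\<in>space N. T < \<bar>F t\<bar>}"
      by (simp add: D)
    also have "\<dots> = P.prob ((\<lambda>x. x i) -` {t\<in>space N. T < \<bar>F t\<bar>} \<inter> space ?P)"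
      using that by (intro measure_distr) auto
    also have "(\<lambda>x. x i) -` {t\<in>space N. T < \<bar>F t\<bar>} \<inter> space ?P = {t\<in>space ?P. T < \<bar>F (t i)\<bar>}"
      using measurable_space[OF measurable_component_singleton[of i "{..<n}" "\<lambda>_. N"]] that by blast
    finally show ?thesis by (rule sym)
  qed
  have "P.prob {t\<in>space ?P. e < \<bar>(\<Sum>i<n. F (t i)) / real n - m\<bar>} \<le>
    P.prob ((\<Union>i\<in>{..<n}. {t\<in>space ?P. T < \<bar>F (t i)\<bar>}) \<union> {t\<in>space ?P. real n * e < \<bar>\<Sum>i<n. g (t i)\<bar>})"
  proof (rule P.finite_measure_mono)
    show "{t\<in>space ?P. e < \<bar>(\<Sum>i<n. F (t i)) / real n - m\<bar>} \<subseteq>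
      (\<Union>i\<in>{..<n}. {t\<in>space ?P. T < \<bar>F (t i)\<bar>}) \<union> {t\<in>space ?P. real n * e < \<bar>\<Sum>i<n. g (t i)\<bar>}"
    proof safe
      fix t assume t: "t \<in> space ?P" "e < \<bar>(\<Sum>i<n. F (t i)) / real n - m\<bar>"
        and "t \<notin> (\<Union>i\<in>{..<n}. {t\<in>space ?P. T < \<bar>F (t i)\<bar>})"
      then have "F (t i) = ?f (t i)" if "i < n" for i using that by (auto simp: truncated_def not_less)
      then have "(\<Sum>i<n. g (t i)) = real n * ((\<Sum>i<n. F (t i)) / real n - m)"
        using n by (simp add: g_def sum_subtractf right_diff_distrib)
      then show "real n * e < \<bar>\<Sum>i<n. g (t i)\<bar>" using t(2) n by (simp add: abs_mult)
    qed
    show "(\<Union>i\<in>{..<n}. {t\<in>space ?P. T < \<bar>F (t i)\<bar>}) \<union> {t\<in>space ?P. real n * e < \<bar>\<Sum>i<n. g (t i)\<bar>} \<in> P.events"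
      using Ai by (intro sets.Un sets.finite_UN) auto
  qed
  also have "\<dots> \<le> (\<Sum>i<n. P.prob {t\<in>space ?P. T < \<bar>F (t i)\<bar>}) + P.prob {t\<in>space ?P. real n * e < \<bar>\<Sum>i<n. g (t i)\<bar>}"
    using Ai by (intro order_trans[OF measure_Un_le] add_mono P.finite_measure_subadditive_finite) auto
  also have "\<dots> \<le> real n * N.prob {t\<in>space N. T < \<bar>F t\<bar>} + P.expectation (\<lambda>t. (\<Sum>i<n. g (t i)) ^ 4) / (real n * e) ^ 4"
    using n e by (intro add_mono P.fourth_power_markov S4i) (auto simp: pA)
  also have "\<dots> \<le> real n * N.prob {t\<in>space N. T < \<bar>F t\<bar>} +
    (3 * (real n * N.expectation (\<lambda>t. (?f t)\<^sup>2))\<^sup>2 + real n * (16 * N.expectation (\<lambda>t. ?f t ^ 4))) / (real n * e) ^ 4"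
    using n e by (intro add_left_mono divide_right_mono S4) auto
  also have "(3 * (real n * N.expectation (\<lambda>t. (?f t)\<^sup>2))\<^sup>2 + real n * (16 * N.expectation (\<lambda>t. ?f t ^ 4))) / (real n * e) ^ 4 =
    (16 * N.expectation (\<lambda>t. ?f t ^ 4) / real n ^ 3 + 3 * (N.expectation (\<lambda>t. (?f t)\<^sup>2))\<^sup>2 / (real n)\<^sup>2) / e ^ 4"
    using n e by (simp add: power4_eq_xxxx power3_eq_cube power2_eq_square field_simps)
  finally show ?thesis by (simp add: m_def)
qed

lemma mean_deviation_tail_bound:
  fixes F :: "'b \<Rightarrow> real"
  assumes N: "prob_space N" and F: "F \<in> borel_measurable N" and n: "0 < n" and T: "0 < T" and e: "0 < e"
    and close: "\<bar>(LINT t|N. truncated T F t) - (LINT t|N. F t)\<bar> < e / 2"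
  shows "measure (PiM {..<n} (\<lambda>_. N)) {t\<in>space (PiM {..<n} (\<lambda>_. N)).
      e < \<bar>(\<Sum>i<n. F (t i)) / real n - (LINT t|N. F t)\<bar>} \<le>
    real n * measure N {t\<in>space N. T < \<bar>F t\<bar>} +
    (16 * (LINT t|N. truncated T F t ^ 4) / real n ^ 3 + 3 * (LINT t|N. (truncated T F t)\<^sup>2)\<^sup>2 / (real n)\<^sup>2) / (e / 2) ^ 4"
proof -
  let ?P = "PiM {..<n} (\<lambda>_. N)"
  interpret P: prob_space ?P by (intro prob_space_PiM N)
  have "(\<lambda>t. F (t i)) \<in> borel_measurable ?P" if "i < n" for i
    using measurable_compose[OF measurable_component_singleton[of i "{..<n}" "\<lambda>_. N"] F] that by simp
  then have [measurable]: "(\<lambda>t. \<Sum>i<n. F (t i)) \<in> borel_measurable ?P" by (intro borel_measurable_sum) auto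
  have "P.prob {t\<in>space ?P. e < \<bar>(\<Sum>i<n. F (t i)) / real n - (LINT t|N. F t)\<bar>} \<le>
    P.prob {t\<in>space ?P. e / 2 < \<bar>(\<Sum>i<n. F (t i)) / real n - (LINT t|N. truncated T F t)\<bar>}"
  proof (rule P.finite_measure_mono)
    show "{t\<in>space ?P. e < \<bar>(\<Sum>i<n. F (t i)) / real n - (LINT t|N. F t)\<bar>} \<subseteq>
      {t\<in>space ?P. e / 2 < \<bar>(\<Sum>i<n. F (t i)) / real n - (LINT t|N. truncated T F t)\<bar>}"
    proof safe
      fix t assume "e < \<bar>(\<Sum>i<n. F (t i)) / real n - (LINT t|N. F t)\<bar>"
      then show "e / 2 < \<bar>(\<Sum>i<n. F (t i)) / real n - (LINT t|N. truncated T F t)\<bar>"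
        using close by linarith
    qed
  qed measurable
  also have "\<dots> \<le> real n * measure N {t\<in>space N. T < \<bar>F t\<bar>} +
    (16 * (LINT t|N. truncated T F t ^ 4) / real n ^ 3 + 3 * (LINT t|N. (truncated T F t)\<^sup>2)\<^sup>2 / (real n)\<^sup>2) / (e / 2) ^ 4"
    using T e by (intro mean_tail_bound N F n) auto
  finally show ?thesis .
qed

section \<open>Complete convergence of averages\<close>

text \<open>Used to sum moments of truncated variables over the truncation levels: the sum is taken inside the integral.\<close>

lemma summable_integrals:
  fixes f :: "nat \<Rightarrow> 'b \<Rightarrow> real"
  assumes f [measurable]: "\<And>d. f d \<in> borel_measurable N" and nn: "\<And>d x. 0 \<le> f d x"
    and g: "integrable N g" and le: "\<And>(n::nat) x. (\<Sum>d<n. f d x) \<le> g x"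
  shows "summable (\<lambda>d. LINT x|N. f d x)"
proof -
  have fi: "integrable N (f d)" for d
  proof (rule Bochner_Integration.integrable_bound[OF g f])
    have "f d x \<le> g x" for x
      using le[of x "Suc d"] sum_nonneg[of "{..<d}" "\<lambda>d. f d x"] nn by simp
    then show "AE x in N. norm (f d x) \<le> norm (g x)" using nn by (simp add: order.trans[OF _ abs_ge_self])
  qed
  show ?thesis
  proof (rule summableI_nonneg_bounded)
    show "0 \<le> (LINT x|N. f d x)" for d by (simp add: nn)
    show "(\<Sum>d<n. LINT x|N. f d x) \<le> (LINT x|N. g x)" for n
    proof -
      have "(\<Sum>d<n. LINT x|N. f d x) = (LINT x|N. (\<Sum>d<n. f d x))" by (simp add: fi)
      also have "\<dots> \<le> (LINT x|N. g x)" by (intro integral_mono g le Bochner_Integration.integrable_sum fi)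
      finally show ?thesis .
    qed
  qed
qed

lemma tendsto_integral_truncated:
  fixes F :: "'b \<Rightarrow> real"
  assumes F: "integrable N F" and T: "filterlim T at_top sequentially"
  shows "(\<lambda>d. LINT t|N. truncated (T d) F t) \<longlonglongrightarrow> (LINT t|N. F t)"
proof (rule integral_dominated_convergence[where w="\<lambda>t. \<bar>F t\<bar>"])
  have [measurable]: "F \<in> borel_measurable N" using F by simp
  show "F \<in> borel_measurable N" "truncated (T d) F \<in> borel_measurable N" for d by measurable
  show "integrable N (\<lambda>t. \<bar>F t\<bar>)" using F by simp
  show "AE t in N. norm (truncated (T d) F t) \<le> \<bar>F t\<bar>" for d by (simp add: truncated_def)
  show "AE t in N. (\<lambda>d. truncated (T d) F t) \<longlonglongrightarrow> F t"
  proof (intro AE_I2 tendsto_eventually)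
    fix t
    have "\<forall>\<^sub>F d in sequentially. \<bar>F t\<bar> \<le> T d" using T by (simp add: filterlim_at_top)
    then show "\<forall>\<^sub>F d in sequentially. truncated (T d) F t = F t"
      by eventually_elim (simp add: truncated_def)
  qed
qed

text \<open>Telescoping: beyond the level \<open>x\<close> the weights are dominated by the decrements of \<open>G\<close>.\<close>

lemma sum_above_level_le:
  fixes T w :: "nat \<Rightarrow> real" and G :: "real \<Rightarrow> real"
  assumes T: "mono T" and w: "\<And>d. 0 < T d \<Longrightarrow> w d \<le> G (T d) - G (T (Suc d))"
    and G: "\<And>a b. 0 < a \<Longrightarrow> a \<le> b \<Longrightarrow> G b \<le> G a" "\<And>a. 0 < a \<Longrightarrow> 0 \<le> G a" and x: "0 < x"
  shows "(\<Sum>d<n. if x \<le> T d then w d else 0) \<le> G x"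
proof -
  have "(\<Sum>d<n. if x \<le> T d then w d else 0) \<le> G x - G (max x (T n))"
  proof (induction n)
    case 0 then show ?case using x by (simp add: G)
  next
    case (Suc n)
    have le: "T n \<le> T (Suc n)" using T by (simp add: mono_def)
    show ?case
    proof (cases "x \<le> T n")
      case True
      then show ?thesis using Suc w[of n] x le by (simp add: max_def)
    next
      case False
      then have "G (max x (T (Suc n))) \<le> G (max x (T n))" using le x by (intro G) auto
      then show ?thesis using Suc False by simp
    qed
  qed
  moreover have "0 \<le> G (max x (T n))" using x by (intro G) auto
  ultimately show ?thesis by simp
qed

lemma integral_truncated_power_le:
  fixes F :: "'b \<Rightarrow> real"
  assumes N: "prob_space N" and [measurable]: "F \<in> borel_measurable N" and T: "0 \<le> T"
  shows "integrable N (\<lambda>t. \<bar>truncated T F t\<bar> ^ k)"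
    and "(LINT t|N. \<bar>truncated T F t\<bar> ^ (k + l)) \<le> T ^ k * (LINT t|N. \<bar>truncated T F t\<bar> ^ l)"
proof -
  interpret prob_space N by fact
  have b: "\<bar>truncated T F t\<bar> \<le> T" for t using T by (simp add: truncated_def)
  show i: "integrable N (\<lambda>t. \<bar>truncated T F t\<bar> ^ k)" for k
    by (rule integrable_const_bound[where B="T ^ k"]) (auto simp: power_abs b intro!: power_mono AE_I2)
  have "(LINT t|N. \<bar>truncated T F t\<bar> ^ (k + l)) \<le> (LINT t|N. T ^ k * \<bar>truncated T F t\<bar> ^ l)"
    unfolding power_add
    by (intro integral_mono integrable_mult_right i mult_right_mono power_mono b)
       (simp_all add: i flip: power_add)
  then show "(LINT t|N. \<bar>truncated T F t\<bar> ^ (k + l)) \<le> T ^ k * (LINT t|N. \<bar>truncated T F t\<bar> ^ l)" by simp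
qed

lemma tail_probability_as_integral:
  fixes F :: "'b \<Rightarrow> real"
  assumes [measurable]: "F \<in> borel_measurable N"
  shows "c * measure N {t\<in>space N. T < \<bar>F t\<bar>} = (LINT t|N. (if T < \<bar>F t\<bar> then c else 0))"
proof -
  have "(LINT t|N. (if T < \<bar>F t\<bar> then c else 0)) = (LINT t|N. c * indicator {t\<in>space N. T < \<bar>F t\<bar>} t)"
    by (intro Bochner_Integration.integral_cong refl) (auto simp: indicator_def)
  then show ?thesis by simp
qed

lemma truncated_fourth_moment_bound_mono:
  fixes r2 r4 s n m e :: real
  assumes "0 < m" "m \<le> n" "r2 \<le> s" "0 \<le> r2" "0 \<le> r4" "0 < e"
  shows "(16 * r4 / n ^ 3 + 3 * r2\<^sup>2 / n\<^sup>2) / e ^ 4 \<le> (16 * r4 / m ^ 3 + 3 * s\<^sup>2 / m\<^sup>2) / e ^ 4"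
proof -
  have "m ^ 3 \<le> n ^ 3" "m\<^sup>2 \<le> n\<^sup>2" "r2\<^sup>2 \<le> s\<^sup>2" using assms by (auto intro: power_mono)
  then have "16 * r4 / n ^ 3 \<le> 16 * r4 / m ^ 3" "3 * r2\<^sup>2 / n\<^sup>2 \<le> 3 * s\<^sup>2 / m\<^sup>2"
    using assms by (simp_all add: frac_le)
  then show ?thesis by (intro divide_right_mono add_mono) auto
qed

text \<open>The theorem of Hsu and Robbins, for sample sizes comparable to \<open>d\<close>. The terms are truncated at
level \<open>d\<close> and not at \<open>n d\<close>: then repeated values of \<open>n\<close> do no harm. By exchanging sum and expectation,
\<open>\<Sum>d. d P(\<bar>F\<bar> > d)\<close> and \<open>\<Sum>d. d\<^sup>-\<^sup>3 E[F\<^sup>4; \<bar>F\<bar> \<le> d]\<close> are finite as soon as \<open>F\<close> is square integrable.\<close>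

lemma complete_convergence_of_means:
  fixes F :: "'b \<Rightarrow> real" and n :: "nat \<Rightarrow> nat"
  assumes N: "prob_space N" and F [measurable]: "F \<in> borel_measurable N" and F2: "integrable N (\<lambda>t. (F t)\<^sup>2)"
    and c: "0 < c" and n: "\<forall>\<^sub>F d in sequentially. c * real d \<le> real (n d) \<and> real (n d) \<le> C * real d" and e: "0 < e"
  shows "\<exists>p. summable p \<and> (\<forall>\<^sub>F d in sequentially. measure (PiM {..<n d} (\<lambda>_. N))
    {t\<in>space (PiM {..<n d} (\<lambda>_. N)). e < \<bar>(\<Sum>i<n d. F (t i)) / real (n d) - (LINT t|N. F t)\<bar>} \<le> p d)"
proof -
  interpret N: prob_space N by fact
  have Fi: "integrable N F" using F2 by (rule N.square_integrable_imp_integrable[rotated]) simp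
  let ?q = "\<lambda>d. N.prob {t\<in>space N. real d < \<bar>F t\<bar>}"
  let ?r = "\<lambda>d k. LINT t|N. truncated (real d) F t ^ k"
  let ?s = "LINT t|N. (F t)\<^sup>2"
  define p where "p d = C * (real d * ?q d) + (16 * (?r d 4 / real d ^ 3) / c ^ 3 + 3 * ?s\<^sup>2 * (1 / (real d)\<^sup>2) / c\<^sup>2) / (e / 2) ^ 4" for d
  have "summable (\<lambda>d. real d * ?q d)"
    unfolding tail_probability_as_integral[OF F]
  proof (rule summable_integrals)
    show "integrable N (\<lambda>t. \<bar>F t\<bar> * (\<bar>F t\<bar> + 1))"
      using F2 Fi by (simp add: distrib_left flip: power2_eq_square)
    fix m t
    have "(\<Sum>d<m. if real d < x then real d else 0) \<le> x * min (x + 1) (real m)" if "0 \<le> x" for x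
    proof (induction m)
      case 0 then show ?case using that by simp
    next
      case (Suc m)
      have "x * min (x + 1) (real m) \<le> x * min (x + 1) (real (Suc m))" using that by (intro mult_left_mono) auto
      moreover have "x * min (x + 1) (real m) + real m \<le> x * min (x + 1) (real (Suc m))" if "real m < x"
        using that by (simp add: distrib_left min_def)
      ultimately show ?case using Suc by (cases "real m < x") simp_all
    qed
    from this[of "\<bar>F t\<bar>"] show "(\<Sum>d<m. if real d < \<bar>F t\<bar> then real d else 0) \<le> \<bar>F t\<bar> * (\<bar>F t\<bar> + 1)"
      by (rule order.trans[OF _ mult_left_mono]) auto
  qed auto
  moreover have "summable (\<lambda>d. ?r d 4 / real d ^ 3)"
  proof -
    have "summable (\<lambda>d. LINT t|N. (if \<bar>F t\<bar> \<le> real d then F t ^ 4 * (1 / real d ^ 3) else 0))"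
    proof (rule summable_integrals)
      show "integrable N (\<lambda>t. 2 * (F t)\<^sup>2)" using F2 by simp
      fix m t
      show "(\<Sum>d<m. if \<bar>F t\<bar> \<le> real d then F t ^ 4 * (1 / real d ^ 3) else 0) \<le> 2 * (F t)\<^sup>2"
      proof (cases "F t = 0")
        case True then show ?thesis by (simp cong: if_cong)
      next
        case False
        have "(\<Sum>d<m. if \<bar>F t\<bar> \<le> real d then 1 / real d ^ 3 else 0) \<le> 2 / \<bar>F t\<bar>\<^sup>2"
        proof (rule sum_above_level_le[where G="\<lambda>x. 2 / x\<^sup>2"])
          fix d assume "0 < real d"
          then have d: "1 \<le> real d" by simp
          define y where "y = real d"
          have y: "1 \<le> y" using d by (simp add: y_def)
          have "2 / y\<^sup>2 - 2 / (y + 1)\<^sup>2 - 1 / y ^ 3 = (2 * y * (2 * y + 1) - (y + 1)\<^sup>2) / (y ^ 3 * (y + 1)\<^sup>2)"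
            using y by (simp add: divide_simps) (simp add: algebra_simps power2_eq_square power3_eq_cube)
          also have "\<dots> \<ge> 0"
            using y mult_mono[OF y y] by (intro divide_nonneg_pos mult_pos_pos) (simp_all add: power2_eq_square algebra_simps)
          finally show "1 / real d ^ 3 \<le> 2 / (real d)\<^sup>2 - 2 / (real (Suc d))\<^sup>2" by (simp add: y_def add.commute)
        next
          fix a b :: real assume "0 < a" "a \<le> b"
          then show "2 / b\<^sup>2 \<le> 2 / a\<^sup>2" by (intro divide_left_mono power_mono mult_pos_pos) auto
        qed (use False in \<open>auto simp: mono_def\<close>)
        then have "F t ^ 4 * (\<Sum>d<m. if \<bar>F t\<bar> \<le> real d then 1 / real d ^ 3 else 0) \<le> F t ^ 4 * (2 / \<bar>F t\<bar>\<^sup>2)"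
          by (intro mult_left_mono) auto
        also have "\<dots> = 2 * (F t)\<^sup>2" using False by (simp add: power4_eq_xxxx power2_eq_square)
        finally show ?thesis by (simp add: sum_distrib_left if_distrib cong: if_cong)
      qed
    qed auto
    also have "(\<lambda>d. LINT t|N. (if \<bar>F t\<bar> \<le> real d then F t ^ 4 * (1 / real d ^ 3) else 0)) = (\<lambda>d. ?r d 4 / real d ^ 3)"
    proof
      fix d
      have "(LINT t|N. (if \<bar>F t\<bar> \<le> real d then F t ^ 4 * (1 / real d ^ 3) else 0)) = (LINT t|N. truncated (real d) F t ^ 4 * (1 / real d ^ 3))"
        by (intro Bochner_Integration.integral_cong refl) (auto simp: truncated_def)
      then show "(LINT t|N. (if \<bar>F t\<bar> \<le> real d then F t ^ 4 * (1 / real d ^ 3) else 0)) = ?r d 4 / real d ^ 3" by simp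
    qed
    finally show ?thesis .
  qed
  moreover have "summable (\<lambda>d. 1 / (real d)\<^sup>2)"
    using inverse_power_summable[of 2, where 'a=real] by (simp add: inverse_eq_divide power_one_over)
  ultimately have "summable p"
    unfolding p_def by (intro summable_add summable_mult summable_divide)
  moreover have "\<forall>\<^sub>F d in sequentially. measure (PiM {..<n d} (\<lambda>_. N))
    {t\<in>space (PiM {..<n d} (\<lambda>_. N)). e < \<bar>(\<Sum>i<n d. F (t i)) / real (n d) - (LINT t|N. F t)\<bar>} \<le> p d"
  proof -
    have "\<forall>\<^sub>F d in sequentially. \<bar>(LINT t|N. truncated (real d) F t) - (LINT t|N. F t)\<bar> < e / 2"
      using tendstoD[OF tendsto_integral_truncated[OF Fi filterlim_real_sequentially], of "e / 2"] e by (simp add: dist_real_def)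
    then show ?thesis
      using n eventually_gt_at_top[of 0]
    proof eventually_elim
      case (elim d)
      let ?P = "PiM {..<n d} (\<lambda>_. N)"
      interpret P: prob_space ?P by (intro prob_space_PiM N)
      have d: "0 < real d" using elim by simp
      have cd: "0 < c * real d" using c d by simp
      then have nd: "0 < n d" using elim by (cases "n d") auto
      have "P.prob {t\<in>space ?P. e < \<bar>(\<Sum>i<n d. F (t i)) / real (n d) - (LINT t|N. F t)\<bar>} \<le>
        real (n d) * ?q d + (16 * ?r d 4 / real (n d) ^ 3 + 3 * (?r d 2)\<^sup>2 / (real (n d))\<^sup>2) / (e / 2) ^ 4"
        by (rule mean_deviation_tail_bound[OF N F nd d e elim(1)])
      also have "\<dots> \<le> (C * real d) * ?q d + (16 * ?r d 4 / (c * real d) ^ 3 + 3 * ?s\<^sup>2 / (c * real d)\<^sup>2) / (e / 2) ^ 4"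
      proof -
        have "?r d 2 \<le> ?s"
        proof (rule integral_mono[OF _ F2])
          show "integrable N (\<lambda>t. (truncated (real d) F t)\<^sup>2)"
            using integral_truncated_power_le(1)[OF N F, of "real d" 2] by simp
        qed (auto simp: truncated_def)
        then have "(16 * ?r d 4 / real (n d) ^ 3 + 3 * (?r d 2)\<^sup>2 / (real (n d))\<^sup>2) / (e / 2) ^ 4 \<le>
          (16 * ?r d 4 / (c * real d) ^ 3 + 3 * ?s\<^sup>2 / (c * real d)\<^sup>2) / (e / 2) ^ 4"
          using elim cd e by (intro truncated_fourth_moment_bound_mono) auto
        moreover have "real (n d) * ?q d \<le> (C * real d) * ?q d"
          using elim by (intro mult_right_mono) auto
        ultimately show ?thesis by (rule add_mono[rotated])
      qed
      also have "\<dots> = p d" by (simp add: p_def power_mult_distrib mult_ac)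
      finally show ?case .
    qed
  qed
  ultimately show ?thesis by blast
qed

section \<open>The strong law of large numbers\<close>

lemma sum_geometric_below_le:
  fixes \<beta> x :: real
  assumes \<beta>: "1 < \<beta>" and x: "0 \<le> x"
  shows "(\<Sum>m<n. if \<beta> ^ m < x then \<beta> ^ m else 0) \<le> \<beta> / (\<beta> - 1) * x"
proof -
  have "(\<Sum>m<n. if \<beta> ^ m < x then \<beta> ^ m else 0) \<le> min (\<beta> / (\<beta> - 1) * x) (\<beta> ^ n / (\<beta> - 1))"
  proof (induction n)
    case 0 then show ?case using \<beta> x by simp
  next
    case (Suc n)
    have mono: "\<beta> ^ n / (\<beta> - 1) \<le> \<beta> ^ Suc n / (\<beta> - 1)"
      using \<beta> by (intro divide_right_mono power_increasing) auto
    show ?case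
    proof (cases "\<beta> ^ n < x")
      case True
      have eq: "\<beta> ^ n / (\<beta> - 1) + \<beta> ^ n = \<beta> / (\<beta> - 1) * \<beta> ^ n" using \<beta> by (simp add: field_simps)
      also have "\<dots> \<le> \<beta> / (\<beta> - 1) * x" using \<beta> True by (intro mult_left_mono) auto
      finally have "\<beta> ^ n / (\<beta> - 1) + \<beta> ^ n \<le> \<beta> / (\<beta> - 1) * x" .
      moreover have "\<beta> ^ n / (\<beta> - 1) + \<beta> ^ n = \<beta> ^ Suc n / (\<beta> - 1)" using eq by simp
      ultimately show ?thesis using Suc True by simp
    next
      case False then show ?thesis using Suc mono by simp
    qed
  qed
  then show ?thesis by simp
qed

text \<open>Fourth and squared second moments of a variable bounded by \<open>T\<close> are controlled by its second moment, at the
price of powers of \<open>T\<close> and of the first absolute moment \<open>A\<close>.\<close>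

lemma truncated_moment_bound_first_moment:
  fixes T n r2 r4 A :: real
  assumes T: "0 < T" "T \<le> n" and r: "0 \<le> r2" "r4 \<le> T\<^sup>2 * r2" "r2 \<le> T * A"
  shows "16 * r4 / n ^ 3 + 3 * r2\<^sup>2 / n\<^sup>2 \<le> (16 + 3 * A) * (r2 / T)"
proof -
  have n: "T ^ 3 \<le> n ^ 3" "T\<^sup>2 \<le> n\<^sup>2" using T by (auto intro: power_mono)
  have "16 * r4 / n ^ 3 \<le> 16 * (T\<^sup>2 * r2) / n ^ 3" using r T by (intro divide_right_mono) auto
  also have "\<dots> \<le> 16 * (T\<^sup>2 * r2) / T ^ 3" using r T n by (intro divide_left_mono) auto
  also have "\<dots> = 16 * (r2 / T)" using T by (simp add: power3_eq_cube power2_eq_square)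
  finally have 1: "16 * r4 / n ^ 3 \<le> 16 * (r2 / T)" .
  have "3 * r2\<^sup>2 / n\<^sup>2 \<le> 3 * r2\<^sup>2 / T\<^sup>2" using T n by (intro divide_left_mono) auto
  also have "r2\<^sup>2 \<le> (T * A) * r2" unfolding power2_eq_square using r by (intro mult_right_mono)
  then have "3 * r2\<^sup>2 / T\<^sup>2 \<le> 3 * ((T * A) * r2) / T\<^sup>2" by (intro divide_right_mono) auto
  also have "\<dots> = 3 * A * (r2 / T)" using T by (simp add: power2_eq_square)
  finally have 2: "3 * r2\<^sup>2 / n\<^sup>2 \<le> 3 * A * (r2 / T)" .
  show ?thesis using add_mono[OF 1 2] by (simp only: distrib_right)
qed

text \<open>Along sample sizes that grow geometrically one moment suffices, because sums of powers of
\<open>\<beta>\<close> are of the order of their largest term. Here \<open>\<Sum>m. \<beta>\<^sup>m P(\<bar>F\<bar> > \<beta>\<^sup>m)\<close> and \<open>\<Sum>m. \<beta>\<^sup>-\<^sup>m E[F\<^sup>2; \<bar>F\<bar> \<le> \<beta>\<^sup>m]\<close>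
are bounded by multiples of \<open>E \<bar>F\<bar>\<close>.\<close>

lemma geometric_complete_convergence_of_means:
  fixes F :: "'b \<Rightarrow> real" and k :: "nat \<Rightarrow> nat"
  assumes N: "prob_space N" and F: "integrable N F"
    and \<beta>: "1 < \<beta>" and k: "\<And>m. \<beta> ^ m \<le> real (k m)" "\<And>m. real (k m) \<le> 2 * \<beta> ^ m" and e: "0 < e"
  shows "\<exists>p. summable p \<and> (\<forall>\<^sub>F m in sequentially. measure (PiM {..<k m} (\<lambda>_. N))
    {t\<in>space (PiM {..<k m} (\<lambda>_. N)). e < \<bar>(\<Sum>i<k m. F (t i)) / real (k m) - (LINT t|N. F t)\<bar>} \<le> p m)"
proof -
  interpret N: prob_space N by fact
  have Fm [measurable]: "F \<in> borel_measurable N" using F by simp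
  let ?q = "\<lambda>m. N.prob {t\<in>space N. \<beta> ^ m < \<bar>F t\<bar>}"
  let ?r = "\<lambda>m l. LINT t|N. truncated (\<beta> ^ m) F t ^ l"
  define A where "A = (LINT t|N. \<bar>F t\<bar>)"
  have A: "0 \<le> A" by (simp add: A_def)
  define p where "p m = 2 * (\<beta> ^ m * ?q m) + (16 + 3 * A) * (?r m 2 / \<beta> ^ m) / (e / 2) ^ 4" for m
  have "summable (\<lambda>m. \<beta> ^ m * ?q m)"
    unfolding tail_probability_as_integral[OF Fm]
  proof (rule summable_integrals)
    show "integrable N (\<lambda>t. \<beta> / (\<beta> - 1) * \<bar>F t\<bar>)" using F by simp
    show "(\<Sum>m<n. if \<beta> ^ m < \<bar>F t\<bar> then \<beta> ^ m else 0) \<le> \<beta> / (\<beta> - 1) * \<bar>F t\<bar>" for n t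
      using \<beta> by (intro sum_geometric_below_le) auto
  qed (use \<beta> in auto)
  moreover have "summable (\<lambda>m. ?r m 2 / \<beta> ^ m)"
  proof -
    have "summable (\<lambda>m. LINT t|N. (if \<bar>F t\<bar> \<le> \<beta> ^ m then (F t)\<^sup>2 * (1 / \<beta> ^ m) else 0))"
    proof (rule summable_integrals)
      show "integrable N (\<lambda>t. \<beta> / (\<beta> - 1) * \<bar>F t\<bar>)" using F by simp
      fix n t
      show "(\<Sum>m<n. if \<bar>F t\<bar> \<le> \<beta> ^ m then (F t)\<^sup>2 * (1 / \<beta> ^ m) else 0) \<le> \<beta> / (\<beta> - 1) * \<bar>F t\<bar>"
      proof (cases "F t = 0")
        case True then show ?thesis by (simp cong: if_cong)
      next
        case False
        have "(\<Sum>m<n. if \<bar>F t\<bar> \<le> \<beta> ^ m then 1 / \<beta> ^ m else 0) \<le> \<beta> / (\<beta> - 1) / \<bar>F t\<bar>"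
        proof (rule sum_above_level_le[where G="\<lambda>x. \<beta> / (\<beta> - 1) / x"])
          show "mono (\<lambda>m. \<beta> ^ m)" using \<beta> by (intro monoI power_increasing) auto
          fix m
          show "1 / \<beta> ^ m \<le> \<beta> / (\<beta> - 1) / \<beta> ^ m - \<beta> / (\<beta> - 1) / \<beta> ^ Suc m"
            using \<beta> by (simp add: divide_simps)
        next
          fix a b :: real assume "0 < a" "a \<le> b"
          then show "\<beta> / (\<beta> - 1) / b \<le> \<beta> / (\<beta> - 1) / a"
            using \<beta> by (intro divide_left_mono mult_pos_pos) auto
        qed (use False \<beta> in auto)
        then have "(F t)\<^sup>2 * (\<Sum>m<n. if \<bar>F t\<bar> \<le> \<beta> ^ m then 1 / \<beta> ^ m else 0) \<le> (F t)\<^sup>2 * (\<beta> / (\<beta> - 1) / \<bar>F t\<bar>)"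
          by (intro mult_left_mono) auto
        also have "(F t)\<^sup>2 = \<bar>F t\<bar> * \<bar>F t\<bar>" by (simp add: power2_eq_square)
        also have "\<bar>F t\<bar> * \<bar>F t\<bar> * (\<beta> / (\<beta> - 1) / \<bar>F t\<bar>) = \<beta> / (\<beta> - 1) * \<bar>F t\<bar>"
        proof -
          have "y * y * (c / y) = c * y" if "y \<noteq> 0" for c y :: real using that by simp
          then show ?thesis using False by (metis abs_eq_0)
        qed
        finally show ?thesis by (simp add: sum_distrib_left if_distrib power2_eq_square cong: if_cong)
      qed
    qed (use \<beta> in auto)
    also have "(\<lambda>m. LINT t|N. (if \<bar>F t\<bar> \<le> \<beta> ^ m then (F t)\<^sup>2 * (1 / \<beta> ^ m) else 0)) = (\<lambda>m. ?r m 2 / \<beta> ^ m)"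
    proof
      fix m
      have "(LINT t|N. (if \<bar>F t\<bar> \<le> \<beta> ^ m then (F t)\<^sup>2 * (1 / \<beta> ^ m) else 0)) = (LINT t|N. (truncated (\<beta> ^ m) F t)\<^sup>2 * (1 / \<beta> ^ m))"
        by (intro Bochner_Integration.integral_cong refl) (auto simp: truncated_def)
      then show "(LINT t|N. (if \<bar>F t\<bar> \<le> \<beta> ^ m then (F t)\<^sup>2 * (1 / \<beta> ^ m) else 0)) = ?r m 2 / \<beta> ^ m" by simp
    qed
    finally show ?thesis .
  qed
  ultimately have "summable p"
    unfolding p_def by (intro summable_add summable_mult summable_divide)
  moreover have "\<forall>\<^sub>F m in sequentially. measure (PiM {..<k m} (\<lambda>_. N))
    {t\<in>space (PiM {..<k m} (\<lambda>_. N)). e < \<bar>(\<Sum>i<k m. F (t i)) / real (k m) - (LINT t|N. F t)\<bar>} \<le> p m"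
  proof -
    have lim: "filterlim (\<lambda>m. \<beta> ^ m) at_top sequentially" 
      using \<beta> by (intro filterlim_at_infinity_imp_filterlim_at_top filterlim_realpow_sequentially_gt1) auto
    have "\<forall>\<^sub>F m in sequentially. \<bar>(LINT t|N. truncated (\<beta> ^ m) F t) - (LINT t|N. F t)\<bar> < e / 2"
      using tendstoD[OF tendsto_integral_truncated[OF F lim], of "e / 2"] e by (simp add: dist_real_def)
    then show ?thesis
    proof eventually_elim
      case (elim m)
      let ?P = "PiM {..<k m} (\<lambda>_. N)"
      interpret P: prob_space ?P by (intro prob_space_PiM N)
      have T: "0 < \<beta> ^ m" using \<beta> by simp
      then have km: "0 < k m" using k(1)[of m] by (cases "k m") auto
      have "P.prob {t\<in>space ?P. e < \<bar>(\<Sum>i<k m. F (t i)) / real (k m) - (LINT t|N. F t)\<bar>} \<le>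
        real (k m) * ?q m + (16 * ?r m 4 / real (k m) ^ 3 + 3 * (?r m 2)\<^sup>2 / (real (k m))\<^sup>2) / (e / 2) ^ 4"
        by (rule mean_deviation_tail_bound[OF N Fm km T e elim])
      also have "\<dots> \<le> p m"
      proof -
        note tr = integral_truncated_power_le[OF N Fm, of "\<beta> ^ m"]
        have r4: "?r m 4 \<le> (\<beta> ^ m)\<^sup>2 * ?r m 2" using tr(2)[of 2 2] T by simp
        have "(LINT t|N. \<bar>truncated (\<beta> ^ m) F t\<bar>) \<le> A"
          unfolding A_def using tr(1)[of 1] T F by (intro integral_mono) (auto simp: truncated_def)
        then have r2: "?r m 2 \<le> \<beta> ^ m * A"
          using tr(2)[of 1 1] T by (simp add: power2_eq_square order.trans[OF _ mult_left_mono])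
        have r2p: "0 \<le> ?r m 2" by simp
        have "16 * ?r m 4 / real (k m) ^ 3 + 3 * (?r m 2)\<^sup>2 / (real (k m))\<^sup>2 \<le> (16 + 3 * A) * (?r m 2 / \<beta> ^ m)"
          using T k(1)[of m] r2p r4 r2
          by (rule truncated_moment_bound_first_moment)
        then have "(16 * ?r m 4 / real (k m) ^ 3 + 3 * (?r m 2)\<^sup>2 / (real (k m))\<^sup>2) / (e / 2) ^ 4 \<le>
          (16 + 3 * A) * (?r m 2 / \<beta> ^ m) / (e / 2) ^ 4"
          using e by (intro divide_right_mono) auto
        moreover have "real (k m) * ?q m \<le> (2 * \<beta> ^ m) * ?q m" by (intro mult_right_mono k) auto
        ultimately show ?thesis by (simp add: p_def)
      qed
      finally show ?case .
    qed
  qed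
  ultimately show ?thesis by blast
qed

lemma (in prob_space) prob_mean_deviation:
  fixes F :: "'b \<Rightarrow> real"
  assumes t: "(\<lambda>\<omega>. \<lambda>i\<in>{..<n}. t i \<omega>) \<in> M \<rightarrow>\<^sub>M PiM {..<n} (\<lambda>_. N)"
    and law: "distr M (PiM {..<n} (\<lambda>_. N)) (\<lambda>\<omega>. \<lambda>i\<in>{..<n}. t i \<omega>) = PiM {..<n} (\<lambda>_. N)"
    and F: "F \<in> borel_measurable N"
  shows "prob {\<omega>\<in>space M. e < \<bar>(\<Sum>i<n. F (t i \<omega>)) / real n - c\<bar>} =
    measure (PiM {..<n} (\<lambda>_. N)) {x\<in>space (PiM {..<n} (\<lambda>_. N)). e < \<bar>(\<Sum>i<n. F (x i)) / real n - c\<bar>}"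
    and "(\<lambda>\<omega>. (\<Sum>i<n. F (t i \<omega>)) / real n - c) \<in> borel_measurable M"
proof -
  let ?P = "PiM {..<n} (\<lambda>_. N)" and ?t = "\<lambda>\<omega>. \<lambda>i\<in>{..<n}. t i \<omega>"
  have "(\<lambda>x. F (x i)) \<in> borel_measurable ?P" if "i < n" for i
    using measurable_compose[OF measurable_component_singleton[of i "{..<n}" "\<lambda>_. N"] F] that by simp
  then have m [measurable]: "(\<lambda>x. \<Sum>i<n. F (x i)) \<in> borel_measurable ?P" by (intro borel_measurable_sum) auto
  have E: "{x\<in>space ?P. e < \<bar>(\<Sum>i<n. F (x i)) / real n - c\<bar>} \<in> sets ?P" by measurable
  have "measure ?P {x\<in>space ?P. e < \<bar>(\<Sum>i<n. F (x i)) / real n - c\<bar>} =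
    measure (distr M ?P ?t) {x\<in>space ?P. e < \<bar>(\<Sum>i<n. F (x i)) / real n - c\<bar>}" by (simp add: law)
  also have "\<dots> = prob (?t -` {x\<in>space ?P. e < \<bar>(\<Sum>i<n. F (x i)) / real n - c\<bar>} \<inter> space M)"
    by (rule measure_distr[OF t E])
  also have "?t -` {x\<in>space ?P. e < \<bar>(\<Sum>i<n. F (x i)) / real n - c\<bar>} \<inter> space M =
    {\<omega>\<in>space M. e < \<bar>(\<Sum>i<n. F (t i \<omega>)) / real n - c\<bar>}"
    using measurable_space[OF t] by auto
  finally show "prob {\<omega>\<in>space M. e < \<bar>(\<Sum>i<n. F (t i \<omega>)) / real n - c\<bar>} =
    measure ?P {x\<in>space ?P. e < \<bar>(\<Sum>i<n. F (x i)) / real n - c\<bar>}" by (rule sym)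
  have "(\<lambda>\<omega>. \<Sum>i<n. F (?t \<omega> i)) \<in> borel_measurable M" using measurable_compose[OF t m] .
  then show "(\<lambda>\<omega>. (\<Sum>i<n. F (t i \<omega>)) / real n - c) \<in> borel_measurable M" by simp
qed

text \<open>As \<open>S\<close> is monotone, averages at sizes between two consecutive terms of the subsequence with
ratio \<open>\<beta>\<close> deviate at most by a factor \<open>\<beta>\<close> from those along the subsequence. Then \<open>\<beta>\<close> tends to \<open>1\<close>.\<close>

lemma mean_convergence_by_geometric_subsequences:
  fixes S :: "nat \<Rightarrow> real" and \<mu> :: real
  assumes S: "mono S" "\<And>n. 0 \<le> S n"
    and lim: "\<And>j::nat. (\<lambda>m. S (nat \<lceil>(1 + 1 / Suc j) ^ m\<rceil>) / real (nat \<lceil>(1 + 1 / Suc j) ^ m\<rceil>)) \<longlonglongrightarrow> \<mu>"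
  shows "(\<lambda>n. S n / real n) \<longlonglongrightarrow> \<mu>"
proof -
  have sandwich: "\<exists>l u. l \<longlonglongrightarrow> \<mu> / \<beta> \<and> u \<longlonglongrightarrow> \<mu> * \<beta> \<and> (\<forall>n>0. l n \<le> S n / real n \<and> S n / real n \<le> u n)"
    if j: "\<beta> = 1 + 1 / real (Suc j)" for \<beta> and j :: nat
  proof -
    have \<beta>: "1 < \<beta>" using j by simp
    define k where "k m = nat \<lceil>\<beta> ^ m\<rceil>" for m
    define a where "a m = S (k m) / real (k m)" for m
    have a: "a \<longlonglongrightarrow> \<mu>" using lim[of j] unfolding a_def k_def j .
    have k1: "\<beta> ^ m \<le> real (k m)" and k2: "real (k m) \<le> \<beta> ^ m + 1" for m
    proof -
      have "0 \<le> \<beta> ^ m" using \<beta> by simp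
      then have "0 \<le> \<lceil>\<beta> ^ m\<rceil>" by linarith
      then have "real (k m) = of_int \<lceil>\<beta> ^ m\<rceil>" by (simp add: k_def)
      then show "\<beta> ^ m \<le> real (k m)" "real (k m) \<le> \<beta> ^ m + 1" by linarith+
    qed
    define f where "f n = nat \<lfloor>log \<beta> (real n)\<rfloor>" for n :: nat
    have f: "\<beta> ^ f n \<le> real n" "real n < \<beta> ^ Suc (f n)" if "0 < n" for n
    proof -
      have "0 \<le> log \<beta> (real n)" using \<beta> that by simp
      then have 1: "real (f n) \<le> log \<beta> (real n)" "log \<beta> (real n) < real (f n) + 1" by (simp_all add: f_def)
      show "\<beta> ^ f n \<le> real n" using 1(1) \<beta> that by (simp add: le_log_iff powr_realpow)
      show "real n < \<beta> ^ Suc (f n)" using 1(2) \<beta> that by (simp add: log_less_iff powr_realpow powr_add mult.commute)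
    qed
    have ft: "filterlim f at_top sequentially"
      unfolding f_def
    proof (rule filterlim_compose[OF filterlim_nat_sequentially filterlim_compose[OF filterlim_floor_sequentially]])
      have "filterlim (\<lambda>x. 1 / ln \<beta> * ln x) at_top at_top"
        using \<beta> by (intro filterlim_tendsto_pos_mult_at_top[OF tendsto_const _ ln_at_top]) simp
      then have "filterlim (\<lambda>x. log \<beta> x) at_top at_top" by (simp add: log_def)
      then show "filterlim (\<lambda>n. log \<beta> (real n)) at_top sequentially"
        by (rule filterlim_compose[OF _ filterlim_real_sequentially])
    qed
    define l where "l n = a (f n) / \<beta>" for n
    define u where "u n = a (Suc (f n)) * (\<beta> + 1 / \<beta> ^ f n)" for n
    have "l \<longlonglongrightarrow> \<mu> / \<beta>"
      unfolding l_def using \<beta> filterlim_compose[OF a ft] by (intro tendsto_divide tendsto_const) auto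
    moreover have "u \<longlonglongrightarrow> \<mu> * \<beta>"
    proof -
      have "(\<lambda>m. 1 / \<beta> ^ m) \<longlonglongrightarrow> 0"
        using \<beta> by (simp add: LIMSEQ_inverse_realpow_zero flip: inverse_eq_divide)
      then have "(\<lambda>m. a (Suc m) * (\<beta> + 1 / \<beta> ^ m)) \<longlonglongrightarrow> \<mu> * (\<beta> + 0)"
        by (intro tendsto_mult tendsto_add tendsto_const LIMSEQ_Suc a)
      from filterlim_compose[OF this ft] show ?thesis by (simp add: u_def[abs_def])
    qed
    moreover have "l n \<le> S n / real n \<and> S n / real n \<le> u n" if n: "0 < n" for n
    proof
      have kn: "k (f n) \<le> n" using f(1)[OF n] by (simp add: k_def nat_le_iff ceiling_le_iff)
      have nk: "n \<le> k (Suc (f n))" using f(2)[OF n] k1[of "Suc (f n)"] by simp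
      have p: "0 < \<beta> ^ f n" "0 < real (k (f n))" using \<beta> k1[of "f n"] by (simp, smt (verit) zero_less_power)
      have "l n = S (k (f n)) / (real (k (f n)) * \<beta>)" by (simp add: l_def a_def)
      also have "\<dots> \<le> S n / real n"
      proof (rule frac_le)
        show "S (k (f n)) \<le> S n" using S(1) kn by (rule monoD)
        have "real n \<le> \<beta> ^ f n * \<beta>" using f(2)[OF n] by (simp add: mult.commute)
        also have "\<dots> \<le> real (k (f n)) * \<beta>" using \<beta> by (intro mult_right_mono k1) auto
        finally show "real n \<le> real (k (f n)) * \<beta>" .
      qed (use S n in auto)
      finally show "l n \<le> S n / real n" .
      have "S n / real n \<le> S (k (Suc (f n))) / \<beta> ^ f n"
        using S f(1)[OF n] nk p by (intro frac_le) (auto dest: monoD)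
      also have "\<dots> = a (Suc (f n)) * (real (k (Suc (f n))) / \<beta> ^ f n)"
        using nk n by (simp add: a_def)
      also have "\<dots> \<le> u n"
        unfolding u_def
      proof (rule mult_left_mono)
        have "real (k (Suc (f n))) / \<beta> ^ f n \<le> (\<beta> ^ Suc (f n) + 1) / \<beta> ^ f n"
          using p by (intro divide_right_mono k2) auto
        also have "\<dots> = \<beta> + 1 / \<beta> ^ f n" using p by (simp add: add_divide_distrib)
        finally show "real (k (Suc (f n))) / \<beta> ^ f n \<le> \<beta> + 1 / \<beta> ^ f n" .
        show "0 \<le> a (Suc (f n))" using S by (simp add: a_def)
      qed
      finally show "S n / real n \<le> u n" .
    qed
    ultimately show ?thesis by blast
  qed
  have inv: "(\<lambda>j. 1 + 1 / real (Suc j)) \<longlonglongrightarrow> 1"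
    using tendsto_add[OF tendsto_const LIMSEQ_inverse_real_of_nat, of 1] by (simp add: inverse_eq_divide)
  show ?thesis
  proof (rule order_tendstoI)
    fix c assume c: "c < \<mu>"
    have "(\<lambda>j. \<mu> / (1 + 1 / real (Suc j))) \<longlonglongrightarrow> \<mu> / 1" by (intro tendsto_divide tendsto_const inv) auto
    then have "\<forall>\<^sub>F j in sequentially. c < \<mu> / (1 + 1 / real (Suc j))" using c by (intro order_tendstoD(1)) auto
    then obtain j where j: "c < \<mu> / (1 + 1 / real (Suc j))" by (auto simp: eventually_sequentially)
    from sandwich[OF refl, of j] obtain l u where lu: "l \<longlonglongrightarrow> \<mu> / (1 + 1 / real (Suc j))" "\<forall>n>0. l n \<le> S n / real n \<and> S n / real n \<le> u n" by blast
    show "\<forall>\<^sub>F n in sequentially. c < S n / real n"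
      using order_tendstoD(1)[OF lu(1) j] eventually_gt_at_top[of 0]
    proof eventually_elim
      case (elim n)
      then show ?case using lu(2)[rule_format, of n] by linarith
    qed
  next
    fix c assume c: "\<mu> < c"
    have "(\<lambda>j. \<mu> * (1 + 1 / real (Suc j))) \<longlonglongrightarrow> \<mu> * 1" by (intro tendsto_mult tendsto_const inv)
    then have "\<forall>\<^sub>F j in sequentially. \<mu> * (1 + 1 / real (Suc j)) < c" using c by (intro order_tendstoD(2)) auto
    then obtain j where j: "\<mu> * (1 + 1 / real (Suc j)) < c" by (auto simp: eventually_sequentially)
    from sandwich[OF refl, of j] obtain l u where lu: "u \<longlonglongrightarrow> \<mu> * (1 + 1 / real (Suc j))" "\<forall>n>0. l n \<le> S n / real n \<and> S n / real n \<le> u n" by blast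
    show "\<forall>\<^sub>F n in sequentially. S n / real n < c"
      using order_tendstoD(2)[OF lu(1) j] eventually_gt_at_top[of 0]
    proof eventually_elim
      case (elim n)
      then show ?case using lu(2)[rule_format, of n] by linarith
    qed
  qed
qed

text \<open>Etemadi's argument: nonnegativity makes the partial sums monotone, so that convergence along geometric
subsequences is enough.\<close>

lemma (in prob_space) strong_law_nonneg:
  fixes t :: "nat \<Rightarrow> 'a \<Rightarrow> 'b" and F :: "'b \<Rightarrow> real"
  assumes N: "prob_space N" and t: "\<And>n. (\<lambda>\<omega>. \<lambda>i\<in>{..<n}. t i \<omega>) \<in> M \<rightarrow>\<^sub>M PiM {..<n} (\<lambda>_. N)"
    and law: "\<And>n. distr M (PiM {..<n} (\<lambda>_. N)) (\<lambda>\<omega>. \<lambda>i\<in>{..<n}. t i \<omega>) = PiM {..<n} (\<lambda>_. N)"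
    and F: "integrable N F" and nn: "\<And>x. 0 \<le> F x"
  shows "AE \<omega> in M. (\<lambda>n. (\<Sum>i<n. F (t i \<omega>)) / real n) \<longlonglongrightarrow> (LINT x|N. F x)"
proof -
  have Fm: "F \<in> borel_measurable N" using F by simp
  define k where "k j m = nat \<lceil>(1 + 1 / Suc j) ^ m\<rceil>" for j m :: nat
  have "AE \<omega> in M. (\<lambda>m. (\<Sum>i<k j m. F (t i \<omega>)) / real (k j m) - (LINT x|N. F x)) \<longlonglongrightarrow> 0" for j
  proof (rule AE_tendsto_zero_if_tails_summable)
    show "(\<lambda>\<omega>. (\<Sum>i<k j m. F (t i \<omega>)) / real (k j m) - (LINT x|N. F x)) \<in> borel_measurable M" for m
      by (rule prob_mean_deviation[OF t law Fm])
    fix e :: real assume e: "0 < e"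
    define \<beta> where "\<beta> = 1 + 1 / real (Suc j)"
    have \<beta>: "1 < \<beta>" by (simp add: \<beta>_def)
    have k: "\<beta> ^ m \<le> real (k j m)" "real (k j m) \<le> 2 * \<beta> ^ m" for m
    proof -
      have 1: "1 \<le> \<beta> ^ m" using \<beta> by simp
      then have "0 \<le> \<lceil>\<beta> ^ m\<rceil>" by linarith
      then have "real (k j m) = of_int \<lceil>\<beta> ^ m\<rceil>" by (simp add: k_def \<beta>_def)
      then show "\<beta> ^ m \<le> real (k j m)" "real (k j m) \<le> 2 * \<beta> ^ m" using 1 by linarith+
    qed
    show "\<exists>p. summable p \<and> (\<forall>\<^sub>F m in sequentially. prob {\<omega>\<in>space M. e < \<bar>(\<Sum>i<k j m. F (t i \<omega>)) / real (k j m) - (LINT x|N. F x)\<bar>} \<le> p m)"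
      unfolding prob_mean_deviation(1)[OF t law Fm]
      by (rule geometric_complete_convergence_of_means[OF N F \<beta> k e])
  qed
  then have "AE \<omega> in M. \<forall>j. (\<lambda>m. (\<Sum>i<k j m. F (t i \<omega>)) / real (k j m) - (LINT x|N. F x)) \<longlonglongrightarrow> 0"
    by (simp add: AE_all_countable)
  then show ?thesis
  proof (rule AE_mp, intro AE_I2 impI)
    fix \<omega> assume *: "\<forall>j. (\<lambda>m. (\<Sum>i<k j m. F (t i \<omega>)) / real (k j m) - (LINT x|N. F x)) \<longlonglongrightarrow> 0"
    show "(\<lambda>n. (\<Sum>i<n. F (t i \<omega>)) / real n) \<longlonglongrightarrow> (LINT x|N. F x)"
    proof (rule mean_convergence_by_geometric_subsequences)
      show "mono (\<lambda>n. \<Sum>i<n. F (t i \<omega>))" using nn by (intro monoI sum_mono2) auto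
      show "0 \<le> (\<Sum>i<n. F (t i \<omega>))" for n using nn by (intro sum_nonneg) auto
      show "(\<lambda>m. (\<Sum>i<nat \<lceil>(1 + 1 / Suc j) ^ m\<rceil>. F (t i \<omega>)) / real (nat \<lceil>(1 + 1 / Suc j) ^ m\<rceil>)) \<longlonglongrightarrow> (LINT x|N. F x)" for j :: nat
        using *[rule_format, of j] unfolding k_def by (simp add: LIM_zero_iff)
    qed
  qed
qed

lemma (in prob_space) strong_law:
  fixes t :: "nat \<Rightarrow> 'a \<Rightarrow> 'b" and F :: "'b \<Rightarrow> real"
  assumes N: "prob_space N" and t: "\<And>n. (\<lambda>\<omega>. \<lambda>i\<in>{..<n}. t i \<omega>) \<in> M \<rightarrow>\<^sub>M PiM {..<n} (\<lambda>_. N)"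
    and law: "\<And>n. distr M (PiM {..<n} (\<lambda>_. N)) (\<lambda>\<omega>. \<lambda>i\<in>{..<n}. t i \<omega>) = PiM {..<n} (\<lambda>_. N)"
    and F: "integrable N F"
  shows "AE \<omega> in M. (\<lambda>n. (\<Sum>i<n. F (t i \<omega>)) / real n) \<longlonglongrightarrow> (LINT x|N. F x)"
proof -
  let ?p = "\<lambda>x. max 0 (F x)" and ?n = "\<lambda>x. max 0 (- F x)"
  have i: "integrable N ?p" "integrable N ?n" by (intro integrable_max integrable_zero integrable_minus F)+
  have eq: "?p x - ?n x = F x" for x by (simp add: max_def)
  have "AE \<omega> in M. (\<lambda>n. (\<Sum>i<n. ?p (t i \<omega>)) / real n) \<longlonglongrightarrow> (LINT x|N. ?p x)"
    "AE \<omega> in M. (\<lambda>n. (\<Sum>i<n. ?n (t i \<omega>)) / real n) \<longlonglongrightarrow> (LINT x|N. ?n x)"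
    using strong_law_nonneg[OF N t law i(1)] strong_law_nonneg[OF N t law i(2)] by simp_all
  then show ?thesis
  proof eventually_elim
    case (elim \<omega>)
    have "(\<lambda>n. (\<Sum>i<n. ?p (t i \<omega>)) / real n - (\<Sum>i<n. ?n (t i \<omega>)) / real n) \<longlonglongrightarrow> (LINT x|N. ?p x) - (LINT x|N. ?n x)"
      using elim by (rule tendsto_diff)
    also have "(\<lambda>n. (\<Sum>i<n. ?p (t i \<omega>)) / real n - (\<Sum>i<n. ?n (t i \<omega>)) / real n) = (\<lambda>n. (\<Sum>i<n. F (t i \<omega>)) / real n)"
      unfolding diff_divide_distrib[symmetric] sum_subtractf[symmetric] eq ..
    also have "(LINT x|N. ?p x) - (LINT x|N. ?n x) = (LINT x|N. F x)"
      unfolding Bochner_Integration.integral_diff[OF i, symmetric] eq ..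
    finally show ?case .
  qed
qed

text \<open>The averages dominate those of \<open>min K F\<close>, whose expectations increase to infinity with \<open>K\<close>.\<close>

lemma (in prob_space) strong_law_infinite:
  fixes t :: "nat \<Rightarrow> 'a \<Rightarrow> 'b" and F :: "'b \<Rightarrow> real"
  assumes N: "prob_space N" and t: "\<And>n. (\<lambda>\<omega>. \<lambda>i\<in>{..<n}. t i \<omega>) \<in> M \<rightarrow>\<^sub>M PiM {..<n} (\<lambda>_. N)"
    and law: "\<And>n. distr M (PiM {..<n} (\<lambda>_. N)) (\<lambda>\<omega>. \<lambda>i\<in>{..<n}. t i \<omega>) = PiM {..<n} (\<lambda>_. N)"
    and Fm [measurable]: "F \<in> borel_measurable N" and nn: "\<And>x. 0 \<le> F x" and inf: "(\<integral>\<^sup>+x. ennreal (F x) \<partial>N) = \<infinity>"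
  shows "AE \<omega> in M. filterlim (\<lambda>n. (\<Sum>i<n. F (t i \<omega>)) / real n) at_top sequentially"
proof -
  interpret N: prob_space N by fact
  define G where "G K x = min (real K) (F x)" for K x
  have [measurable]: "G K \<in> borel_measurable N" for K unfolding G_def[abs_def] by measurable
  have G: "integrable N (G K)" for K
    by (rule N.integrable_const_bound[where B="real K"]) (auto simp: G_def nn)
  have "AE \<omega> in M. (\<lambda>n. (\<Sum>i<n. G K (t i \<omega>)) / real n) \<longlonglongrightarrow> (LINT x|N. G K x)" for K
    by (rule strong_law[OF N t law G])
  then have "AE \<omega> in M. \<forall>K. (\<lambda>n. (\<Sum>i<n. G K (t i \<omega>)) / real n) \<longlonglongrightarrow> (LINT x|N. G K x)"
    by (simp add: AE_all_countable)
  moreover have unbounded: "\<exists>K. c < (LINT x|N. G K x)" for c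
  proof -
    have "(\<Squnion>K. ennreal (G K x)) = ennreal (F x)" for x
    proof (rule antisym)
      show "(\<Squnion>K. ennreal (G K x)) \<le> ennreal (F x)" by (intro SUP_least ennreal_leI) (simp add: G_def)
      obtain K where "F x \<le> real K" using real_arch_simple by blast
      then have "F x = G K x" by (simp add: G_def)
      then show "ennreal (F x) \<le> (\<Squnion>K. ennreal (G K x))" by (metis SUP_upper UNIV_I)
    qed
    moreover have "(\<integral>\<^sup>+x. (\<Squnion>K. ennreal (G K x)) \<partial>N) = (\<Squnion>K. \<integral>\<^sup>+x. ennreal (G K x) \<partial>N)"
      by (intro nn_integral_monotone_convergence_SUP) (auto simp: incseq_def le_fun_def G_def intro!: ennreal_leI)
    ultimately have "(\<Squnion>K. \<integral>\<^sup>+x. ennreal (G K x) \<partial>N) = \<infinity>" using inf by simp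
    then have "ennreal c < (\<Squnion>K. \<integral>\<^sup>+x. ennreal (G K x) \<partial>N)" by (simp only: infinity_ennreal_def ennreal_less_top)
    then obtain K where "ennreal c < (\<integral>\<^sup>+x. ennreal (G K x) \<partial>N)" by (auto simp: less_SUP_iff)
    also have "\<dots> = ennreal (LINT x|N. G K x)" by (intro nn_integral_eq_integral G) (simp add: G_def nn)
    finally show ?thesis using ennreal_less_iff by (metis ennreal_leI not_le)
  qed
  ultimately show ?thesis
  proof (elim AE_mp, intro AE_I2 impI)
    fix \<omega> assume *: "\<forall>K. (\<lambda>n. (\<Sum>i<n. G K (t i \<omega>)) / real n) \<longlonglongrightarrow> (LINT x|N. G K x)"
    show "filterlim (\<lambda>n. (\<Sum>i<n. F (t i \<omega>)) / real n) at_top sequentially"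
      unfolding filterlim_at_top
    proof
      fix c :: real
      obtain K where K: "c < (LINT x|N. G K x)" using unbounded by blast
      have "\<forall>\<^sub>F n in sequentially. c < (\<Sum>i<n. G K (t i \<omega>)) / real n"
        using *[rule_format] K by (rule order_tendstoD(1))
      then show "\<forall>\<^sub>F n in sequentially. c \<le> (\<Sum>i<n. F (t i \<omega>)) / real n"
      proof eventually_elim
        case (elim n)
        have "(\<Sum>i<n. G K (t i \<omega>)) / real n \<le> (\<Sum>i<n. F (t i \<omega>)) / real n"
          by (intro divide_right_mono sum_mono) (auto simp: G_def)
        with elim show ?case by simp
      qed
    qed
  qed
qed

section \<open>The inner product of independent uniform signals\<close>

lemma measurable_ip_vec_borel [measurable]:
  "(\<lambda>x. ip d x u) \<in> borel_measurable (vec_borel d)"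
  "(\<lambda>x. ip d u x) \<in> borel_measurable (vec_borel d)"
  "(\<lambda>x. ip d x x) \<in> borel_measurable (vec_borel d)"
  by (intro measurable_ip measurable_component_singleton borel_measurable_const; simp)+

text \<open>The Householder reflection that exchanges \<open>v\<close> with the first vector of the standard basis.\<close>

lemma orthogonal_mat_with_first_row:
  assumes d: "0 < d" and v: "ip d v v = 1"
  shows "\<exists>Q. orthogonal_mat d Q \<and> (\<forall>j<d. Q 0 j = v j)"
proof (cases "v 0 = 1")
  case True
  have "(\<Sum>j<d. v j * v j) = v 0 * v 0 + (\<Sum>j\<in>{..<d} - {0}. v j * v j)"
    using d by (intro sum.remove) auto
  then have "(\<Sum>j\<in>{..<d} - {0}. v j * v j) = 0" using v True by (simp add: ip_def)
  then have v0: "v j = 0" if "j < d" "j \<noteq> 0" for j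
    using that by (subst (asm) sum_nonneg_eq_0_iff) auto
  show ?thesis
    by (rule exI[of _ "\<lambda>i j. if i = j then 1 else 0"])
       (auto simp: orthogonal_mat_def v0 True if_distrib[of "\<lambda>x. x * _"] sum.delta' cong: if_cong)
next
  case False
  define w where "w j = v j - (if j = 0 then 1 else 0)" for j :: nat
  define c where "c = 1 / (1 - v 0)"
  have c: "c * (1 - v 0) = 1" using False by (simp add: c_def)
  have "(\<Sum>j<d. w j * w j) = (\<Sum>j<d. v j * v j + (if j = 0 then 1 - 2 * v 0 else 0))"
    by (intro sum.cong refl) (auto simp: w_def algebra_simps)
  also have "\<dots> = 2 * (1 - v 0)" using v d by (simp add: ip_def sum.distrib sum.delta)
  finally have ww: "(\<Sum>j<d. w j * w j) = 2 * (1 - v 0)" .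
  define Q where "Q i j = (if i = j then 1 else 0) - c * w i * w j" for i j
  have "(\<Sum>k<d. Q i k * Q j k) = (if i = j then 1 else 0)" if ij: "i < d" "j < d" for i j
  proof -
    have "(\<Sum>k<d. Q i k * Q j k) = (\<Sum>k<d. (if k = i then (if i = j then 1 else 0) - c * w j * w i else 0) +
        ((if k = j then - c * w i * w j else 0) + c * c * w i * w j * (w k * w k)))"
      by (intro sum.cong refl) (auto simp: Q_def algebra_simps)
    also have "\<dots> = (if i = j then 1 else 0) - c * w j * w i + (- c * w i * w j + c * c * w i * w j * (\<Sum>k<d. w k * w k))"
      using ij by (simp add: sum.distrib sum.delta sum_distrib_left)
    also have "\<dots> = (if i = j then 1 else 0) - 2 * c * w i * w j * (1 - c * (1 - v 0))"
      unfolding ww by (simp add: algebra_simps)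
    finally show ?thesis unfolding c by simp
  qed
  then have "orthogonal_mat d Q" by (simp add: orthogonal_mat_def)
  moreover have "Q 0 j = v j" for j
  proof -
    have "c * w 0 = - 1" using c by (simp add: w_def algebra_simps)
    then show ?thesis by (simp add: Q_def w_def)
  qed
  ultimately show ?thesis by blast
qed

lemma ip_self_L2: "ip d v v = (L2_set v {..<d})\<^sup>2"
  by (simp add: ip_def L2_set_def sum_nonneg power2_eq_square)

lemma ip_commute: "ip d u v = ip d v u"
  by (simp add: ip_def mult.commute)

lemma std_gaussian_norm_fourth_moment_ge:
  "ennreal ((real d)\<^sup>2) \<le> (\<integral>\<^sup>+b. ennreal ((ip d b b)\<^sup>2) \<partial>std_gaussian d)"
proof -
  interpret G: prob_space "std_gaussian d" by (rule prob_space_std_gaussian)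
  define e where "e j = (\<lambda>i. if i = j then 1 else 0 :: real)" for j :: nat
  have ipe: "ip d b (e j) = b j" "ip d (e j) (e j) = 1" if "j < d" for b j
    using that by (simp_all add: ip_def e_def if_distrib[of "\<lambda>x. _ * x"] sum.delta cong: if_cong)
  have sq: "integrable (std_gaussian d) (\<lambda>b. b j * b j)" "(LINT b|std_gaussian d. b j * b j) = 1" if "j < d" for j
    using ip_std_gaussian_moments(1)[of d "e j" 2] ip_std_gaussian_moments(3)[of d "e j"] ipe[OF that]
    by (simp_all add: power2_eq_square)
  have i1: "integrable (std_gaussian d) (\<lambda>b. ip d b b)" unfolding ip_def by (intro Bochner_Integration.integrable_sum sq) auto
  have e1: "(LINT b|std_gaussian d. ip d b b) = d"
    unfolding ip_def by (subst Bochner_Integration.integral_sum) (auto simp: sq)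
  have "integrable (std_gaussian d) (\<lambda>b. (ip d b b - d)\<^sup>2)"
  proof (rule G.integrable_power_le_4)
    show "(\<lambda>b. ip d b b - real d) \<in> borel_measurable (std_gaussian d)" by measurable
    show "integrable (std_gaussian d) (\<lambda>b. (ip d b b - real d) ^ 4)" by (rule std_gaussian_norm_moment)
  qed simp
  then have "integrable (std_gaussian d) (\<lambda>b. (ip d b b - d)\<^sup>2 + (2 * d * ip d b b - d * d))"
    by (intro Bochner_Integration.integrable_add Bochner_Integration.integrable_diff integrable_mult_right i1 G.integrable_const)
  then have i2: "integrable (std_gaussian d) (\<lambda>b. (ip d b b)\<^sup>2)" by (simp add: power2_eq_square algebra_simps)
  have "(real d)\<^sup>2 = (LINT b|std_gaussian d. 2 * d * ip d b b - d * d)"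
    using i1 e1 G.prob_space by (simp add: power2_eq_square)
  also have "\<dots> \<le> (LINT b|std_gaussian d. (ip d b b)\<^sup>2)"
  proof (rule integral_mono)
    show "2 * d * ip d b b - d * d \<le> (ip d b b)\<^sup>2" for b
      using zero_le_power2[of "ip d b b - d"] by (simp add: power2_eq_square algebra_simps)
  qed (use i1 i2 in auto)
  finally show ?thesis using i2 by (subst nn_integral_eq_integral) (auto intro: ennreal_leI)
qed

lemma measurable_L2_set:
  assumes "\<And>j. j < d \<Longrightarrow> (\<lambda>x. f x j) \<in> borel_measurable M"
  shows "(\<lambda>x. L2_set (f x) {..<d}) \<in> borel_measurable M"
proof -
  have "(\<lambda>x. \<Sum>j<d. (f x j)\<^sup>2) \<in> borel_measurable M"
    using assms by (intro borel_measurable_sum borel_measurable_power) auto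
  then show ?thesis unfolding L2_set_def by measurable
qed

text \<open>By rotation invariance the fourth moment of \<open>\<langle>x, b\<rangle>\<close> under \<open>\<mu>\<close> is \<open>\<kappa> \<parallel>b\<parallel>\<^sup>4\<close> for every vector \<open>b\<close>. Average this
over a standard Gaussian \<open>b\<close>: for each fixed unit vector \<open>x\<close> the expectation of \<open>\<langle>x, b\<rangle>\<^sup>4\<close> is \<open>3\<close>, hence
\<open>\<kappa> E \<parallel>b\<parallel>\<^sup>4 = 3\<close>, while \<open>E \<parallel>b\<parallel>\<^sup>4 \<ge> d\<^sup>2\<close>.\<close>

lemma sphere_fourth_moment_le:
  assumes \<mu>: "uniform_on_sphere d \<mu>" and d: "0 < d" and v: "ip d v v = 1"
  shows "(\<integral>\<^sup>+x. ennreal (ip d x v ^ 4) \<partial>\<mu>) \<le> ennreal (3 / (real d)\<^sup>2)"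
proof -
  have P: "prob_space \<mu>" and s [measurable_cong]: "sets \<mu> = sets (vec_borel d)"
    and AE: "AE x in \<mu>. ip d x x = 1"
    and inv: "\<And>Q. orthogonal_mat d Q \<Longrightarrow> distr \<mu> (vec_borel d) (mat_apply d Q) = \<mu>"
    using \<mu> by (auto simp: uniform_on_sphere_def ip_self_L2)
  interpret \<mu>: prob_space \<mu> by fact
  have [measurable]: "(\<lambda>x. x 0) \<in> borel_measurable (vec_borel d)"
    using d by (intro measurable_component_singleton) auto
  define \<kappa> where "\<kappa> = (\<integral>\<^sup>+x. ennreal (x 0 ^ 4) \<partial>\<mu>)"
  have unit: "(\<integral>\<^sup>+x. ennreal (ip d x u ^ 4) \<partial>\<mu>) = \<kappa>" if u: "ip d u u = 1" for u
  proof -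
    obtain Q where Q: "orthogonal_mat d Q" "\<And>j. j < d \<Longrightarrow> Q 0 j = u j"
      using orthogonal_mat_with_first_row[OF d u] by blast
    have "(\<lambda>u. \<lambda>i\<in>{..<d}. \<Sum>j<d. Q i j * u j) \<in> vec_borel d \<rightarrow>\<^sub>M vec_borel d"
      by (intro measurable_restrict borel_measurable_sum borel_measurable_times borel_measurable_const)
         (rule measurable_component_singleton)
    then have [measurable]: "mat_apply d Q \<in> \<mu> \<rightarrow>\<^sub>M vec_borel d" 
      by (simp add: mat_apply_def[abs_def] measurable_cong_sets[OF s refl])
    have "\<kappa> = (\<integral>\<^sup>+x. ennreal (mat_apply d Q x 0 ^ 4) \<partial>\<mu>)"
      unfolding \<kappa>_def by (subst inv[OF Q(1), symmetric], subst nn_integral_distr) auto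
    also have "\<dots> = (\<integral>\<^sup>+x. ennreal (ip d x u ^ 4) \<partial>\<mu>)"
      using d Q(2) by (simp add: mat_apply_def ip_def mult.commute)
    finally show ?thesis by simp
  qed
  have gen: "(\<integral>\<^sup>+x. ennreal (ip d x b ^ 4) \<partial>\<mu>) = ennreal ((ip d b b)\<^sup>2) * \<kappa>" for b
  proof (cases "ip d b b = 0")
    case True
    then have "\<forall>j<d. b j = 0" by (simp add: ip_self_eq_0_iff)
    then have "ip d x b = 0" for x by (simp add: ip_def)
    then show ?thesis using True by simp
  next
    case False
    let ?s = "sqrt (ip d b b)"
    have nn: "0 \<le> ip d b b" by (simp add: ip_self_L2)
    define u where "u = (\<lambda>j. (1 / ?s) * b j)"
    have "ip d u u = ip d b b / ?s\<^sup>2"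
      unfolding u_def ip_scale_left ip_scale_right by (simp add: power2_eq_square)
    then have u: "ip d u u = 1" using False nn by simp
    have su: "ip d x b = ?s * ip d x u" for x unfolding u_def ip_scale_right using False by simp
    have s4: "?s ^ 4 = (ip d b b)\<^sup>2" using nn by (simp add: power4_eq_xxxx power2_eq_square)
    have p4: "ip d x b ^ 4 = (ip d b b)\<^sup>2 * ip d x u ^ 4" for x
      by (subst su) (simp only: power_mult_distrib s4)
    have "(\<integral>\<^sup>+x. ennreal (ip d x b ^ 4) \<partial>\<mu>) = (\<integral>\<^sup>+x. ennreal ((ip d b b)\<^sup>2) * ennreal (ip d x u ^ 4) \<partial>\<mu>)"
      by (intro nn_integral_cong) (simp only: p4 ennreal_mult zero_le_power2 zero_le_even_power even_numeral)
    also have "\<dots> = ennreal ((ip d b b)\<^sup>2) * \<kappa>"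
    proof (subst nn_integral_cmult)
      show "(\<lambda>x. ennreal (ip d x u ^ 4)) \<in> borel_measurable \<mu>" by measurable
    qed (simp add: unit[OF u])
    finally show ?thesis .
  qed
  let ?G = "std_gaussian d"
  have "\<kappa> * ennreal ((real d)\<^sup>2) \<le> \<kappa> * (\<integral>\<^sup>+b. ennreal ((ip d b b)\<^sup>2) \<partial>?G)"
    by (intro mult_left_mono std_gaussian_norm_fourth_moment_ge) auto
  also have "\<dots> = (\<integral>\<^sup>+b. \<integral>\<^sup>+x. ennreal (ip d x b ^ 4) \<partial>\<mu> \<partial>?G)"
    unfolding gen by (subst nn_integral_multc) (auto simp: mult.commute)
  also have "\<dots> = (\<integral>\<^sup>+x. \<integral>\<^sup>+b. ennreal (ip d x b ^ 4) \<partial>?G \<partial>\<mu>)"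
    by (rule nn_integral_swap[OF prob_space_std_gaussian P]) measurable
  also have "\<dots> = (\<integral>\<^sup>+x. 3 \<partial>\<mu>)"
  proof (rule nn_integral_cong_AE)
    show "AE x in \<mu>. (\<integral>\<^sup>+b. ennreal (ip d x b ^ 4) \<partial>?G) = 3"
      using AE
    proof eventually_elim
      case (elim x)
      have "(\<integral>\<^sup>+b. ennreal (ip d b x ^ 4) \<partial>?G) = ennreal 3"
        using ip_std_gaussian_moments(1)[of d x 4] ip_std_gaussian_moments(4)[of d x] elim
        by (subst nn_integral_eq_integral) auto
      then show ?case by (simp add: ip_commute[of d x])
    qed
  qed
  finally have le: "\<kappa> * ennreal ((real d)\<^sup>2) \<le> ennreal 3" using \<mu>.emeasure_space_1 by simp
  then have "\<kappa> \<noteq> \<top>" using d by (auto simp: ennreal_top_mult top_unique)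
  then obtain k where k: "\<kappa> = ennreal k" "0 \<le> k" by (cases \<kappa>) auto
  then have "ennreal (k * (real d)\<^sup>2) \<le> ennreal 3" using le by (subst ennreal_mult) auto
  then have "k * (real d)\<^sup>2 \<le> 3" by (rule iffD1[OF ennreal_le_iff, rotated]) simp
  then have "k \<le> 3 / (real d)\<^sup>2" using d by (simp add: field_simps)
  then show ?thesis using k unit[OF v] by (auto intro: ennreal_leI)
qed

lemma sphere_overlap_tail:
  assumes \<mu>: "uniform_on_sphere d \<mu>" and d: "0 < d" and e: "0 < e"
  shows "(\<integral>\<^sup>+x1. \<integral>\<^sup>+x2. indicator {x2. e < \<bar>ip d x1 x2\<bar>} x2 \<partial>\<mu> \<partial>\<mu>) \<le> ennreal (3 / e ^ 4 / (real d)\<^sup>2)"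
proof -
  interpret \<mu>: prob_space \<mu> using \<mu> by (simp add: uniform_on_sphere_def)
  have s [measurable_cong]: "sets \<mu> = sets (vec_borel d)" and AE: "AE x in \<mu>. ip d x x = 1"
    using \<mu> by (auto simp: uniform_on_sphere_def ip_self_L2)
  have "AE x1 in \<mu>. (\<integral>\<^sup>+x2. indicator {x2. e < \<bar>ip d x1 x2\<bar>} x2 \<partial>\<mu>) \<le> ennreal (3 / e ^ 4 / (real d)\<^sup>2)"
    using AE
  proof eventually_elim
    case (elim x1)
    have "(\<integral>\<^sup>+x2. indicator {x2. e < \<bar>ip d x1 x2\<bar>} x2 \<partial>\<mu>) \<le> (\<integral>\<^sup>+x2. ennreal (1 / e ^ 4) * ennreal (ip d x2 x1 ^ 4) \<partial>\<mu>)"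
    proof (rule nn_integral_mono)
      fix x2
      have "1 \<le> 1 / e ^ 4 * ip d x2 x1 ^ 4" if "e < \<bar>ip d x1 x2\<bar>"
      proof -
        have "e ^ 4 \<le> \<bar>ip d x1 x2\<bar> ^ 4" using that e by (intro power_mono) auto
        then show ?thesis using e by (simp add: ip_commute divide_simps)
      qed
      then show "indicator {x2. e < \<bar>ip d x1 x2\<bar>} x2 \<le> ennreal (1 / e ^ 4) * ennreal (ip d x2 x1 ^ 4)"
        by (auto simp: indicator_def simp flip: ennreal_mult' ennreal_1 intro!: ennreal_leI)
    qed
    also have "\<dots> = ennreal (1 / e ^ 4) * (\<integral>\<^sup>+x2. ennreal (ip d x2 x1 ^ 4) \<partial>\<mu>)"
      by (rule nn_integral_cmult) measurable
    also have "\<dots> \<le> ennreal (1 / e ^ 4) * ennreal (3 / (real d)\<^sup>2)"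
      by (intro mult_left_mono sphere_fourth_moment_le \<mu> d elim) auto
    also have "\<dots> = ennreal (3 / e ^ 4 / (real d)\<^sup>2)" using e by (simp flip: ennreal_mult')
    finally show ?case .
  qed
  then have "(\<integral>\<^sup>+x1. \<integral>\<^sup>+x2. indicator {x2. e < \<bar>ip d x1 x2\<bar>} x2 \<partial>\<mu> \<partial>\<mu>) \<le> (\<integral>\<^sup>+x1. ennreal (3 / e ^ 4 / (real d)\<^sup>2) \<partial>\<mu>)"
    by (rule nn_integral_mono_AE)
  also have "\<dots> = ennreal (3 / e ^ 4 / (real d)\<^sup>2)" using \<mu>.emeasure_space_1 by simp
  finally show ?thesis .
qed

section \<open>The residual for given weights\<close>

abbreviation gauss_rows :: "nat \<Rightarrow> nat \<Rightarrow> (nat \<Rightarrow> nat \<Rightarrow> real) measure" where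
  "gauss_rows n d \<equiv> PiM {..<n} (\<lambda>_. std_gaussian d)"

lemma measurable_rows [measurable]:
  assumes "i < n" "j < d"
  shows "(\<lambda>b. b i j) \<in> borel_measurable (gauss_rows n d)"
proof -
  have "(\<lambda>w. w j) \<in> borel_measurable (std_gaussian d)"
    using assms by (simp add: std_gaussian_def measurable_component_singleton)
  then show ?thesis using assms by (intro measurable_compose[OF measurable_component_singleton]) auto
qed

lemma measurable_rows_linear_form:
  "(\<lambda>b. \<Sum>i<n. ip d (b i) (c i)) \<in> borel_measurable (gauss_rows n d)"
  by (intro borel_measurable_sum measurable_ip measurable_rows) auto

lemma gaussian_rows_linear_form_tail:
  assumes c: "\<And>i. i < n \<Longrightarrow> ip d (c i) (c i) \<le> (w i / real n)\<^sup>2"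
    and V: "V = (\<Sum>i<n. (w i)\<^sup>2) / real n" and e: "0 < e" and n: "0 < n"
  shows "measure (gauss_rows n d) {b\<in>space (gauss_rows n d). e < \<bar>(\<Sum>i<n. ip d (b i) (c i)) / sqrt V\<bar>} \<le> 3 / e ^ 4 / (real n)\<^sup>2"
proof -
  let ?A = "gauss_rows n d"
  interpret A: prob_space ?A by (intro prob_space_PiM prob_space_std_gaussian)
  have V0: "0 \<le> V" unfolding V by (intro divide_nonneg_nonneg sum_nonneg) auto
  show ?thesis
  proof (cases "V = 0")
    \<comment> \<open>Division by zero: the tail event is empty.\<close>
    case True
    then show ?thesis using e by simp
  next
    case False
    then have Vp: "0 < V" using V0 by simp
    have "(\<Sum>i<n. ip d (c i) (c i)) \<le> (\<Sum>i<n. (w i / real n)\<^sup>2)" by (intro sum_mono c) auto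
    also have "\<dots> = V / n" using n by (simp add: V power_divide sum_divide_distrib power2_eq_square)
    finally have cV: "(\<Sum>i<n. ip d (c i) (c i)) \<le> V / n" .
    have "A.prob {b\<in>space ?A. e < \<bar>(\<Sum>i<n. ip d (b i) (c i)) / sqrt V\<bar>} =
      A.prob {b\<in>space ?A. e * sqrt V < \<bar>\<Sum>i<n. ip d (b i) (c i)\<bar>}"
      using Vp by (simp add: field_simps abs_divide)
    also have "\<dots> \<le> A.expectation (\<lambda>b. (\<Sum>i<n. ip d (b i) (c i)) ^ 4) / (e * sqrt V) ^ 4"
      using e Vp by (intro A.fourth_power_markov measurable_rows_linear_form gaussian_rows_linear_form_moment) auto
    also have "\<dots> \<le> 3 * (\<Sum>i<n. ip d (c i) (c i))\<^sup>2 / (e * sqrt V) ^ 4"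
      using e Vp by (intro divide_right_mono gaussian_rows_linear_form_moment) auto
    also have "\<dots> \<le> 3 * (V / n)\<^sup>2 / (e * sqrt V) ^ 4"
      using e Vp cV by (intro divide_right_mono mult_left_mono power_mono sum_nonneg) (auto simp: ip_self_L2)
    also have "\<dots> = 3 / e ^ 4 / (real n)\<^sup>2"
    proof -
      have "(e * sqrt V) ^ 4 = e ^ 4 * V\<^sup>2" using Vp by (simp add: power_mult_distrib power4_eq_xxxx power2_eq_square)
      then show ?thesis using Vp e n by (simp add: power_divide)
    qed
    finally show ?thesis .
  qed
qed

lemma sqrt_power4: "0 \<le> x \<Longrightarrow> sqrt x ^ 4 = x\<^sup>2"
  by (simp add: power4_eq_xxxx power2_eq_square)

lemma L2_set_scale: "0 \<le> c \<Longrightarrow> L2_set (\<lambda>j. c * f j) A = c * L2_set f A"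
  by (simp add: L2_set_right_distrib)

text \<open>The vector is distributed like \<open>sqrt (V / n)\<close> times a standard Gaussian vector \<open>z\<close>, and
\<open>\<bar>\<parallel>z\<parallel> - sqrt d\<bar> \<le> \<bar>\<parallel>z\<parallel>\<^sup>2 - d\<bar> / sqrt d\<close>.\<close>

lemma gaussian_rows_norm_tail:
  assumes V: "V = (\<Sum>i<n. (w i)\<^sup>2) / real n" and e: "0 < e" and n: "0 < n" and d: "0 < d"
  shows "measure (gauss_rows n d) {b\<in>space (gauss_rows n d).
      e < \<bar>L2_set (\<lambda>j. \<Sum>i<n. w i / real n * b i j) {..<d} - sqrt (V * d / n)\<bar> / sqrt V} \<le> 60 / e ^ 4 / (real n)\<^sup>2"
proof -
  let ?A = "gauss_rows n d" and ?G = "std_gaussian d"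
  interpret A: prob_space ?A by (intro prob_space_PiM prob_space_std_gaussian)
  interpret G: prob_space ?G by (rule prob_space_std_gaussian)
  have V0: "0 \<le> V" unfolding V by (intro divide_nonneg_nonneg sum_nonneg) auto
  show ?thesis
  proof (cases "V = 0")
    case True
    then show ?thesis using e by simp
  next
    case False
    then have Vp: "0 < V" using V0 by simp
    define F :: "(nat \<Rightarrow> real) \<Rightarrow> ennreal" where
      "F = indicator {v. e < \<bar>L2_set v {..<d} - sqrt (V * d / n)\<bar> / sqrt V}"
    have L2m: "(\<lambda>v. L2_set v {..<d}) \<in> borel_measurable (vec_borel d)" unfolding L2_set_def by measurable
    then have F [measurable]: "F \<in> borel_measurable (vec_borel d)" unfolding F_def
      by (intro borel_measurable_indicator') auto
    have s: "sqrt (\<Sum>i<n. (w i / real n)\<^sup>2) = sqrt (V / n)"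
      using n by (simp add: V power_divide sum_divide_distrib power2_eq_square)
    have L2r: "L2_set (\<lambda>j\<in>{..<d}. f j) {..<d} = L2_set f {..<d}" for f by (intro L2_set_cong) auto
    have mA: "(\<lambda>b. L2_set (\<lambda>j. \<Sum>i<n. w i / real n * b i j) {..<d}) \<in> borel_measurable ?A"
      by (intro measurable_L2_set borel_measurable_sum borel_measurable_times borel_measurable_const measurable_rows) auto
    have "emeasure ?A {b\<in>space ?A. e < \<bar>L2_set (\<lambda>j. \<Sum>i<n. w i / real n * b i j) {..<d} - sqrt (V * d / n)\<bar> / sqrt V} =
      (\<integral>\<^sup>+b. indicator {b\<in>space ?A. e < \<bar>L2_set (\<lambda>j. \<Sum>i<n. w i / real n * b i j) {..<d} - sqrt (V * d / n)\<bar> / sqrt V} b \<partial>?A)"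
      using mA by (subst nn_integral_indicator) auto
    also have "\<dots> = (\<integral>\<^sup>+b. F (\<lambda>j\<in>{..<d}. \<Sum>i<n. w i / real n * b i j) \<partial>?A)"
      by (intro nn_integral_cong) (auto simp: F_def indicator_def L2r)
    also have "\<dots> = (\<integral>\<^sup>+z. F (\<lambda>j\<in>{..<d}. sqrt (V / n) * z j) \<partial>?G)"
      unfolding s[symmetric] by (rule nn_integral_gaussian_rows_combination[OF F])
    also have "\<dots> \<le> (\<integral>\<^sup>+z. indicator {z\<in>space ?G. e * sqrt n * sqrt d < \<bar>ip d z z - d\<bar>} z \<partial>?G)"
    proof (rule nn_integral_mono)
      fix z assume z: "z \<in> space ?G"
      have "e * sqrt n * sqrt d < \<bar>ip d z z - d\<bar>"
        if "e < \<bar>L2_set (\<lambda>j. sqrt (V / n) * z j) {..<d} - sqrt (V * d / n)\<bar> / sqrt V"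
      proof -
        define l where "l = L2_set z {..<d}"
        have l: "0 \<le> l" "l\<^sup>2 = ip d z z" by (simp_all add: l_def L2_set_nonneg ip_self_L2)
        have "L2_set (\<lambda>j. sqrt (V / n) * z j) {..<d} - sqrt (V * d / n) = sqrt V * ((l - sqrt d) / sqrt n)"
        proof -
          have "L2_set (\<lambda>j. sqrt (V / n) * z j) {..<d} = sqrt V * (l / sqrt n)"
            using V0 by (subst L2_set_scale) (auto simp: l_def real_sqrt_divide)
          moreover have "sqrt (V * d / n) = sqrt V * (sqrt d / sqrt n)" by (simp add: real_sqrt_mult real_sqrt_divide)
          ultimately show ?thesis by (simp add: diff_divide_distrib right_diff_distrib)
        qed
        then have "e < \<bar>l - sqrt d\<bar> / sqrt n" using that Vp by (simp add: abs_mult)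
        then have 1: "e * sqrt n < \<bar>l - sqrt d\<bar>" using n by (simp add: field_simps)
        have "e * sqrt n * sqrt d < \<bar>l - sqrt d\<bar> * sqrt d" using 1 d by simp
        also have "\<dots> \<le> \<bar>l - sqrt d\<bar> * (l + sqrt d)" using l by (intro mult_left_mono) auto
        also have "\<dots> = \<bar>(l - sqrt d) * (l + sqrt d)\<bar>" using l by (simp add: abs_mult)
        also have "(l - sqrt d) * (l + sqrt d) = ip d z z - d"
          using l(2) by (simp add: power2_eq_square algebra_simps)
        finally show ?thesis .
      qed
      then show "F (\<lambda>j\<in>{..<d}. sqrt (V / n) * z j) \<le> indicator {z\<in>space ?G. e * sqrt n * sqrt d < \<bar>ip d z z - d\<bar>} z"
        using z by (auto simp: F_def L2r indicator_def)
    qed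
    also have "\<dots> = emeasure ?G {z\<in>space ?G. e * sqrt n * sqrt d < \<bar>ip d z z - d\<bar>}"
      by (rule nn_integral_indicator) measurable
    finally have "A.prob {b\<in>space ?A. e < \<bar>L2_set (\<lambda>j. \<Sum>i<n. w i / real n * b i j) {..<d} - sqrt (V * d / n)\<bar> / sqrt V} \<le>
      G.prob {z\<in>space ?G. e * sqrt n * sqrt d < \<bar>ip d z z - d\<bar>}"
      by (simp add: A.emeasure_eq_measure G.emeasure_eq_measure)
    also have "\<dots> \<le> G.expectation (\<lambda>z. (ip d z z - d) ^ 4) / (e * sqrt n * sqrt d) ^ 4"
    proof (rule G.fourth_power_markov)
      show "(\<lambda>z. ip d z z - real d) \<in> borel_measurable ?G" by measurable
    qed (use e n d in \<open>auto intro: std_gaussian_norm_moment\<close>)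
    also have "\<dots> \<le> 60 * (real d)\<^sup>2 / (e * sqrt n * sqrt d) ^ 4"
      by (intro divide_right_mono std_gaussian_norm_moment) auto
    also have "\<dots> = 60 / e ^ 4 / (real n)\<^sup>2"
    proof -
      have "(e * sqrt n * sqrt d) ^ 4 = e ^ 4 * (real n)\<^sup>2 * (real d)\<^sup>2"
        by (simp add: power_mult_distrib sqrt_power4)
      then show ?thesis using d by simp
    qed
    finally show ?thesis .
  qed
qed

text \<open>The contribution to the linear estimator of those parts of the covariates \<open>a i\<close> that are orthogonal to the
signals \<open>u i\<close>, when sample \<open>i\<close> has weight \<open>w i\<close>.\<close>

definition residual :: "nat \<Rightarrow> nat \<Rightarrow> (nat \<Rightarrow> real) \<Rightarrow> (nat \<Rightarrow> nat \<Rightarrow> real) \<Rightarrow> (nat \<Rightarrow> nat \<Rightarrow> real) \<Rightarrow> nat \<Rightarrow> real" where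
  "residual d n w u a = (\<lambda>j. (1 / real n) * (\<Sum>i<n. w i * (a i j - ip d (a i) (u i) * u i j)))"

lemma ip_diff_right: "ip d x (\<lambda>j. u j - v j) = ip d x u - ip d x v"
  by (simp add: ip_def right_diff_distrib sum_subtractf)

lemma ip_residual:
  "ip d (residual d n w u a) x =
    (\<Sum>i<n. ip d (a i) (\<lambda>j. (w i / real n) * (x j - ip d (u i) x * u i j)))"
proof -
  have "ip d (residual d n w u a) x = (\<Sum>j<d. \<Sum>i<n. (w i / real n) * (a i j * x j - ip d (a i) (u i) * (u i j * x j)))"
    unfolding ip_def[of d "residual d n w u a"]
    by (intro sum.cong refl) (simp add: residual_def sum_distrib_left sum_distrib_right algebra_simps)
  also have "\<dots> = (\<Sum>i<n. \<Sum>j<d. (w i / real n) * (a i j * x j - ip d (a i) (u i) * (u i j * x j)))"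
    by (rule sum.swap)
  also have "\<dots> = (\<Sum>i<n. (w i / real n) * (ip d (a i) x - ip d (a i) (u i) * ip d (u i) x))"
    by (simp add: ip_def sum_distrib_left sum_subtractf right_diff_distrib)
  also have "\<dots> = (\<Sum>i<n. ip d (a i) (\<lambda>j. (w i / real n) * (x j - ip d (u i) x * u i j)))"
    unfolding ip_scale_right ip_diff_right by (simp add: mult.commute)
  finally show ?thesis .
qed

text \<open>A linear form in the rows with coefficient vectors \<open>(w\<^sub>i / n) (x - \<langle>u\<^sub>i, x\<rangle> u\<^sub>i)\<close>; projections do not increase
norms.\<close>

lemma residual_inner_product_tail:
  assumes u: "\<And>i. i < n \<Longrightarrow> ip d (u i) (u i) = 1" and x: "ip d x x = 1"
    and V: "V = (\<Sum>i<n. (w i)\<^sup>2) / real n" and e: "0 < e" and n: "0 < n"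
  shows "measure (gauss_rows n d) {b\<in>space (gauss_rows n d). e < \<bar>ip d (residual d n w u b) x / sqrt V\<bar>} \<le> 3 / e ^ 4 / (real n)\<^sup>2"
  unfolding ip_residual
proof (rule gaussian_rows_linear_form_tail[OF _ V e n])
  fix i assume i: "i < n"
  have "ip d (\<lambda>j. x j - ip d (u i) x * u i j) (\<lambda>j. x j - ip d (u i) x * u i j) = 1 - (ip d (u i) x)\<^sup>2"
  proof -
    let ?v = "\<lambda>j. x j - ip d (u i) x * u i j"
    have "ip d ?v ?v = ip d ?v x - ip d (u i) x * ip d ?v (u i)" by (simp add: ip_diff_right ip_scale_right)
    also have "ip d ?v x = 1 - ip d (u i) x * ip d (u i) x"
      unfolding ip_commute[of d ?v] ip_diff_right ip_scale_right using x by (simp add: ip_commute)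
    also have "ip d ?v (u i) = 0"
      unfolding ip_commute[of d ?v] ip_diff_right ip_scale_right using u[OF i] by (simp add: ip_commute)
    finally show ?thesis by (simp add: power2_eq_square)
  qed
  then have "ip d (\<lambda>j. (w i / real n) * (x j - ip d (u i) x * u i j)) (\<lambda>j. (w i / real n) * (x j - ip d (u i) x * u i j)) =
    (w i / real n)\<^sup>2 * (1 - (ip d (u i) x)\<^sup>2)"
    unfolding ip_scale_left ip_scale_right by (simp add: power2_eq_square)
  also have "\<dots> \<le> (w i / real n)\<^sup>2 * 1" by (intro mult_left_mono) auto
  finally show "ip d (\<lambda>j. (w i / real n) * (x j - ip d (u i) x * u i j)) (\<lambda>j. (w i / real n) * (x j - ip d (u i) x * u i j)) \<le> (w i / real n)\<^sup>2"
    by simp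
qed

text \<open>The residual is \<open>\<Sum>i<n. (w\<^sub>i / n) b\<^sub>i\<close> minus its components \<open>B\<^sub>1 x\<^sub>1\<close> and \<open>B\<^sub>2 x\<^sub>2\<close>, and \<open>B\<^sub>1\<close>, \<open>B\<^sub>2\<close> are linear
forms of the order of \<open>sqrt (V / n)\<close>. One third of \<open>e\<close> is allotted to each of the three terms, whence the constant
\<open>5346 = 3\<^sup>4 (3 + 3 + 60)\<close>.\<close>

lemma residual_norm_tail:
  assumes x1: "ip d x1 x1 = 1" and x2: "ip d x2 x2 = 1"
    and V: "V = (\<Sum>i<n. (w i)\<^sup>2) / real n" and e: "0 < e" and n: "0 < n" and d: "0 < d"
  shows "measure (gauss_rows n d) {b\<in>space (gauss_rows n d).
    e < \<bar>(L2_set (residual d n w (\<lambda>i. if \<eta> i then x1 else x2) b) {..<d} - sqrt (V * d / n)) / sqrt V\<bar>} \<le> 5346 / e ^ 4 / (real n)\<^sup>2"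
proof -
  let ?A = "gauss_rows n d"
  interpret A: prob_space ?A by (intro prob_space_PiM prob_space_std_gaussian)
  have V0: "0 \<le> V" unfolding V by (intro divide_nonneg_nonneg sum_nonneg) auto
  define c1 where "c1 i = (\<lambda>j. (if \<eta> i then w i / real n else 0) * x1 j)" for i
  define c2 where "c2 i = (\<lambda>j. (if \<eta> i then 0 else w i / real n) * x2 j)" for i
  let ?B1 = "\<lambda>b. \<Sum>i<n. ip d (b i) (c1 i)" and ?B2 = "\<lambda>b. \<Sum>i<n. ip d (b i) (c2 i)"
  let ?E = "\<lambda>b j. \<Sum>i<n. w i / real n * b i j"
  let ?r = "\<lambda>b. residual d n w (\<lambda>i. if \<eta> i then x1 else x2) b"
  let ?s = "sqrt (V * d / n)"
  have c: "ip d (c1 i) (c1 i) \<le> (w i / real n)\<^sup>2" "ip d (c2 i) (c2 i) \<le> (w i / real n)\<^sup>2" for i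
    unfolding c1_def c2_def ip_scale_left ip_scale_right using x1 x2 by (auto simp: power2_eq_square)
  have L1: "L2_set x1 {..<d} = 1" "L2_set x2 {..<d} = 1"
    using x1 x2 L2_set_nonneg[of x1 "{..<d}"] L2_set_nonneg[of x2 "{..<d}"] by (auto simp: ip_self_L2 power2_eq_1_iff)
  have dec: "?r b j = ?E b j - ?B1 b * x1 j - ?B2 b * x2 j" for b j
  proof -
    have "?r b j = (\<Sum>i<n. w i / real n * b i j - (ip d (b i) (c1 i) * x1 j + ip d (b i) (c2 i) * x2 j))"
      unfolding residual_def c1_def c2_def ip_scale_right sum_distrib_left
      by (intro sum.cong) (auto simp: algebra_simps)
    then show ?thesis by (simp add: sum_subtractf sum.distrib sum_distrib_right)
  qed
  have tri: "\<bar>L2_set (?r b) {..<d} - L2_set (?E b) {..<d}\<bar> \<le> \<bar>?B1 b\<bar> + \<bar>?B2 b\<bar>" for b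
  proof -
    have sc: "L2_set (\<lambda>j. t * f j) {..<d} = \<bar>t\<bar> * L2_set f {..<d}" for t f
      unfolding L2_set_def by (simp add: power_mult_distrib real_sqrt_mult flip: sum_distrib_left)
    have "L2_set (\<lambda>j. ?B1 b * x1 j + ?B2 b * x2 j) {..<d} \<le> \<bar>?B1 b\<bar> + \<bar>?B2 b\<bar>"
      using L2_set_triangle_ineq[of "\<lambda>j. ?B1 b * x1 j" "\<lambda>j. ?B2 b * x2 j" "{..<d}"] by (simp add: sc L1)
    moreover have "L2_set (?E b) {..<d} \<le> L2_set (?r b) {..<d} + L2_set (\<lambda>j. ?B1 b * x1 j + ?B2 b * x2 j) {..<d}"
      using L2_set_triangle_ineq[of "?r b" "\<lambda>j. ?B1 b * x1 j + ?B2 b * x2 j" "{..<d}"] by (simp add: dec)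
    moreover have "L2_set (?r b) {..<d} \<le> L2_set (?E b) {..<d} + L2_set (\<lambda>j. ?B1 b * x1 j + ?B2 b * x2 j) {..<d}"
    proof -
      have "?r b = (\<lambda>j. ?E b j + (- 1) * (?B1 b * x1 j + ?B2 b * x2 j))" by (simp add: dec fun_eq_iff)
      then show ?thesis
        using L2_set_triangle_ineq[of "?E b" "\<lambda>j. (- 1) * (?B1 b * x1 j + ?B2 b * x2 j)" "{..<d}"]
        unfolding sc by simp
    qed
    ultimately show ?thesis by linarith
  qed
  let ?X1 = "{b\<in>space ?A. e / 3 < \<bar>?B1 b / sqrt V\<bar>}" and ?X2 = "{b\<in>space ?A. e / 3 < \<bar>?B2 b / sqrt V\<bar>}"
    and ?X3 = "{b\<in>space ?A. e / 3 < \<bar>L2_set (?E b) {..<d} - ?s\<bar> / sqrt V}"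
  have [measurable]: "?B1 \<in> borel_measurable ?A" "?B2 \<in> borel_measurable ?A" by (rule measurable_rows_linear_form)+
  have mE: "(\<lambda>b. L2_set (?E b) {..<d}) \<in> borel_measurable ?A"
    by (intro measurable_L2_set borel_measurable_sum borel_measurable_times borel_measurable_const measurable_rows) auto
  have X: "?X1 \<in> A.events" "?X2 \<in> A.events" "?X3 \<in> A.events" using mE by auto
  have "A.prob {b\<in>space ?A. e < \<bar>(L2_set (?r b) {..<d} - ?s) / sqrt V\<bar>} \<le> A.prob (?X1 \<union> (?X2 \<union> ?X3))"
  proof (rule A.finite_measure_mono)
    show "{b\<in>space ?A. e < \<bar>(L2_set (?r b) {..<d} - ?s) / sqrt V\<bar>} \<subseteq> ?X1 \<union> (?X2 \<union> ?X3)"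
    proof (rule subsetI, rule ccontr)
      fix b assume b: "b \<in> {b\<in>space ?A. e < \<bar>(L2_set (?r b) {..<d} - ?s) / sqrt V\<bar>}" and "b \<notin> ?X1 \<union> (?X2 \<union> ?X3)"
      then have "\<bar>?B1 b\<bar> / sqrt V \<le> e / 3" "\<bar>?B2 b\<bar> / sqrt V \<le> e / 3" "\<bar>L2_set (?E b) {..<d} - ?s\<bar> / sqrt V \<le> e / 3"
        using V0 by (auto simp: abs_divide not_less)
      moreover have "\<bar>L2_set (?r b) {..<d} - ?s\<bar> / sqrt V \<le> (\<bar>?B1 b\<bar> + \<bar>?B2 b\<bar> + \<bar>L2_set (?E b) {..<d} - ?s\<bar>) / sqrt V"
        using tri[of b] V0 by (intro divide_right_mono) auto
      ultimately have "\<bar>L2_set (?r b) {..<d} - ?s\<bar> / sqrt V \<le> e" unfolding add_divide_distrib by linarith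
      then show False using b V0 by (simp add: abs_divide)
    qed
  qed (intro sets.Un X)
  also have "\<dots> \<le> A.prob ?X1 + (A.prob ?X2 + A.prob ?X3)"
    using measure_Un_le[OF X(1) sets.Un[OF X(2,3)]] measure_Un_le[OF X(2,3)] by linarith
  also have "\<dots> \<le> 3 / (e / 3) ^ 4 / (real n)\<^sup>2 + (3 / (e / 3) ^ 4 / (real n)\<^sup>2 + 60 / (e / 3) ^ 4 / (real n)\<^sup>2)"
  proof -
    have e3: "0 < e / 3" using e by simp
    show ?thesis
      by (rule add_mono[OF gaussian_rows_linear_form_tail[OF c(1) V e3 n]
            add_mono[OF gaussian_rows_linear_form_tail[OF c(2) V e3 n] gaussian_rows_norm_tail[OF V e3 n d]]])
  qed
  also have "\<dots> = 5346 / e ^ 4 / (real n)\<^sup>2"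
    by (simp add: power_divide flip: add_divide_distrib)
  finally show ?thesis .
qed

section \<open>Integration over an instance of the model\<close>

abbreviation latent_law :: "nat \<Rightarrow> real \<Rightarrow> (nat \<Rightarrow> bool) measure" where
  "latent_law n \<alpha> \<equiv> PiM {..<n} (\<lambda>_. measure_pmf (bernoulli_pmf \<alpha>))"

abbreviation sample_law :: "real \<Rightarrow> real measure \<Rightarrow> (bool \<times> real \<times> real) measure" where
  "sample_law \<alpha> P \<equiv> measure_pmf (bernoulli_pmf \<alpha>) \<Otimes>\<^sub>M scalar_law P"

lemma nn_integral_const_prob:
  "prob_space N \<Longrightarrow> (\<integral>\<^sup>+x. c \<partial>N) = c"
  by (simp add: prob_space.emeasure_space_1)

text \<open>The covariates are integrated first, since all estimates are conditional on the other variables.\<close>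

lemma nn_integral_instance:
  assumes \<mu>: "prob_space \<mu>" and P: "prob_space P" and F: "F \<in> borel_measurable (instance_law d n \<mu> \<alpha> P)"
  shows "(\<integral>\<^sup>+t. F t \<partial>instance_law d n \<mu> \<alpha> P) =
    (\<integral>\<^sup>+x1. \<integral>\<^sup>+x2. \<integral>\<^sup>+s. \<integral>\<^sup>+a. F (x1, x2, a, s) \<partial>gauss_rows n d \<partial>(latent_law n \<alpha> \<Otimes>\<^sub>M PiM {..<n} (\<lambda>_. P)) \<partial>\<mu> \<partial>\<mu>)"
proof -
  let ?S = "latent_law n \<alpha> \<Otimes>\<^sub>M PiM {..<n} (\<lambda>_. P)" and ?A = "gauss_rows n d"
  have S: "prob_space ?S" by (intro prob_space_pair prob_space_PiM P prob_space_measure_pmf)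
  have A: "prob_space ?A" by (intro prob_space_PiM prob_space_std_gaussian)
  have AS: "prob_space (?A \<Otimes>\<^sub>M ?S)" by (intro prob_space_pair A S)
  note F = F[unfolded instance_law_def]
  have "(\<integral>\<^sup>+t. F t \<partial>instance_law d n \<mu> \<alpha> P) = (\<integral>\<^sup>+x1. \<integral>\<^sup>+z. F (x1, z) \<partial>(\<mu> \<Otimes>\<^sub>M (?A \<Otimes>\<^sub>M ?S)) \<partial>\<mu>)"
    unfolding instance_law_def by (intro nn_integral_pair F prob_space_pair \<mu> AS)
  also have "\<dots> = (\<integral>\<^sup>+x1. \<integral>\<^sup>+x2. \<integral>\<^sup>+s. \<integral>\<^sup>+a. F (x1, x2, a, s) \<partial>?A \<partial>?S \<partial>\<mu> \<partial>\<mu>)"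
  proof (rule nn_integral_cong)
    fix x1 assume "x1 \<in> space \<mu>"
    then have F1: "(\<lambda>z. F (x1, z)) \<in> borel_measurable (\<mu> \<Otimes>\<^sub>M (?A \<Otimes>\<^sub>M ?S))" by (rule measurable_Pair2[OF F])
    have "(\<integral>\<^sup>+z. F (x1, z) \<partial>(\<mu> \<Otimes>\<^sub>M (?A \<Otimes>\<^sub>M ?S))) = (\<integral>\<^sup>+x2. \<integral>\<^sup>+z. F (x1, x2, z) \<partial>(?A \<Otimes>\<^sub>M ?S) \<partial>\<mu>)"
      by (rule nn_integral_pair[OF AS F1])
    also have "\<dots> = (\<integral>\<^sup>+x2. \<integral>\<^sup>+s. \<integral>\<^sup>+a. F (x1, x2, a, s) \<partial>?A \<partial>?S \<partial>\<mu>)"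
    proof (rule nn_integral_cong)
      fix x2 assume "x2 \<in> space \<mu>"
      then have F2: "(\<lambda>z. F (x1, x2, z)) \<in> borel_measurable (?A \<Otimes>\<^sub>M ?S)" by (rule measurable_Pair2[OF F1])
      have "(\<integral>\<^sup>+z. F (x1, x2, z) \<partial>(?A \<Otimes>\<^sub>M ?S)) = (\<integral>\<^sup>+a. \<integral>\<^sup>+s. F (x1, x2, a, s) \<partial>?S \<partial>?A)"
        by (rule nn_integral_pair[OF S F2])
      also have "\<dots> = (\<integral>\<^sup>+s. \<integral>\<^sup>+a. F (x1, x2, a, s) \<partial>?A \<partial>?S)"
        by (rule nn_integral_swap[OF A S]) (use F2 in \<open>simp add: split_beta'\<close>)
      finally show "(\<integral>\<^sup>+z. F (x1, x2, z) \<partial>(?A \<Otimes>\<^sub>M ?S)) = (\<integral>\<^sup>+s. \<integral>\<^sup>+a. F (x1, x2, a, s) \<partial>?A \<partial>?S)" .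
    qed
    finally show "(\<integral>\<^sup>+z. F (x1, z) \<partial>(\<mu> \<Otimes>\<^sub>M (?A \<Otimes>\<^sub>M ?S))) = (\<integral>\<^sup>+x2. \<integral>\<^sup>+s. \<integral>\<^sup>+a. F (x1, x2, a, s) \<partial>?A \<partial>?S \<partial>\<mu>)" .
  qed
  finally show ?thesis .
qed

lemma nn_integral_gauss_rows_resample:
  assumes u: "\<And>i. ip d (u i) (u i) = 1" and G: "G \<in> borel_measurable (gauss_rows n d)"
  shows "(\<integral>\<^sup>+a. G a \<partial>gauss_rows n d) =
    (\<integral>\<^sup>+\<xi>. \<integral>\<^sup>+b. G (\<lambda>i\<in>{..<n}. resample d (u i) (b i) (\<xi> i)) \<partial>gauss_rows n d \<partial>PiM {..<n} (\<lambda>_. gauss))"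
proof -
  let ?A = "gauss_rows n d" and ?X = "PiM {..<n} (\<lambda>_. gauss)"
  have A: "prob_space ?A" by (intro prob_space_PiM prob_space_std_gaussian)
  have X: "prob_space ?X" by (intro prob_space_PiM prob_space_gauss)
  have s: "sets ?A = sets (PiM {..<n} (\<lambda>_. vec_borel d))" by (intro sets_PiM_cong) (auto simp: sets_std_gaussian)
  have G': "G \<in> borel_measurable (PiM {..<n} (\<lambda>_. vec_borel d))" using G by (simp cong: measurable_cong_sets add: s)
  have "(\<integral>\<^sup>+a. G a \<partial>?A) = (\<integral>\<^sup>+b. \<integral>\<^sup>+\<xi>. G (\<lambda>i\<in>{..<n}. resample d (u i) (b i) (\<xi> i)) \<partial>?X \<partial>?A)"
    using nn_integral_PiM_zip[where A="\<lambda>_. std_gaussian d" and B="\<lambda>_. gauss" and C="\<lambda>_. vec_borel d" and D="\<lambda>_. std_gaussian d"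
        and f="\<lambda>i z. resample d (u i) (fst z) (snd z)" and I="{..<n}", OF _ prob_space_std_gaussian prob_space_gauss measurable_resample distr_resample[OF u] G']
    by simp
  also have "\<dots> = (\<integral>\<^sup>+\<xi>. \<integral>\<^sup>+b. G (\<lambda>i\<in>{..<n}. resample d (u i) (b i) (\<xi> i)) \<partial>?A \<partial>?X)"
  proof (rule nn_integral_swap[OF A X])
    have "(\<lambda>z. resample d (u i) (fst z i) (snd z i)) \<in> ?A \<Otimes>\<^sub>M ?X \<rightarrow>\<^sub>M vec_borel d" if "i < n" for i
    proof -
      have "(\<lambda>z. (fst z i, snd z i)) \<in> ?A \<Otimes>\<^sub>M ?X \<rightarrow>\<^sub>M std_gaussian d \<Otimes>\<^sub>M gauss"
        using that by (intro measurable_Pair measurable_compose[OF measurable_fst] measurable_compose[OF measurable_snd]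
            measurable_component_singleton) auto
      from measurable_compose[OF this measurable_resample[of d "u i"]] show ?thesis by simp
    qed
    then have "(\<lambda>z. \<lambda>i\<in>{..<n}. resample d (u i) (fst z i) (snd z i)) \<in> ?A \<Otimes>\<^sub>M ?X \<rightarrow>\<^sub>M PiM {..<n} (\<lambda>_. vec_borel d)"
      by (intro measurable_restrict) auto
    from measurable_compose[OF this G']
    show "(\<lambda>(b, \<xi>). G (\<lambda>i\<in>{..<n}. resample d (u i) (b i) (\<xi> i))) \<in> borel_measurable (?A \<Otimes>\<^sub>M ?X)"
      by (simp add: split_beta')
  qed
  finally show ?thesis .
qed

text \<open>The pair \<open>s\<close> consists of the latent variables and of the noise.\<close>

abbreviation resampled_instance where
  "resampled_instance d n x1 x2 s b \<xi> \<equiv> (x1, x2, (\<lambda>i\<in>{..<n}. resample d (if fst s i then x1 else x2) (b i) (\<xi> i)), s)"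

text \<open>Each covariate is generated from an independent pair \<open>(b i, \<xi> i)\<close>, with \<open>\<xi> i\<close> as its component along the
signal of its sample. The signals are unit vectors almost surely only, hence the restriction to almost every \<open>x1\<close> and \<open>x2\<close>.\<close>

lemma nn_integral_instance_resampled:
  assumes \<mu>: "uniform_on_sphere d \<mu>" and P: "prob_space P" and F: "F \<in> borel_measurable (instance_law d n \<mu> \<alpha> P)"
  shows "(\<integral>\<^sup>+t. F t \<partial>instance_law d n \<mu> \<alpha> P) =
    (\<integral>\<^sup>+x1. \<integral>\<^sup>+x2. \<integral>\<^sup>+s. \<integral>\<^sup>+\<xi>. \<integral>\<^sup>+b. F (resampled_instance d n x1 x2 s b \<xi>)
      \<partial>gauss_rows n d \<partial>PiM {..<n} (\<lambda>_. gauss) \<partial>(latent_law n \<alpha> \<Otimes>\<^sub>M PiM {..<n} (\<lambda>_. P)) \<partial>\<mu> \<partial>\<mu>)"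
proof -
  have P\<mu>: "prob_space \<mu>" and AE: "AE x in \<mu>. ip d x x = 1"
    using \<mu> by (auto simp: uniform_on_sphere_def ip_self_L2)
  show ?thesis
    unfolding nn_integral_instance[OF P\<mu> P F]
  proof (rule nn_integral_cong_AE, use AE AE_space in eventually_elim)
    case (elim x1)
    note x1 = this
    show ?case
    proof (rule nn_integral_cong_AE, use AE AE_space in eventually_elim)
      case (elim x2)
      note x2 = this
      show ?case
      proof (rule nn_integral_cong)
        fix s assume s: "s \<in> space (latent_law n \<alpha> \<Otimes>\<^sub>M PiM {..<n} (\<lambda>_. P))"
        have "(\<lambda>a. (x1, x2, a, s)) \<in> gauss_rows n d \<rightarrow>\<^sub>M instance_law d n \<mu> \<alpha> P"
          unfolding instance_law_def using x1 x2 s by (intro measurable_Pair measurable_const measurable_ident) (auto simp: space_pair_measure)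
        from measurable_compose[OF this F]
        show "(\<integral>\<^sup>+a. F (x1, x2, a, s) \<partial>gauss_rows n d) =
          (\<integral>\<^sup>+\<xi>. \<integral>\<^sup>+b. F (resampled_instance d n x1 x2 s b \<xi>) \<partial>gauss_rows n d \<partial>PiM {..<n} (\<lambda>_. gauss))"
          using x1 x2 by (intro nn_integral_gauss_rows_resample) auto
      qed
    qed
  qed
qed

lemma measurable_instance_components:
  fixes n :: nat and \<alpha> :: real
  assumes \<mu>: "sets \<mu> = sets (vec_borel d)" and P: "sets P = sets borel"
  defines "I \<equiv> instance_law d n \<mu> \<alpha> P"
  shows "j < d \<Longrightarrow> (\<lambda>t. fst t j) \<in> borel_measurable I"
    and "j < d \<Longrightarrow> (\<lambda>t. fst (snd t) j) \<in> borel_measurable I"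
    and "i < n \<Longrightarrow> j < d \<Longrightarrow> (\<lambda>t. fst (snd (snd t)) i j) \<in> borel_measurable I"
    and "i < n \<Longrightarrow> (\<lambda>t. fst (snd (snd (snd t))) i) \<in> I \<rightarrow>\<^sub>M count_space UNIV"
    and "i < n \<Longrightarrow> (\<lambda>t. snd (snd (snd (snd t))) i) \<in> borel_measurable I"
proof -
  have c: "(\<lambda>x. x j) \<in> borel_measurable \<mu>" if "j < d" for j
    using that by (simp add: measurable_cong_sets[OF \<mu> refl] measurable_component_singleton)
  have p: "(\<lambda>x. x i) \<in> borel_measurable (PiM {..<n} (\<lambda>_. P))" if "i < n" for i
    using measurable_component_singleton[of i "{..<n}" "\<lambda>_. P"] that by (simp add: measurable_cong_sets[OF refl P])
  have b: "(\<lambda>x. x i) \<in> latent_law n \<alpha> \<rightarrow>\<^sub>M count_space UNIV" if "i < n" for i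
    using measurable_component_singleton[of i "{..<n}" "\<lambda>_. measure_pmf (bernoulli_pmf \<alpha>)"] that
    by (simp add: measurable_cong_sets[OF refl sets_measure_pmf_count_space])
  note s = measurable_compose[OF measurable_snd] and f = measurable_compose[OF measurable_fst]
  show "j < d \<Longrightarrow> (\<lambda>t. fst t j) \<in> borel_measurable I" unfolding I_def instance_law_def by (intro f c)
  show "j < d \<Longrightarrow> (\<lambda>t. fst (snd t) j) \<in> borel_measurable I"
    unfolding I_def instance_law_def by (rule s[OF f[OF c]])
  show "i < n \<Longrightarrow> j < d \<Longrightarrow> (\<lambda>t. fst (snd (snd t)) i j) \<in> borel_measurable I"
    unfolding I_def instance_law_def by (rule s[OF s[OF f[OF measurable_rows]]])
  show "i < n \<Longrightarrow> (\<lambda>t. fst (snd (snd (snd t))) i) \<in> I \<rightarrow>\<^sub>M count_space UNIV"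
    unfolding I_def instance_law_def by (rule s[OF s[OF s[OF f[OF b]]]])
  show "i < n \<Longrightarrow> (\<lambda>t. snd (snd (snd (snd t))) i) \<in> borel_measurable I"
    unfolding I_def instance_law_def by (rule s[OF s[OF s[OF s[OF p]]]])
qed

section \<open>Functionals of an instance\<close>

type_synonym glm_data = "(nat \<Rightarrow> real) \<times> (nat \<Rightarrow> real) \<times> (nat \<Rightarrow> nat \<Rightarrow> real) \<times> (nat \<Rightarrow> bool) \<times> (nat \<Rightarrow> real)"

definition sample_signal :: "glm_data \<Rightarrow> nat \<Rightarrow> nat \<Rightarrow> real" where
  "sample_signal = (\<lambda>(x1, x2, a, \<eta>, \<epsilon>) i. if \<eta> i then x1 else x2)"

text \<open>The observation is a function of the last two components; the latent variable tells which signal has generated it.\<close>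

definition sample :: "nat \<Rightarrow> glm_data \<Rightarrow> nat \<Rightarrow> bool \<times> real \<times> real" where
  "sample d = (\<lambda>(x1, x2, a, \<eta>, \<epsilon>) i. (\<eta> i, ip d (a i) (if \<eta> i then x1 else x2), \<epsilon> i))"

definition weight :: "nat \<Rightarrow> (real \<times> real \<Rightarrow> real) \<Rightarrow> glm_data \<Rightarrow> nat \<Rightarrow> real" where
  "weight d h t i = h (snd (sample d t i))"

definition mean_square_weight :: "nat \<Rightarrow> nat \<Rightarrow> (real \<times> real \<Rightarrow> real) \<Rightarrow> glm_data \<Rightarrow> real" where
  "mean_square_weight d n h t = (\<Sum>i<n. (weight d h t i)\<^sup>2) / real n"

definition instance_residual :: "nat \<Rightarrow> nat \<Rightarrow> (real \<times> real \<Rightarrow> real) \<Rightarrow> glm_data \<Rightarrow> nat \<Rightarrow> real" where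
  "instance_residual d n h t = residual d n (weight d h t) (sample_signal t) (fst (snd (snd t)))"

lemma measurable_sample:
  assumes \<mu>: "sets \<mu> = sets (vec_borel d)" and P: "sets P = sets borel" and i: "i < n"
  shows "(\<lambda>t. sample d t i) \<in> instance_law d n \<mu> \<alpha> P \<rightarrow>\<^sub>M sample_law \<alpha> P"
proof -
  let ?I = "instance_law d n \<mu> \<alpha> P"
  note m = measurable_instance_components[OF \<mu> P, where n=n and \<alpha>=\<alpha>]
  have [measurable]: "(\<lambda>t. ip d (fst (snd (snd t)) i) (fst t)) \<in> borel_measurable ?I"
    "(\<lambda>t. ip d (fst (snd (snd t)) i) (fst (snd t))) \<in> borel_measurable ?I"
    by (intro measurable_ip m i; assumption)+
  have [measurable]: "Measurable.pred ?I (\<lambda>t. fst (snd (snd (snd t))) i)" by (rule m(4)[OF i])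
  have "(\<lambda>t. ip d (fst (snd (snd t)) i) (if fst (snd (snd (snd t))) i then fst t else fst (snd t))) \<in> borel_measurable ?I"
    unfolding if_distrib[of "ip d _"] by measurable
  moreover have "(\<lambda>t. fst (snd (snd (snd t))) i) \<in> ?I \<rightarrow>\<^sub>M measure_pmf (bernoulli_pmf \<alpha>)"
    using m(4)[OF i] by (simp add: measurable_cong_sets[OF refl sets_measure_pmf_count_space])
  moreover have "(\<lambda>t. snd (snd (snd (snd t))) i) \<in> ?I \<rightarrow>\<^sub>M P"
    using m(5)[OF i] by (simp add: measurable_cong_sets[OF refl P])
  ultimately show ?thesis unfolding sample_def split_beta by (intro measurable_Pair) auto
qed

lemma measurable_weight:
  assumes \<mu>: "sets \<mu> = sets (vec_borel d)" and P: "sets P = sets borel" and h: "h \<in> borel_measurable borel" and i: "i < n"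
  shows "(\<lambda>t. weight d h t i) \<in> borel_measurable (instance_law d n \<mu> \<alpha> P)"
proof -
  have "sets (scalar_law P) = sets (borel :: (real \<times> real) measure)"
    unfolding borel_prod[symmetric] by (intro sets_pair_measure_cong P) simp
  then have "h \<in> borel_measurable (scalar_law P)" using h by (simp cong: measurable_cong_sets)
  then have "(\<lambda>z. h (snd z)) \<in> borel_measurable (sample_law \<alpha> P)" by measurable
  from measurable_compose[OF measurable_sample[OF \<mu> P i] this] show ?thesis by (simp add: weight_def)
qed

lemma measurable_instance_residual:
  assumes \<mu>: "sets \<mu> = sets (vec_borel d)" and P: "sets P = sets borel" and h: "h \<in> borel_measurable borel"
  shows "j < d \<Longrightarrow> (\<lambda>t. instance_residual d n h t j) \<in> borel_measurable (instance_law d n \<mu> \<alpha> P)"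
    and "mean_square_weight d n h \<in> borel_measurable (instance_law d n \<mu> \<alpha> P)"
proof -
  let ?I = "instance_law d n \<mu> \<alpha> P"
  note m = measurable_instance_components[OF \<mu> P, where n=n and \<alpha>=\<alpha>]
  note w = measurable_weight[OF \<mu> P h]
  have s: "(\<lambda>t. sample_signal t i j) \<in> borel_measurable ?I" if "i < n" "j < d" for i j
  proof -
    have [measurable]: "Measurable.pred ?I (\<lambda>t. fst (snd (snd (snd t))) i)" by (rule m(4)[OF that(1)])
    have [measurable]: "(\<lambda>t. fst t j) \<in> borel_measurable ?I" "(\<lambda>t. fst (snd t) j) \<in> borel_measurable ?I"
      by (intro m that)+
    have "(\<lambda>t. if fst (snd (snd (snd t))) i then fst t j else fst (snd t) j) \<in> borel_measurable ?I" by measurable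
    then show ?thesis unfolding sample_signal_def split_beta by (simp add: if_distrib[of "\<lambda>f. f j"])
  qed
  have ips: "(\<lambda>t. ip d (fst (snd (snd t)) i) (sample_signal t i)) \<in> borel_measurable ?I" if "i < n" for i
    by (intro measurable_ip m s that; assumption)
  show "(\<lambda>t. instance_residual d n h t j) \<in> borel_measurable ?I" if "j < d"
    unfolding instance_residual_def residual_def using that
    by (intro borel_measurable_times borel_measurable_const borel_measurable_sum borel_measurable_diff w m s ips) auto
  have "(\<lambda>t. (\<Sum>i<n. (weight d h t i)\<^sup>2) / real n) \<in> borel_measurable ?I"
    by (intro borel_measurable_divide borel_measurable_const borel_measurable_sum borel_measurable_power w) auto
  then show "mean_square_weight d n h \<in> borel_measurable ?I" by (simp add: mean_square_weight_def[abs_def])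
qed

lemma sample_resampled:
  assumes "ip d x1 x1 = 1" "ip d x2 x2 = 1" "i < n"
  shows "sample d (resampled_instance d n x1 x2 s b \<xi>) i = (fst s i, \<xi> i, snd s i)"
  using assms by (cases s) (simp add: sample_def ip_resample)

text \<open>The weights no longer involve \<open>b\<close>, and the residual is the one of \<open>b\<close> itself because the component along
the signal is removed anyway.\<close>

lemma instance_residual_resampled:
  fixes \<xi> :: "nat \<Rightarrow> real" and n d :: nat and s :: "(nat \<Rightarrow> bool) \<times> (nat \<Rightarrow> real)" and h :: "real \<times> real \<Rightarrow> real"
  assumes x: "ip d x1 x1 = 1" "ip d x2 x2 = 1"
  defines "t \<equiv> \<lambda>b. (resampled_instance d n x1 x2 s b \<xi>)"
  defines "w \<equiv> \<lambda>i. h (\<xi> i, snd s i)"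
  shows "mean_square_weight d n h (t b) = (\<Sum>i<n. (w i)\<^sup>2) / real n"
    and "ip d (instance_residual d n h (t b)) x = ip d (residual d n w (\<lambda>i. if fst s i then x1 else x2) b) x"
    and "L2_set (instance_residual d n h (t b)) {..<d} = L2_set (residual d n w (\<lambda>i. if fst s i then x1 else x2) b) {..<d}"
proof -
  have w: "weight d h (t b) i = w i" if "i < n" for i
    unfolding weight_def t_def sample_resampled[OF x that] by (simp add: w_def)
  then show "mean_square_weight d n h (t b) = (\<Sum>i<n. (w i)\<^sup>2) / real n" by (simp add: mean_square_weight_def)
  let ?u = "\<lambda>i. if fst s i then x1 else x2"
  have u: "ip d (?u i) (?u i) = 1" for i using x by simp
  have sg: "sample_signal (t b) = ?u" by (simp add: sample_signal_def t_def split_beta fun_eq_iff)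
  have r: "instance_residual d n h (t b) j = residual d n w ?u b j" if "j < d" for j
    unfolding instance_residual_def residual_def sg
  proof (intro arg_cong[where f="\<lambda>x. 1 / real n * x"] sum.cong refl)
    fix i assume "i \<in> {..<n}"
    then have i: "i < n" by simp
    have "fst (snd (snd (t b))) i = resample d (?u i) (b i) (\<xi> i)" using i by (simp add: t_def)
    then show "weight d h (t b) i * (fst (snd (snd (t b))) i j - ip d (fst (snd (snd (t b))) i) (?u i) * ?u i j) =
      w i * (b i j - ip d (b i) (?u i) * ?u i j)"
      using that unfolding w[OF i] by (simp only: ip_resample[OF u]) (simp add: resample_def algebra_simps)
  qed
  show "ip d (instance_residual d n h (t b)) x = ip d (residual d n w ?u b) x"
    unfolding ip_def by (intro sum.cong) (auto simp: r)
  show "L2_set (instance_residual d n h (t b)) {..<d} = L2_set (residual d n w ?u b) {..<d}"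
    by (intro L2_set_cong) (auto simp: r)
qed

lemma nn_integral_le_const:
  assumes "prob_space N" "AE x in N. f x \<le> c"
  shows "(\<integral>\<^sup>+x. f x \<partial>N) \<le> c"
  using nn_integral_mono_AE[OF assms(2)] nn_integral_const_prob[OF assms(1)] by simp

text \<open>After resampling, the weights are functions of \<open>\<xi>\<close> and of the noise. A tail bound that is uniform in all
variables except for the Gaussian rows \<open>b\<close> therefore carries over to the instance law.\<close>

lemma instance_tail_by_resampling:
  fixes Y :: "glm_data \<Rightarrow> real"
  assumes \<mu>: "uniform_on_sphere d \<mu>" and P: "prob_space P" and Y: "Y \<in> borel_measurable (instance_law d n \<mu> \<alpha> P)"
    and K: "\<And>x1 x2 s \<xi>. ip d x1 x1 = 1 \<Longrightarrow> ip d x2 x2 = 1 \<Longrightarrow>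
      emeasure (gauss_rows n d) {b\<in>space (gauss_rows n d).
        e < \<bar>Y (resampled_instance d n x1 x2 s b \<xi>)\<bar>} \<le> ennreal K"
    and Km: "\<And>x1 x2 s \<xi>. ip d x1 x1 = 1 \<Longrightarrow> ip d x2 x2 = 1 \<Longrightarrow>
      (\<lambda>b. Y (resampled_instance d n x1 x2 s b \<xi>)) \<in> borel_measurable (gauss_rows n d)"
  shows "emeasure (instance_law d n \<mu> \<alpha> P) {t\<in>space (instance_law d n \<mu> \<alpha> P). e < \<bar>Y t\<bar>} \<le> ennreal K"
proof -
  let ?I = "instance_law d n \<mu> \<alpha> P" and ?S = "latent_law n \<alpha> \<Otimes>\<^sub>M PiM {..<n} (\<lambda>_. P)" and ?A = "gauss_rows n d"
    and ?X = "PiM {..<n} (\<lambda>_. gauss)"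
  have P\<mu>: "prob_space \<mu>" and AE: "AE x in \<mu>. ip d x x = 1"
    using \<mu> by (auto simp: uniform_on_sphere_def ip_self_L2)
  have PS: "prob_space ?S" by (intro prob_space_pair prob_space_PiM P prob_space_measure_pmf)
  have PX: "prob_space ?X" by (intro prob_space_PiM prob_space_gauss)
  let ?B = "{t\<in>space ?I. e < \<bar>Y t\<bar>}"
  have B: "?B \<in> sets ?I" using Y by measurable
  let ?t = "\<lambda>x1 x2 s \<xi> b. (resampled_instance d n x1 x2 s b \<xi>)"
  have tail: "(\<integral>\<^sup>+b. indicator ?B (f b) \<partial>?A) \<le> ennreal K"
    if f: "(\<lambda>b. Y (f b)) \<in> borel_measurable ?A" and le: "emeasure ?A {b\<in>space ?A. e < \<bar>Y (f b)\<bar>} \<le> ennreal K" for f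
  proof -
    have "{b\<in>space ?A. e < \<bar>Y (f b)\<bar>} \<in> sets ?A" using f by measurable
    then have eq: "(\<integral>\<^sup>+b. indicator {b\<in>space ?A. e < \<bar>Y (f b)\<bar>} b \<partial>?A) = emeasure ?A {b\<in>space ?A. e < \<bar>Y (f b)\<bar>}"
      by (rule nn_integral_indicator)
    have "(\<integral>\<^sup>+b. indicator ?B (f b) \<partial>?A) \<le> (\<integral>\<^sup>+b. indicator {b\<in>space ?A. e < \<bar>Y (f b)\<bar>} b \<partial>?A)"
      by (intro nn_integral_mono) (simp add: indicator_def)
    then show ?thesis unfolding eq using le by (rule order.trans)
  qed
  have inner: "(\<integral>\<^sup>+b. indicator ?B (?t x1 x2 s \<xi> b) \<partial>?A) \<le> ennreal K"
    if x: "ip d x1 x1 = 1" "ip d x2 x2 = 1" for x1 x2 s \<xi>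
    by (rule tail[OF Km[OF x] K[OF x]])
  have "emeasure ?I ?B = (\<integral>\<^sup>+t. indicator ?B t \<partial>?I)" using B by (rule nn_integral_indicator[symmetric])
  also have "\<dots> = (\<integral>\<^sup>+x1. \<integral>\<^sup>+x2. \<integral>\<^sup>+s. \<integral>\<^sup>+\<xi>. \<integral>\<^sup>+b. indicator ?B (?t x1 x2 s \<xi> b) \<partial>?A \<partial>?X \<partial>?S \<partial>\<mu> \<partial>\<mu>)"
    by (rule nn_integral_instance_resampled[OF \<mu> P]) (rule borel_measurable_indicator[OF B])
  also have "\<dots> \<le> ennreal K"
  proof (rule nn_integral_le_const[OF P\<mu>], use AE in eventually_elim)
    case (elim x1)
    note x1 = this
    show ?case
    proof (rule nn_integral_le_const[OF P\<mu>], use AE in eventually_elim)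
      case (elim x2)
      show ?case
        by (intro nn_integral_le_const[OF PS] nn_integral_le_const[OF PX] AE_I2 inner x1 elim)
    qed
  qed
  finally show ?thesis .
qed

lemma measurable_residual:
  assumes "j < d"
  shows "(\<lambda>b. residual d n w u b j) \<in> borel_measurable (gauss_rows n d)"
proof -
  have "(\<lambda>b. ip d (b i) (u i)) \<in> borel_measurable (gauss_rows n d)" if "i < n" for i
    using that by (intro measurable_ip measurable_rows borel_measurable_const)
  then show ?thesis unfolding residual_def using assms
    by (intro borel_measurable_times borel_measurable_const borel_measurable_sum borel_measurable_diff measurable_rows) auto
qed

text \<open>The factor \<open>1 / sqrt V\<close> makes the residual comparable to a Gaussian vector of norm \<open>sqrt (d / n)\<close>, whatever
the weights are. If all weights vanish, so do the quotients.\<close>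

definition scaled_residual_ip1 :: "nat \<Rightarrow> nat \<Rightarrow> (real \<times> real \<Rightarrow> real) \<Rightarrow> glm_data \<Rightarrow> real" where
  "scaled_residual_ip1 d n h t = ip d (instance_residual d n h t) (fst t) / sqrt (mean_square_weight d n h t)"

definition scaled_residual_ip2 :: "nat \<Rightarrow> nat \<Rightarrow> (real \<times> real \<Rightarrow> real) \<Rightarrow> glm_data \<Rightarrow> real" where
  "scaled_residual_ip2 d n h t = ip d (instance_residual d n h t) (fst (snd t)) / sqrt (mean_square_weight d n h t)"

definition scaled_residual_norm_error :: "nat \<Rightarrow> nat \<Rightarrow> (real \<times> real \<Rightarrow> real) \<Rightarrow> glm_data \<Rightarrow> real" where
  "scaled_residual_norm_error d n h t =
     (L2_set (instance_residual d n h t) {..<d} - sqrt (mean_square_weight d n h t * real d / real n)) / sqrt (mean_square_weight d n h t)"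

lemma measurable_scaled_residuals:
  assumes \<mu>: "sets \<mu> = sets (vec_borel d)" and P: "sets P = sets borel" and h: "h \<in> borel_measurable borel"
  shows "scaled_residual_ip1 d n h \<in> borel_measurable (instance_law d n \<mu> \<alpha> P)"
    "scaled_residual_ip2 d n h \<in> borel_measurable (instance_law d n \<mu> \<alpha> P)"
    "scaled_residual_norm_error d n h \<in> borel_measurable (instance_law d n \<mu> \<alpha> P)"
proof -
  let ?I = "instance_law d n \<mu> \<alpha> P"
  note r = measurable_instance_residual[OF \<mu> P h, where n=n and \<alpha>=\<alpha>] and m = measurable_instance_components[OF \<mu> P, where n=n and \<alpha>=\<alpha>]
  note [measurable] = r(2)
  have [measurable]: "(\<lambda>t. ip d (instance_residual d n h t) (fst t)) \<in> borel_measurable ?I"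
    "(\<lambda>t. ip d (instance_residual d n h t) (fst (snd t))) \<in> borel_measurable ?I"
    "(\<lambda>t. L2_set (instance_residual d n h t) {..<d}) \<in> borel_measurable ?I"
    by (intro measurable_ip measurable_L2_set r m; assumption)+
  show "scaled_residual_ip1 d n h \<in> borel_measurable ?I" unfolding scaled_residual_ip1_def[abs_def] by measurable
  show "scaled_residual_ip2 d n h \<in> borel_measurable ?I" unfolding scaled_residual_ip2_def[abs_def] by measurable
  show "scaled_residual_norm_error d n h \<in> borel_measurable ?I" unfolding scaled_residual_norm_error_def[abs_def] by measurable
qed

lemma scaled_residual_tails:
  assumes \<mu>: "uniform_on_sphere d \<mu>" and P: "prob_space P" and Pb: "sets P = sets borel" and h: "h \<in> borel_measurable borel"
    and n: "0 < n" and d: "0 < d" and e: "0 < e"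
  shows "emeasure (instance_law d n \<mu> \<alpha> P) {t\<in>space (instance_law d n \<mu> \<alpha> P). e < \<bar>scaled_residual_ip1 d n h t\<bar>} \<le> ennreal (3 / e ^ 4 / (real n)\<^sup>2)"
    "emeasure (instance_law d n \<mu> \<alpha> P) {t\<in>space (instance_law d n \<mu> \<alpha> P). e < \<bar>scaled_residual_ip2 d n h t\<bar>} \<le> ennreal (3 / e ^ 4 / (real n)\<^sup>2)"
    "emeasure (instance_law d n \<mu> \<alpha> P) {t\<in>space (instance_law d n \<mu> \<alpha> P). e < \<bar>scaled_residual_norm_error d n h t\<bar>} \<le> ennreal (5346 / e ^ 4 / (real n)\<^sup>2)"
proof -
  have s: "sets \<mu> = sets (vec_borel d)" using \<mu> by (simp add: uniform_on_sphere_def)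
  note m = measurable_scaled_residuals[OF s Pb h, where n=n and \<alpha>=\<alpha>]
  interpret A: prob_space "gauss_rows n d" by (intro prob_space_PiM prob_space_std_gaussian)
  have mip: "(\<lambda>b. ip d (residual d n w u b) x) \<in> borel_measurable (gauss_rows n d)" for w u x
    by (intro measurable_ip measurable_residual borel_measurable_const; assumption)
  have mL: "(\<lambda>b. L2_set (residual d n w u b) {..<d}) \<in> borel_measurable (gauss_rows n d)" for w u
    by (intro measurable_L2_set measurable_residual)
  note r = instance_residual_resampled[where h=h and n=n and d=d]
  show "emeasure (instance_law d n \<mu> \<alpha> P) {t\<in>space (instance_law d n \<mu> \<alpha> P). e < \<bar>scaled_residual_ip1 d n h t\<bar>} \<le> ennreal (3 / e ^ 4 / (real n)\<^sup>2)"
  proof (rule instance_tail_by_resampling[OF \<mu> P m(1)], goal_cases)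
    case (1 x1 x2 s \<xi>)
    show ?case
      unfolding scaled_residual_ip1_def r[OF 1] fst_conv A.emeasure_eq_measure
      by (intro ennreal_leI residual_inner_product_tail[OF _ _ refl e n]) (use 1 in auto)
  next
    case (2 x1 x2 s \<xi>)
    show ?case
      unfolding scaled_residual_ip1_def r[OF 2] fst_conv by (intro borel_measurable_divide mip borel_measurable_const)
  qed
  show "emeasure (instance_law d n \<mu> \<alpha> P) {t\<in>space (instance_law d n \<mu> \<alpha> P). e < \<bar>scaled_residual_ip2 d n h t\<bar>} \<le> ennreal (3 / e ^ 4 / (real n)\<^sup>2)"
  proof (rule instance_tail_by_resampling[OF \<mu> P m(2)], goal_cases)
    case (1 x1 x2 s \<xi>)
    show ?case
      unfolding scaled_residual_ip2_def r[OF 1] fst_conv snd_conv A.emeasure_eq_measure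
      by (intro ennreal_leI residual_inner_product_tail[OF _ _ refl e n]) (use 1 in auto)
  next
    case (2 x1 x2 s \<xi>)
    show ?case
      unfolding scaled_residual_ip2_def r[OF 2] fst_conv snd_conv by (intro borel_measurable_divide mip borel_measurable_const)
  qed
  show "emeasure (instance_law d n \<mu> \<alpha> P) {t\<in>space (instance_law d n \<mu> \<alpha> P). e < \<bar>scaled_residual_norm_error d n h t\<bar>} \<le> ennreal (5346 / e ^ 4 / (real n)\<^sup>2)"
  proof (rule instance_tail_by_resampling[OF \<mu> P m(3)], goal_cases)
    case (1 x1 x2 s \<xi>)
    show ?case
      unfolding scaled_residual_norm_error_def r[OF 1] A.emeasure_eq_measure
      by (intro ennreal_leI residual_norm_tail[OF 1 refl e n d])
  next
    case (2 x1 x2 s \<xi>)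
    show ?case
      unfolding scaled_residual_norm_error_def r[OF 2] by (intro borel_measurable_divide borel_measurable_diff mL borel_measurable_const)
  qed
qed

text \<open>After resampling the linear predictors are the \<open>\<xi> i\<close>, independent of everything else.\<close>

lemma instance_sample_law:
  assumes \<mu>: "uniform_on_sphere d \<mu>" and P: "prob_space P" and Pb: "sets P = sets borel"
  shows "distr (instance_law d n \<mu> \<alpha> P) (PiM {..<n} (\<lambda>_. sample_law \<alpha> P)) (\<lambda>t. \<lambda>i\<in>{..<n}. sample d t i) =
    PiM {..<n} (\<lambda>_. sample_law \<alpha> P)"
proof (rule measure_eqI)
  let ?I = "instance_law d n \<mu> \<alpha> P" and ?T = "PiM {..<n} (\<lambda>_. sample_law \<alpha> P)" and ?Z = "\<lambda>t. \<lambda>i\<in>{..<n}. sample d t i"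
  let ?B = "latent_law n \<alpha>" and ?E = "PiM {..<n} (\<lambda>_. P)" and ?A = "gauss_rows n d" and ?X = "PiM {..<n} (\<lambda>_. gauss)"
    and ?W = "PiM {..<n} (\<lambda>_. scalar_law P)"
  have s: "sets \<mu> = sets (vec_borel d)" using \<mu> by (simp add: uniform_on_sphere_def)
  have P\<mu>: "prob_space \<mu>" and AE: "AE x in \<mu>. ip d x x = 1"
    using \<mu> by (auto simp: uniform_on_sphere_def ip_self_L2)
  have PA: "prob_space ?A" by (intro prob_space_PiM prob_space_std_gaussian)
  have PX: "prob_space ?X" by (intro prob_space_PiM prob_space_gauss)
  have PE: "prob_space ?E" by (intro prob_space_PiM P)
  have Pb: "prob_space (measure_pmf (bernoulli_pmf \<alpha>))" by (rule prob_space_measure_pmf)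
  have PsL: "prob_space (scalar_law P)" by (intro prob_space_pair prob_space_gauss P)
  have Z: "?Z \<in> ?I \<rightarrow>\<^sub>M ?T" by (intro measurable_restrict measurable_sample s assms) auto
  fix E assume "E \<in> sets (distr ?I ?T ?Z)"
  then have E: "E \<in> sets ?T" by simp
  let ?F = "indicator E :: (nat \<Rightarrow> bool \<times> real \<times> real) \<Rightarrow> ennreal"
  have F: "?F \<in> borel_measurable ?T" by (rule borel_measurable_indicator[OF E])
  have "emeasure (distr ?I ?T ?Z) E = (\<integral>\<^sup>+t. ?F (?Z t) \<partial>?I)" by (rule emeasure_distr_indicator[OF Z E])
  also have "\<dots> = (\<integral>\<^sup>+x1. \<integral>\<^sup>+x2. \<integral>\<^sup>+s. \<integral>\<^sup>+\<xi>. \<integral>\<^sup>+b. ?F (?Z (resampled_instance d n x1 x2 s b \<xi>))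
      \<partial>?A \<partial>?X \<partial>(?B \<Otimes>\<^sub>M ?E) \<partial>\<mu> \<partial>\<mu>)"
    by (rule nn_integral_instance_resampled[OF \<mu> P measurable_compose[OF Z F]])
  also have "\<dots> = (\<integral>\<^sup>+x1. \<integral>\<^sup>+x2. \<integral>\<^sup>+s. \<integral>\<^sup>+\<xi>. ?F (\<lambda>i\<in>{..<n}. (fst s i, \<xi> i, snd s i)) \<partial>?X \<partial>(?B \<Otimes>\<^sub>M ?E) \<partial>\<mu> \<partial>\<mu>)"
  proof (rule nn_integral_cong_AE, use AE in eventually_elim)
    case (elim x1)
    note x1 = this
    show ?case
    proof (rule nn_integral_cong_AE, use AE in eventually_elim)
      case (elim x2)
      have "(\<lambda>i\<in>{..<n}. sample d (resampled_instance d n x1 x2 s b \<xi>) i) =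
        (\<lambda>i\<in>{..<n}. (fst s i, \<xi> i, snd s i))" for s b \<xi>
        by (intro restrict_ext sample_resampled x1 elim) simp
      then show ?case by (simp only: nn_integral_const_prob[OF PA])
    qed
  qed
  also have "\<dots> = (\<integral>\<^sup>+s. \<integral>\<^sup>+\<xi>. ?F (\<lambda>i\<in>{..<n}. (fst s i, \<xi> i, snd s i)) \<partial>?X \<partial>(?B \<Otimes>\<^sub>M ?E))"
    by (simp only: nn_integral_const_prob[OF P\<mu>])
  also have "\<dots> = (\<integral>\<^sup>+\<eta>. \<integral>\<^sup>+\<epsilon>. \<integral>\<^sup>+\<xi>. ?F (\<lambda>i\<in>{..<n}. (\<eta> i, \<xi> i, \<epsilon> i)) \<partial>?X \<partial>?E \<partial>?B)"
  proof -
    have m: "(\<lambda>z. ?F (\<lambda>i\<in>{..<n}. (fst (fst z) i, snd z i, snd (fst z) i))) \<in> borel_measurable ((?B \<Otimes>\<^sub>M ?E) \<Otimes>\<^sub>M ?X)"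
      by (intro measurable_compose[OF _ F] measurable_restrict measurable_Pair
          measurable_compose[OF measurable_fst] measurable_compose[OF measurable_snd] measurable_component_singleton) auto
    have "(\<lambda>s. \<integral>\<^sup>+\<xi>. ?F (\<lambda>i\<in>{..<n}. (fst s i, \<xi> i, snd s i)) \<partial>?X) \<in> borel_measurable (?B \<Otimes>\<^sub>M ?E)"
      using sigma_finite_measure.borel_measurable_nn_integral_fst[OF prob_space_imp_sigma_finite[OF PX] m] by simp
    from nn_integral_pair[OF PE this] show ?thesis by simp
  qed
  also have "\<dots> = (\<integral>\<^sup>+\<eta>. \<integral>\<^sup>+w. ?F (\<lambda>i\<in>{..<n}. (\<eta> i, w i)) \<partial>?W \<partial>?B)"
  proof (rule nn_integral_cong)
    fix \<eta> assume \<eta>: "\<eta> \<in> space ?B"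
    have "(\<lambda>w. \<lambda>i\<in>{..<n}. (\<eta> i, w i)) \<in> ?W \<rightarrow>\<^sub>M ?T"
      by (intro measurable_restrict measurable_Pair measurable_const measurable_component_singleton) auto
    from measurable_compose[OF this F] have G: "(\<lambda>w. ?F (\<lambda>i\<in>{..<n}. (\<eta> i, w i))) \<in> borel_measurable ?W" .
    have "(\<integral>\<^sup>+w. ?F (\<lambda>i\<in>{..<n}. (\<eta> i, w i)) \<partial>?W) =
      (\<integral>\<^sup>+\<xi>. \<integral>\<^sup>+\<epsilon>. ?F (\<lambda>i\<in>{..<n}. (\<eta> i, (\<lambda>i\<in>{..<n}. (\<xi> i, \<epsilon> i)) i)) \<partial>?E \<partial>?X)"
      by (rule nn_integral_PiM_zip[where f="\<lambda>_ z. z", OF _ prob_space_gauss P _ _ G]) (auto simp: distr_id2)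
    also have "\<dots> = (\<integral>\<^sup>+\<xi>. \<integral>\<^sup>+\<epsilon>. ?F (\<lambda>i\<in>{..<n}. (\<eta> i, \<xi> i, \<epsilon> i)) \<partial>?E \<partial>?X)"
      by (simp cong: restrict_cong)
    also have "\<dots> = (\<integral>\<^sup>+\<epsilon>. \<integral>\<^sup>+\<xi>. ?F (\<lambda>i\<in>{..<n}. (\<eta> i, \<xi> i, \<epsilon> i)) \<partial>?X \<partial>?E)"
    proof (rule nn_integral_swap[OF PX PE])
      have "(\<lambda>z. \<lambda>i\<in>{..<n}. (\<eta> i, fst z i, snd z i)) \<in> ?X \<Otimes>\<^sub>M ?E \<rightarrow>\<^sub>M ?T"
        by (intro measurable_restrict measurable_Pair measurable_const measurable_compose[OF measurable_fst]
            measurable_compose[OF measurable_snd] measurable_component_singleton) auto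
      from measurable_compose[OF this F]
      show "(\<lambda>(\<xi>, \<epsilon>). ?F (\<lambda>i\<in>{..<n}. (\<eta> i, \<xi> i, \<epsilon> i))) \<in> borel_measurable (?X \<Otimes>\<^sub>M ?E)" by (simp add: split_beta')
    qed
    finally show "(\<integral>\<^sup>+\<epsilon>. \<integral>\<^sup>+\<xi>. ?F (\<lambda>i\<in>{..<n}. (\<eta> i, \<xi> i, \<epsilon> i)) \<partial>?X \<partial>?E) = (\<integral>\<^sup>+w. ?F (\<lambda>i\<in>{..<n}. (\<eta> i, w i)) \<partial>?W)" ..
  qed
  also have "\<dots> = (\<integral>\<^sup>+z. ?F z \<partial>?T)"
    by (rule nn_integral_PiM_zip[where f="\<lambda>_ z. z", OF _ Pb PsL _ _ F, symmetric]) (auto simp: distr_id2)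
  also have "\<dots> = emeasure ?T E" using E by simp
  finally show "emeasure (distr ?I ?T ?Z) E = emeasure ?T E" .
qed simp

text \<open>Both claims concern the signals only; integrating out the other variables leaves the product law of the signals.\<close>

lemma instance_signals:
  assumes \<mu>: "uniform_on_sphere d \<mu>" and P: "prob_space P" and Pb: "sets P = sets borel"
  shows "AE t in instance_law d n \<mu> \<alpha> P. ip d (fst t) (fst t) = 1 \<and> ip d (fst (snd t)) (fst (snd t)) = 1"
    and "0 < d \<Longrightarrow> 0 < e \<Longrightarrow> emeasure (instance_law d n \<mu> \<alpha> P) {t\<in>space (instance_law d n \<mu> \<alpha> P). e < \<bar>ip d (fst t) (fst (snd t))\<bar>}
      \<le> ennreal (3 / e ^ 4 / (real d)\<^sup>2)"
proof -
  let ?I = "instance_law d n \<mu> \<alpha> P" and ?S = "latent_law n \<alpha> \<Otimes>\<^sub>M PiM {..<n} (\<lambda>_. P)" and ?A = "gauss_rows n d"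
  have s: "sets \<mu> = sets (vec_borel d)" using \<mu> by (simp add: uniform_on_sphere_def)
  have P\<mu>: "prob_space \<mu>" and AE: "AE x in \<mu>. ip d x x = 1"
    using \<mu> by (auto simp: uniform_on_sphere_def ip_self_L2)
  have PS: "prob_space ?S" by (intro prob_space_pair prob_space_PiM P prob_space_measure_pmf)
  have PA: "prob_space ?A" by (intro prob_space_PiM prob_space_std_gaussian)
  note m = measurable_instance_components[OF s Pb, where n=n and \<alpha>=\<alpha>]
  have [measurable]: "(\<lambda>t. ip d (fst t) (fst t)) \<in> borel_measurable ?I" "(\<lambda>t. ip d (fst (snd t)) (fst (snd t))) \<in> borel_measurable ?I"
    "(\<lambda>t. ip d (fst t) (fst (snd t))) \<in> borel_measurable ?I"
    by (intro measurable_ip m; assumption)+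
  let ?N = "{t\<in>space ?I. \<not> (ip d (fst t) (fst t) = 1 \<and> ip d (fst (snd t)) (fst (snd t)) = 1)}"
  have N: "?N \<in> sets ?I" by measurable
  have "emeasure ?I ?N = (\<integral>\<^sup>+t. indicator ?N t \<partial>?I)" using N by simp
  also have "\<dots> = (\<integral>\<^sup>+x1. \<integral>\<^sup>+x2. \<integral>\<^sup>+s. \<integral>\<^sup>+a. indicator ?N (x1, x2, a, s) \<partial>?A \<partial>?S \<partial>\<mu> \<partial>\<mu>)"
    by (rule nn_integral_instance[OF P\<mu> P borel_measurable_indicator[OF N]])
  also have "\<dots> \<le> 0"
  proof (rule nn_integral_le_const[OF P\<mu>], use AE in eventually_elim)
    case (elim x1)
    note x1 = this
    show ?case
    proof (rule nn_integral_le_const[OF P\<mu>], use AE in eventually_elim)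
      case (elim x2)
      then show ?case using x1 by simp
    qed
  qed
  finally show "AE t in ?I. ip d (fst t) (fst t) = 1 \<and> ip d (fst (snd t)) (fst (snd t)) = 1"
    using N by (intro AE_I[where N="?N"]) auto
  assume d: "0 < d" and e: "0 < e"
  let ?C = "{t\<in>space ?I. e < \<bar>ip d (fst t) (fst (snd t))\<bar>}"
  have C: "?C \<in> sets ?I" by measurable
  have "emeasure ?I ?C = (\<integral>\<^sup>+t. indicator ?C t \<partial>?I)" using C by simp
  also have "\<dots> = (\<integral>\<^sup>+x1. \<integral>\<^sup>+x2. \<integral>\<^sup>+s. \<integral>\<^sup>+a. indicator ?C (x1, x2, a, s) \<partial>?A \<partial>?S \<partial>\<mu> \<partial>\<mu>)"
    by (rule nn_integral_instance[OF P\<mu> P borel_measurable_indicator[OF C]])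
  also have "\<dots> \<le> (\<integral>\<^sup>+x1. \<integral>\<^sup>+x2. indicator {x2. e < \<bar>ip d x1 x2\<bar>} x2 \<partial>\<mu> \<partial>\<mu>)"
    by (intro nn_integral_mono nn_integral_le_const[OF PS] nn_integral_le_const[OF PA] AE_I2) (auto simp: indicator_def)
  also have "\<dots> \<le> ennreal (3 / e ^ 4 / (real d)\<^sup>2)" by (rule sphere_overlap_tail[OF \<mu> d e])
  finally show "emeasure ?I ?C \<le> ennreal (3 / e ^ 4 / (real d)\<^sup>2)" .
qed

section \<open>Tails and expectations of functionals of an instance\<close>

lemma (in prob_space) prob_tail_transfer:
  fixes Y :: "'b \<Rightarrow> real"
  assumes T: "T \<in> M \<rightarrow>\<^sub>M N" and law: "distr M N T = N" and Y: "Y \<in> borel_measurable N"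
    and le: "emeasure N {t\<in>space N. e < \<bar>Y t\<bar>} \<le> ennreal K" and K: "0 \<le> K"
  shows "prob {\<omega>\<in>space M. e < \<bar>Y (T \<omega>)\<bar>} \<le> K"
proof -
  have S: "{t\<in>space N. e < \<bar>Y t\<bar>} \<in> sets N" using Y by measurable
  have "emeasure N {t\<in>space N. e < \<bar>Y t\<bar>} = emeasure M (T -` {t\<in>space N. e < \<bar>Y t\<bar>} \<inter> space M)"
    using emeasure_distr[OF T S] by (simp add: law)
  also have "T -` {t\<in>space N. e < \<bar>Y t\<bar>} \<inter> space M = {\<omega>\<in>space M. e < \<bar>Y (T \<omega>)\<bar>}"
    using measurable_space[OF T] by auto
  finally show ?thesis using le K by (simp add: emeasure_eq_measure)
qed

lemma integral_sample_law:
  fixes G :: "bool \<Rightarrow> real \<times> real \<Rightarrow> real"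
  assumes P: "prob_space P" and \<alpha>: "0 \<le> \<alpha>" "\<alpha> \<le> 1" and G: "\<And>b. integrable (scalar_law P) (G b)"
  shows "integrable (sample_law \<alpha> P) (\<lambda>t. G (fst t) (snd t))"
    and "(LINT t|sample_law \<alpha> P. G (fst t) (snd t)) = \<alpha> * (LINT z|scalar_law P. G True z) + (1 - \<alpha>) * (LINT z|scalar_law P. G False z)"
proof -
  let ?B = "measure_pmf (bernoulli_pmf \<alpha>)" and ?W = "scalar_law P"
  interpret W: prob_space ?W by (intro prob_space_pair prob_space_gauss P)
  interpret BW: pair_prob_space ?B ?W ..
  have Gm [measurable]: "G b \<in> borel_measurable ?W" for b using G[of b] by simp
  have "(\<lambda>t. if fst t then G True (snd t) else G False (snd t)) \<in> borel_measurable (?B \<Otimes>\<^sub>M ?W)" by measurable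
  also have "(\<lambda>t. if fst t then G True (snd t) else G False (snd t)) = (\<lambda>t. G (fst t) (snd t))" by (auto simp: fun_eq_iff)
  finally have m: "(\<lambda>t. G (fst t) (snd t)) \<in> borel_measurable (?B \<Otimes>\<^sub>M ?W)" .
  show i: "integrable (sample_law \<alpha> P) (\<lambda>t. G (fst t) (snd t))"
  proof (rule BW.Fubini_integrable[OF m])
    show "integrable ?B (\<lambda>x. LINT y|?W. norm (G (fst (x, y)) (snd (x, y))))"
      by (rule integrable_measure_pmf_finite) simp
    show "AE x in ?B. integrable ?W (\<lambda>y. G (fst (x, y)) (snd (x, y)))" using G by simp
  qed
  have "(LINT t|sample_law \<alpha> P. G (fst t) (snd t)) = (LINT b|?B. LINT z|?W. G b z)"
    using BW.integral_fst'[OF i] by simp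
  also have "\<dots> = (LINT z|?W. G True z) * \<alpha> + (LINT z|?W. G False z) * (1 - \<alpha>)"
    using \<alpha> by (rule integral_bernoulli_pmf)
  finally show "(LINT t|sample_law \<alpha> P. G (fst t) (snd t)) = \<alpha> * (LINT z|scalar_law P. G True z) + (1 - \<alpha>) * (LINT z|scalar_law P. G False z)"
    by simp
qed

section \<open>Overlaps in terms of the decomposition\<close>

lemma ip_add_left: "ip d (\<lambda>j. u j + v j) x = ip d u x + ip d v x"
  by (simp add: ip_def distrib_right sum.distrib)

lemma ip_cong: "(\<And>j. j < d \<Longrightarrow> u j = u' j) \<Longrightarrow> (\<And>j. j < d \<Longrightarrow> v j = v' j) \<Longrightarrow> ip d u v = ip d u' v'"
  unfolding ip_def by (intro sum.cong) auto

lemma ip_combination_left: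
  "ip d (\<lambda>j. A * u j + (B * v j + r j)) x = A * ip d u x + B * ip d v x + ip d r x"
  by (simp add: ip_add_left ip_scale_left)

text \<open>Numerator and denominator are divided by \<open>sqrt V\<close>. In this form the overlap converges no matter whether \<open>V\<close>
converges or diverges to infinity.\<close>

lemma overlap_of_decomposition:
  assumes x: "ip d u u = 1" "ip d v v = 1" and z: "\<And>j. j < d \<Longrightarrow> z j = A * u j + (B * v j + r j)"
    and V: "0 < V" and c: "c = ip d u v"
    and R1: "R1 = ip d r u / sqrt V" and R2: "R2 = ip d r v / sqrt V" and R3: "R3 = (L2_set r {..<d} - sqrt (V * \<gamma>)) / sqrt V"
  shows "overlap d z u = ((1 / sqrt V) * (A + B * c) + R1) /
    sqrt ((1 / sqrt V)\<^sup>2 * (A\<^sup>2 + B\<^sup>2 + 2 * A * B * c) + 2 * (1 / sqrt V) * (A * R1 + B * R2) + (R3 + sqrt \<gamma>)\<^sup>2)"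
proof -
  let ?y = "\<lambda>j. A * u j + (B * v j + r j)"
  define s where "s = sqrt V"
  have s: "0 < s" using V by (simp add: s_def)
  have ru: "ip d r u = s * R1" and rv: "ip d r v = s * R2" using s by (simp_all add: R1 R2 s_def)
  have "L2_set r {..<d} = s * (R3 + sqrt \<gamma>)" using s by (simp add: R3 s_def real_sqrt_mult field_simps)
  then have rr: "ip d r r = (s * (R3 + sqrt \<gamma>))\<^sup>2" by (simp add: ip_self_L2)
  have zu: "ip d z u = A + B * c + s * R1"
    using ip_cong[of d z ?y u u] z x by (simp add: ip_combination_left ru c ip_commute[of d v u])
  have "ip d z z = ip d ?y ?y" by (rule ip_cong) (auto simp: z)
  also have "\<dots> = A * ip d ?y u + B * ip d ?y v + ip d ?y r"
    unfolding ip_combination_left[of d A u B v r ?y] by (simp add: ip_commute)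
  also have "\<dots> = A\<^sup>2 + B\<^sup>2 + 2 * A * B * c + 2 * s * (A * R1 + B * R2) + (s * (R3 + sqrt \<gamma>))\<^sup>2"
    unfolding ip_combination_left x ru rv rr ip_commute[of d v u] ip_commute[of d u r] ip_commute[of d v r] c[symmetric]
    by (simp add: power2_eq_square algebra_simps)
  also have "\<dots> = s\<^sup>2 * ((1 / s)\<^sup>2 * (A\<^sup>2 + B\<^sup>2 + 2 * A * B * c) + 2 * (1 / s) * (A * R1 + B * R2) + (R3 + sqrt \<gamma>)\<^sup>2)"
    (is "_ = s\<^sup>2 * ?D")
  proof -
    have "Q + 2 * s * W + (s * Z)\<^sup>2 = s\<^sup>2 * ((1 / s)\<^sup>2 * Q + 2 * (1 / s) * W + Z\<^sup>2)" for Q W Z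
      using s by (simp add: power2_eq_square field_simps)
    then show ?thesis .
  qed
  finally have zz: "L2_set z {..<d} = s * sqrt ?D"
    using s L2_set_nonneg[of z "{..<d}"] by (metis ip_self_L2 real_sqrt_abs real_sqrt_mult abs_of_nonneg abs_of_pos)
  have "L2_set u {..<d} = 1" using x(1) L2_set_nonneg[of u "{..<d}"] by (simp add: ip_self_L2 power2_eq_1_iff)
  then have "overlap d z u = (s * ((1 / s) * (A + B * c) + R1)) / (s * sqrt ?D)"
    using s by (simp add: overlap_def zu zz distrib_left)
  then show ?thesis using s by (simp add: s_def)
qed

lemma overlap_limit:
  fixes k A B c R1 R2 R3 \<gamma> :: "nat \<Rightarrow> real"
  assumes "k \<longlonglongrightarrow> \<kappa>" "A \<longlonglongrightarrow> a" "B \<longlonglongrightarrow> b" "c \<longlonglongrightarrow> 0" "R1 \<longlonglongrightarrow> 0" "R2 \<longlonglongrightarrow> 0" "R3 \<longlonglongrightarrow> 0" "\<gamma> \<longlonglongrightarrow> g" "0 < g"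
  shows "(\<lambda>d. (k d * (A d + B d * c d) + R1 d) /
      sqrt ((k d)\<^sup>2 * ((A d)\<^sup>2 + (B d)\<^sup>2 + 2 * A d * B d * c d) + 2 * k d * (A d * R1 d + B d * R2 d) + (R3 d + sqrt (\<gamma> d))\<^sup>2))
    \<longlonglongrightarrow> \<kappa> * a / sqrt (\<kappa>\<^sup>2 * (a\<^sup>2 + b\<^sup>2) + g)"
proof -
  have "0 < \<kappa>\<^sup>2 * (a\<^sup>2 + b\<^sup>2) + g" using assms by (intro add_nonneg_pos) auto
  then have "sqrt (\<kappa>\<^sup>2 * (a\<^sup>2 + b\<^sup>2 + 2 * a * b * 0) + 2 * \<kappa> * (a * 0 + b * 0) + (0 + sqrt g)\<^sup>2) \<noteq> 0" using assms by simp
  then have "(\<lambda>d. (k d * (A d + B d * c d) + R1 d) /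
      sqrt ((k d)\<^sup>2 * ((A d)\<^sup>2 + (B d)\<^sup>2 + 2 * A d * B d * c d) + 2 * k d * (A d * R1 d + B d * R2 d) + (R3 d + sqrt (\<gamma> d))\<^sup>2))
    \<longlonglongrightarrow> (\<kappa> * (a + b * 0) + 0) / sqrt (\<kappa>\<^sup>2 * (a\<^sup>2 + b\<^sup>2 + 2 * a * b * 0) + 2 * \<kappa> * (a * 0 + b * 0) + (0 + sqrt g)\<^sup>2)"
    by (intro tendsto_intros assms)
  then show ?thesis using assms(9) by simp
qed

lemma lin_estimator_decomposition:
  fixes x1 x2 :: "nat \<Rightarrow> real" and a :: "nat \<Rightarrow> nat \<Rightarrow> real"
  assumes j: "j < d" and t: "t = (x1, x2, (\<lambda>i\<in>{..<n}. a i), (\<lambda>i\<in>{..<n}. \<eta> i), (\<lambda>i\<in>{..<n}. \<epsilon> i))"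
    and y: "\<And>i. i < n \<Longrightarrow> y i = q (predictor d x1 x2 (a i) (\<eta> i), \<epsilon> i)"
  shows "lin_estimator n L y a j =
    (\<Sum>i<n. of_bool (fst (sample d t i)) * (fst (snd (sample d t i)) * (L \<circ> q) (snd (sample d t i)))) / real n * x1 j +
    ((\<Sum>i<n. (1 - of_bool (fst (sample d t i))) * (fst (snd (sample d t i)) * (L \<circ> q) (snd (sample d t i)))) / real n * x2 j +
     instance_residual d n (L \<circ> q) t j)"
proof -
  have p: "predictor d x1 x2 v b = ip d v (if b then x1 else x2)" for v b
    by (cases b) (simp_all add: predictor_def)
  have s: "sample d t i = (\<eta> i, predictor d x1 x2 (a i) (\<eta> i), \<epsilon> i)" "fst (snd (snd t)) i = a i"
    "sample_signal t i = (if \<eta> i then x1 else x2)" if "i < n" for i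
    using that by (simp_all add: sample_def sample_signal_def t p)
  have "(\<Sum>i<n. L (y i) * a i j) = (\<Sum>i<n. of_bool (\<eta> i) * (predictor d x1 x2 (a i) (\<eta> i) * L (y i)) * x1 j +
     ((1 - of_bool (\<eta> i)) * (predictor d x1 x2 (a i) (\<eta> i) * L (y i)) * x2 j +
     L (y i) * (a i j - predictor d x1 x2 (a i) (\<eta> i) * (if \<eta> i then x1 else x2) j)))"
    by (intro sum.cong refl) (auto simp: algebra_simps)
  also have "\<dots> = (\<Sum>i<n. of_bool (\<eta> i) * (predictor d x1 x2 (a i) (\<eta> i) * L (y i))) * x1 j +
     ((\<Sum>i<n. (1 - of_bool (\<eta> i)) * (predictor d x1 x2 (a i) (\<eta> i) * L (y i))) * x2 j +
     (\<Sum>i<n. L (y i) * (a i j - predictor d x1 x2 (a i) (\<eta> i) * (if \<eta> i then x1 else x2) j)))"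
    by (simp only: sum.distrib sum_distrib_right)
  also have "(\<Sum>i<n. of_bool (\<eta> i) * (predictor d x1 x2 (a i) (\<eta> i) * L (y i))) =
    (\<Sum>i<n. of_bool (fst (sample d t i)) * (fst (snd (sample d t i)) * (L \<circ> q) (snd (sample d t i))))"
    by (intro sum.cong refl) (simp add: s y)
  also have "(\<Sum>i<n. (1 - of_bool (\<eta> i)) * (predictor d x1 x2 (a i) (\<eta> i) * L (y i))) =
    (\<Sum>i<n. (1 - of_bool (fst (sample d t i))) * (fst (snd (sample d t i)) * (L \<circ> q) (snd (sample d t i))))"
    by (intro sum.cong refl) (simp add: s y)
  also have "(\<Sum>i<n. L (y i) * (a i j - predictor d x1 x2 (a i) (\<eta> i) * (if \<eta> i then x1 else x2) j)) =
    (\<Sum>i<n. weight d (L \<circ> q) t i * (fst (snd (snd t)) i j - ip d (fst (snd (snd t)) i) (sample_signal t i) * sample_signal t i j))"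
    by (intro sum.cong refl) (simp add: s y weight_def p)
  finally show ?thesis
    unfolding lin_estimator_def instance_residual_def residual_def
    by (simp add: distrib_left)
qed

lemma summable_inverse_square: "summable (\<lambda>d. C / (real d)\<^sup>2)"
proof -
  have "summable (\<lambda>d. C * (1 / (real d)\<^sup>2))"
    using inverse_power_summable[of 2, where 'a=real] by (intro summable_mult) (simp add: inverse_eq_divide power_one_over)
  then show ?thesis by simp
qed


section \<open>Averages over a family of instances\<close>

lemma (in prob_space) array_mean_limit:
  fixes t :: "nat \<Rightarrow> nat \<Rightarrow> 'a \<Rightarrow> 'b" and F :: "'b \<Rightarrow> real" and n :: "nat \<Rightarrow> nat"
  assumes N: "prob_space N"
    and t: "\<And>d. 0 < d \<Longrightarrow> (\<lambda>\<omega>. \<lambda>i\<in>{..<n d}. t d i \<omega>) \<in> M \<rightarrow>\<^sub>M PiM {..<n d} (\<lambda>_. N)"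
    and law: "\<And>d. 0 < d \<Longrightarrow> distr M (PiM {..<n d} (\<lambda>_. N)) (\<lambda>\<omega>. \<lambda>i\<in>{..<n d}. t d i \<omega>) = PiM {..<n d} (\<lambda>_. N)"
    and F: "F \<in> borel_measurable N" "integrable N (\<lambda>x. (F x)\<^sup>2)"
    and c: "0 < c" and n: "\<forall>\<^sub>F d in sequentially. c * real d \<le> real (n d) \<and> real (n d) \<le> C * real d"
  shows "AE \<omega> in M. (\<lambda>d. (\<Sum>i<n d. F (t d i \<omega>)) / real (n d)) \<longlonglongrightarrow> (LINT x|N. F x)"
proof -
  have "AE \<omega> in M. (\<lambda>d. (\<Sum>i<n d. F (t d i \<omega>)) / real (n d) - (LINT x|N. F x)) \<longlonglongrightarrow> 0"
  proof (rule AE_tendsto_zero_if_tails_summable)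
    show "(\<lambda>\<omega>. (\<Sum>i<n d. F (t d i \<omega>)) / real (n d) - (LINT x|N. F x)) \<in> borel_measurable M" if "0 < d" for d
      by (rule prob_mean_deviation[OF t[OF that] law[OF that] F(1)])
    fix e :: real assume e: "0 < e"
    obtain p where p: "summable p" "\<forall>\<^sub>F d in sequentially. measure (PiM {..<n d} (\<lambda>_. N))
      {x\<in>space (PiM {..<n d} (\<lambda>_. N)). e < \<bar>(\<Sum>i<n d. F (x i)) / real (n d) - (LINT x|N. F x)\<bar>} \<le> p d"
      using complete_convergence_of_means[OF N F c n e] by blast
    have "\<forall>\<^sub>F d in sequentially. prob {\<omega>\<in>space M. e < \<bar>(\<Sum>i<n d. F (t d i \<omega>)) / real (n d) - (LINT x|N. F x)\<bar>} \<le> p d"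
      using p(2) eventually_gt_at_top[of 0]
    proof eventually_elim
      case (elim d)
      show ?case unfolding prob_mean_deviation(1)[OF t[OF elim(2)] law[OF elim(2)] F(1)] by (rule elim(1))
    qed
    with p(1) show "\<exists>p. summable p \<and> (\<forall>\<^sub>F d in sequentially. prob {\<omega>\<in>space M. e < \<bar>(\<Sum>i<n d. F (t d i \<omega>)) / real (n d) - (LINT x|N. F x)\<bar>} \<le> p d)"
      by blast
  qed
  then show ?thesis by (simp only: LIM_zero_iff)
qed

text \<open>The \<open>i\<close>-th term of the sequence is taken from any dimension with more than \<open>i\<close> samples; by coherence this choice
is almost surely immaterial.\<close>

lemma (in prob_space) coherent_array_is_sequence:
  fixes t :: "nat \<Rightarrow> nat \<Rightarrow> 'a \<Rightarrow> 'b" and n :: "nat \<Rightarrow> nat"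
  assumes N: "prob_space N"
    and t: "\<And>d. 0 < d \<Longrightarrow> (\<lambda>\<omega>. \<lambda>i\<in>{..<n d}. t d i \<omega>) \<in> M \<rightarrow>\<^sub>M PiM {..<n d} (\<lambda>_. N)"
    and law: "\<And>d. 0 < d \<Longrightarrow> distr M (PiM {..<n d} (\<lambda>_. N)) (\<lambda>\<omega>. \<lambda>i\<in>{..<n d}. t d i \<omega>) = PiM {..<n d} (\<lambda>_. N)"
    and n: "filterlim n at_top sequentially"
    and coh: "AE \<omega> in M. \<forall>d>0. \<forall>d'>0. \<forall>i. i < n d \<and> i < n d' \<longrightarrow> t d i \<omega> = t d' i \<omega>"
  obtains X where "\<And>m. (\<lambda>\<omega>. \<lambda>i\<in>{..<m}. X i \<omega>) \<in> M \<rightarrow>\<^sub>M PiM {..<m} (\<lambda>_. N)"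
    and "\<And>m. distr M (PiM {..<m} (\<lambda>_. N)) (\<lambda>\<omega>. \<lambda>i\<in>{..<m}. X i \<omega>) = PiM {..<m} (\<lambda>_. N)"
    and "AE \<omega> in M. \<forall>d>0. \<forall>i<n d. t d i \<omega> = X i \<omega>"
proof -
  have ex: "\<exists>d>0. m \<le> n d" for m
  proof -
    have "\<forall>\<^sub>F d in sequentially. m \<le> n d \<and> 0 < d"
      using n eventually_gt_at_top[of 0] by (auto simp: filterlim_at_top intro: eventually_conj)
    then show ?thesis by (auto simp: eventually_sequentially)
  qed
  define D where "D i = (SOME d. 0 < d \<and> i < n d)" for i
  have D: "0 < D i" "i < n (D i)" for i
    using someI_ex[of "\<lambda>d. 0 < d \<and> i < n d"] ex[of "Suc i"] unfolding D_def by (auto simp: Suc_le_eq)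
  define X where "X i = t (D i) i" for i
  have Xi: "X i \<in> M \<rightarrow>\<^sub>M N" for i
  proof -
    have "(\<lambda>\<omega>. (\<lambda>j\<in>{..<n (D i)}. t (D i) j \<omega>) i) \<in> M \<rightarrow>\<^sub>M N"
      using D[of i] by (intro measurable_compose[OF t measurable_component_singleton]) auto
    then show ?thesis using D[of i] by (simp add: X_def)
  qed
  have Xm: "(\<lambda>\<omega>. \<lambda>i\<in>{..<m}. X i \<omega>) \<in> M \<rightarrow>\<^sub>M PiM {..<m} (\<lambda>_. N)" for m
    by (intro measurable_restrict Xi)
  have AE: "AE \<omega> in M. \<forall>d>0. \<forall>i<n d. t d i \<omega> = X i \<omega>"
    using coh
  proof eventually_elim
    case (elim \<omega>)
    show ?case
    proof (intro allI impI)
      fix d i assume "0 < d" "i < n d"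
      then show "t d i \<omega> = X i \<omega>" using elim[rule_format, of d "D i" i] D[of i] by (simp only: X_def)
    qed
  qed
  have "distr M (PiM {..<m} (\<lambda>_. N)) (\<lambda>\<omega>. \<lambda>i\<in>{..<m}. X i \<omega>) = PiM {..<m} (\<lambda>_. N)" for m
  proof -
    obtain d where d: "0 < d" "m \<le> n d" using ex by blast
    let ?Z = "\<lambda>\<omega>. \<lambda>i\<in>{..<n d}. t d i \<omega>" and ?r = "\<lambda>x. restrict x {..<m}"
    interpret N: product_prob_space "\<lambda>_::nat. N" by (intro product_prob_spaceI N)
    have sub: "{..<m} \<subseteq> {..<n d}" using d by auto
    have r: "?r \<in> PiM {..<n d} (\<lambda>_. N) \<rightarrow>\<^sub>M PiM {..<m} (\<lambda>_. N)" by (rule measurable_restrict_subset[OF sub])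
    have "distr M (PiM {..<m} (\<lambda>_. N)) (\<lambda>\<omega>. \<lambda>i\<in>{..<m}. X i \<omega>) = distr M (PiM {..<m} (\<lambda>_. N)) (?r \<circ> ?Z)"
    proof (rule distr_cong_AE)
      show "AE \<omega> in M. (\<lambda>i\<in>{..<m}. X i \<omega>) = (?r \<circ> ?Z) \<omega>"
        using AE by eventually_elim (use d in \<open>auto simp: fun_eq_iff restrict_def\<close>)
      show "?r \<circ> ?Z \<in> M \<rightarrow>\<^sub>M PiM {..<m} (\<lambda>_. N)" by (rule measurable_comp[OF t[OF d(1)] r])
    qed (use Xm in auto)
    also have "\<dots> = distr (distr M (PiM {..<n d} (\<lambda>_. N)) ?Z) (PiM {..<m} (\<lambda>_. N)) ?r"
      by (rule distr_distr[OF r t[OF d(1)], symmetric])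
    also have "\<dots> = PiM {..<m} (\<lambda>_. N)"
      unfolding law[OF d(1)] by (rule N.distr_restrict[OF sub, symmetric]) simp
    finally show ?thesis .
  qed
  with Xm AE show ?thesis using that by blast
qed

section \<open>The limit of the overlaps\<close>

lemma sample_predictor:
  "i < n \<Longrightarrow> sample d (x1, x2, (\<lambda>i\<in>{..<n}. a i), (\<lambda>i\<in>{..<n}. \<eta> i), (\<lambda>i\<in>{..<n}. \<epsilon> i)) i =
    (\<eta> i, predictor d x1 x2 (a i) (\<eta> i), \<epsilon> i)"
  by (cases "\<eta> i") (simp_all add: sample_def predictor_def)

theorem corollary3p8:
  fixes M :: "'w measure"
    and n :: "nat \<Rightarrow> nat"
    and \<delta> \<alpha> :: real
    and q :: "real \<times> real \<Rightarrow> real"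
    and P :: "real measure"
    and L :: "real \<Rightarrow> real"
    and x1 x2 :: "nat \<Rightarrow> 'w \<Rightarrow> nat \<Rightarrow> real"
    and a :: "nat \<Rightarrow> nat \<Rightarrow> 'w \<Rightarrow> nat \<Rightarrow> real"
    and \<eta> :: "nat \<Rightarrow> nat \<Rightarrow> 'w \<Rightarrow> bool"
    and \<epsilon> :: "nat \<Rightarrow> nat \<Rightarrow> 'w \<Rightarrow> real"
    and y :: "nat \<Rightarrow> nat \<Rightarrow> 'w \<Rightarrow> real"
    and xlin :: "nat \<Rightarrow> 'w \<Rightarrow> nat \<Rightarrow> real"
  assumes "prob_space M"
    and "filterlim n at_top sequentially"
    and "0 < \<delta>" and "(\<lambda>d. real (n d) / real d) \<longlonglongrightarrow> \<delta>"
    and "1/2 < \<alpha>" and "\<alpha> < 1"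
    and "q \<in> borel_measurable borel"
    and "prob_space P" and "sets P = sets borel" and "integrable P (\<lambda>e. e\<^sup>2)"
    and model: "\<And>d. 0 < d \<Longrightarrow> mixed_glm_instance M d (n d) \<alpha> P (x1 d) (x2 d) (a d) (\<eta> d) (\<epsilon> d)"
    and y: "\<And>d i \<omega>. y d i \<omega> = q (predictor d (x1 d \<omega>) (x2 d \<omega>) (a d i \<omega>) (\<eta> d i \<omega>), \<epsilon> d i \<omega>)"
    and "\<exists>C. C-lipschitz_on UNIV L"
    and "integrable (scalar_law P) (\<lambda>z. fst z * L (q z))"
    and "mean_GL P q L \<noteq> 0"
    and xlin: "\<And>d \<omega>. xlin d \<omega> = lin_estimator (n d) L (\<lambda>i. y d i \<omega>) (\<lambda>i. a d i \<omega>)"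
    and coupling: "coherent_samples M n x1 x2 a \<eta> \<epsilon> \<or>
                   integrable (scalar_law P) (\<lambda>z. (L (q z)) ^ 4)"
  shows "AE \<omega> in M.
           (\<lambda>d. ereal (overlap d (xlin d \<omega>) (x1 d \<omega>))) \<longlonglongrightarrow> rho1_lin \<alpha> \<delta> P q L \<and>
           (\<lambda>d. ereal (overlap d (xlin d \<omega>) (x2 d \<omega>))) \<longlonglongrightarrow> rho2_lin \<alpha> \<delta> P q L"
proof -
  interpret prob_space M by fact
  note n_lim = assms(2) and \<delta> = assms(3) and nd = assms(4) and \<alpha>1 = assms(5) and \<alpha>2 = assms(6) and qm = assms(7)
    and P = assms(8) and Pb = assms(9) and Lip = assms(13) and GL = assms(14) and m0 = assms(15)
  define h where "h = L \<circ> q"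
  define m where "m = mean_GL P q L"
  have \<alpha>: "0 \<le> \<alpha>" "\<alpha> \<le> 1" using \<alpha>1 \<alpha>2 by auto
  obtain C where "C-lipschitz_on UNIV L" using Lip by blast
  then have "continuous_on UNIV L" by (rule lipschitz_on_continuous_on)
  then have "L \<in> borel_measurable borel" by (rule borel_measurable_continuous_onI)
  then have h: "h \<in> borel_measurable borel" unfolding h_def using qm by (rule measurable_comp[rotated])
  have sW: "sets (scalar_law P) = sets (borel :: (real \<times> real) measure)"
    unfolding borel_prod[symmetric] by (intro sets_pair_measure_cong Pb) simp
  then have hW [measurable]: "h \<in> borel_measurable (scalar_law P)" using h by (simp cong: measurable_cong_sets)
  have PW: "prob_space (scalar_law P)" by (intro prob_space_pair prob_space_gauss P)
  have P\<tau>: "prob_space (sample_law \<alpha> P)" by (intro prob_space_pair PW prob_space_measure_pmf)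
  define T :: "nat \<Rightarrow> 'w \<Rightarrow> glm_data" where
    "T d \<omega> = (x1 d \<omega>, x2 d \<omega>, \<lambda>i\<in>{..<n d}. a d i \<omega>, \<lambda>i\<in>{..<n d}. \<eta> d i \<omega>, \<lambda>i\<in>{..<n d}. \<epsilon> d i \<omega>)" for d \<omega>
  have "\<exists>\<mu>. uniform_on_sphere d \<mu> \<and> T d \<in> M \<rightarrow>\<^sub>M instance_law d (n d) \<mu> \<alpha> P \<and>
      distr M (instance_law d (n d) \<mu> \<alpha> P) (T d) = instance_law d (n d) \<mu> \<alpha> P" if "0 < d" for d
    using model[OF that] by (simp add: mixed_glm_instance_def T_def[abs_def] Let_def)
  then obtain \<mu> where \<mu>: "\<And>d. 0 < d \<Longrightarrow> uniform_on_sphere d (\<mu> d)"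
    and Tm: "\<And>d. 0 < d \<Longrightarrow> T d \<in> M \<rightarrow>\<^sub>M instance_law d (n d) (\<mu> d) \<alpha> P"
    and Tlaw: "\<And>d. 0 < d \<Longrightarrow> distr M (instance_law d (n d) (\<mu> d) \<alpha> P) (T d) = instance_law d (n d) (\<mu> d) \<alpha> P"
    by metis
  have \<mu>s: "sets (\<mu> d) = sets (vec_borel d)" if "0 < d" for d
    using \<mu>[OF that] by (simp add: uniform_on_sphere_def)

  have n_bounds: "\<forall>\<^sub>F d in sequentially. \<delta> / 2 * real d \<le> real (n d) \<and> real (n d) \<le> 2 * \<delta> * real d"
  proof -
    have "\<forall>\<^sub>F d in sequentially. \<delta> / 2 < real (n d) / real d" "\<forall>\<^sub>F d in sequentially. real (n d) / real d < 2 * \<delta>"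
      using order_tendstoD[OF nd, of "\<delta> / 2"] order_tendstoD[OF nd, of "2 * \<delta>"] \<delta> by auto
    then show ?thesis
      using eventually_gt_at_top[of 0] by eventually_elim (simp add: field_simps)
  qed
  have n_pos: "\<forall>\<^sub>F d in sequentially. 0 < n d"
  proof -
    have "\<forall>\<^sub>F d in sequentially. 1 \<le> n d" using n_lim unfolding filterlim_at_top by blast
    then show ?thesis by eventually_elim simp
  qed

  \<comment> \<open>As \<open>n d\<close> is eventually at least \<open>\<delta> d / 2\<close>, tails of order \<open>(n d)\<^sup>-\<^sup>2\<close> are summable over \<open>d\<close>.\<close>
  have small: "AE \<omega> in M. (\<lambda>d. Y d (T d \<omega>)) \<longlonglongrightarrow> 0"
    if Y: "\<And>d. 0 < d \<Longrightarrow> Y d \<in> borel_measurable (instance_law d (n d) (\<mu> d) \<alpha> P)"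
      and tail: "\<And>d e. 0 < d \<Longrightarrow> 0 < n d \<Longrightarrow> 0 < e \<Longrightarrow>
        emeasure (instance_law d (n d) (\<mu> d) \<alpha> P) {t\<in>space (instance_law d (n d) (\<mu> d) \<alpha> P). e < \<bar>Y d t\<bar>} \<le>
        ennreal (c / e ^ 4 / (real (n d))\<^sup>2)"
      and c: "0 \<le> c" for Y :: "nat \<Rightarrow> glm_data \<Rightarrow> real" and c :: real
  proof (rule AE_tendsto_zero_if_tails_summable)
    show "(\<lambda>\<omega>. Y d (T d \<omega>)) \<in> borel_measurable M" if "0 < d" for d
      by (rule measurable_compose[OF Tm[OF that] Y[OF that]])
    fix e :: real assume e: "0 < e"
    have "\<forall>\<^sub>F d in sequentially. prob {\<omega>\<in>space M. e < \<bar>Y d (T d \<omega>)\<bar>} \<le> c / e ^ 4 / (\<delta> / 2)\<^sup>2 / (real d)\<^sup>2"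
      using n_bounds n_pos eventually_gt_at_top[of 0]
    proof eventually_elim
      case (elim d)
      have "prob {\<omega>\<in>space M. e < \<bar>Y d (T d \<omega>)\<bar>} \<le> c / e ^ 4 / (real (n d))\<^sup>2"
        using c elim e by (intro prob_tail_transfer[OF Tm Tlaw Y tail]) auto
      also have "\<dots> \<le> c / e ^ 4 / (\<delta> / 2 * real d)\<^sup>2"
        using c e elim \<delta> by (intro divide_left_mono power_mono mult_pos_pos zero_less_power) auto
      also have "\<dots> = c / e ^ 4 / (\<delta> / 2)\<^sup>2 / (real d)\<^sup>2" by (simp only: power_mult_distrib divide_divide_eq_left)
      finally show ?case .
    qed
    then show "\<exists>p. summable p \<and> (\<forall>\<^sub>F d in sequentially. prob {\<omega>\<in>space M. e < \<bar>Y d (T d \<omega>)\<bar>} \<le> p d)"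
      using summable_inverse_square[of "c / e ^ 4 / (\<delta> / 2)\<^sup>2"] by blast
  qed
  have R1: "AE \<omega> in M. (\<lambda>d. scaled_residual_ip1 d (n d) h (T d \<omega>)) \<longlonglongrightarrow> 0"
  proof (rule small[of "\<lambda>d. scaled_residual_ip1 d (n d) h" 3], goal_cases)
    case (1 d)
    then show ?case by (intro measurable_scaled_residuals \<mu>s Pb h)
  next
    case (2 d e)
    then show ?case by (intro scaled_residual_tails \<mu> P Pb h)
  qed simp
  have R2: "AE \<omega> in M. (\<lambda>d. scaled_residual_ip2 d (n d) h (T d \<omega>)) \<longlonglongrightarrow> 0"
  proof (rule small[of "\<lambda>d. scaled_residual_ip2 d (n d) h" 3], goal_cases)
    case (1 d)
    then show ?case by (intro measurable_scaled_residuals \<mu>s Pb h)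
  next
    case (2 d e)
    then show ?case by (intro scaled_residual_tails \<mu> P Pb h)
  qed simp
  have R3: "AE \<omega> in M. (\<lambda>d. scaled_residual_norm_error d (n d) h (T d \<omega>)) \<longlonglongrightarrow> 0"
  proof (rule small[of "\<lambda>d. scaled_residual_norm_error d (n d) h" 5346], goal_cases)
    case (1 d)
    then show ?case by (intro measurable_scaled_residuals \<mu>s Pb h)
  next
    case (2 d e)
    then show ?case by (intro scaled_residual_tails \<mu> P Pb h)
  qed simp

  have mc: "(\<lambda>t. ip d (fst t) (fst (snd t))) \<in> borel_measurable (instance_law d (n d) (\<mu> d) \<alpha> P)" if "0 < d" for d
    by (intro measurable_ip measurable_instance_components[OF \<mu>s[OF that] Pb]; assumption)
  have c_lim: "AE \<omega> in M. (\<lambda>d. ip d (x1 d \<omega>) (x2 d \<omega>)) \<longlonglongrightarrow> 0"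
  proof (rule AE_tendsto_zero_if_tails_summable)
    show "(\<lambda>\<omega>. ip d (x1 d \<omega>) (x2 d \<omega>)) \<in> borel_measurable M" if "0 < d" for d
      using measurable_compose[OF Tm[OF that] mc[OF that]] by (simp add: T_def)
    fix e :: real assume e: "0 < e"
    have "\<forall>\<^sub>F d in sequentially. prob {\<omega>\<in>space M. e < \<bar>ip d (x1 d \<omega>) (x2 d \<omega>)\<bar>} \<le> 3 / e ^ 4 / (real d)\<^sup>2"
      using eventually_gt_at_top[of 0]
    proof eventually_elim
      case (elim d)
      show ?case
        using prob_tail_transfer[OF Tm[OF elim] Tlaw[OF elim] mc[OF elim] instance_signals(2)[OF \<mu>[OF elim] P Pb elim e]]
        by (simp add: T_def)
    qed
    then show "\<exists>p. summable p \<and> (\<forall>\<^sub>F d in sequentially. prob {\<omega>\<in>space M. e < \<bar>ip d (x1 d \<omega>) (x2 d \<omega>)\<bar>} \<le> p d)"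
      using summable_inverse_square[of "3 / e ^ 4"] by blast
  qed
  have unit: "AE \<omega> in M. \<forall>d>0. ip d (x1 d \<omega>) (x1 d \<omega>) = 1 \<and> ip d (x2 d \<omega>) (x2 d \<omega>) = 1"
  proof (subst AE_all_countable, intro allI)
    fix d
    show "AE \<omega> in M. 0 < d \<longrightarrow> ip d (x1 d \<omega>) (x1 d \<omega>) = 1 \<and> ip d (x2 d \<omega>) (x2 d \<omega>) = 1"
    proof (cases "0 < d")
      case d: True
      have "AE t in distr M (instance_law d (n d) (\<mu> d) \<alpha> P) (T d). ip d (fst t) (fst t) = 1 \<and> ip d (fst (snd t)) (fst (snd t)) = 1"
        unfolding Tlaw[OF d] by (rule instance_signals(1)[OF \<mu>[OF d] P Pb])
      from AE_distrD[OF Tm[OF d] this] show ?thesis by (simp add: T_def)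
    qed simp
  qed

  let ?t = "\<lambda>d i \<omega>. sample d (T d \<omega>) i"
  let ?avg = "\<lambda>(F :: bool \<times> real \<times> real \<Rightarrow> real) d \<omega>. (\<Sum>i<n d. F (?t d i \<omega>)) / real (n d)"
  have Zm: "(\<lambda>\<omega>. \<lambda>i\<in>{..<n d}. ?t d i \<omega>) \<in> M \<rightarrow>\<^sub>M PiM {..<n d} (\<lambda>_. sample_law \<alpha> P)"
    and Zlaw: "distr M (PiM {..<n d} (\<lambda>_. sample_law \<alpha> P)) (\<lambda>\<omega>. \<lambda>i\<in>{..<n d}. ?t d i \<omega>) = PiM {..<n d} (\<lambda>_. sample_law \<alpha> P)"
    if d: "0 < d" for d
  proof -
    have Z: "(\<lambda>t. \<lambda>i\<in>{..<n d}. sample d t i) \<in> instance_law d (n d) (\<mu> d) \<alpha> P \<rightarrow>\<^sub>M PiM {..<n d} (\<lambda>_. sample_law \<alpha> P)"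
      by (intro measurable_restrict measurable_sample \<mu>s d Pb) auto
    show "(\<lambda>\<omega>. \<lambda>i\<in>{..<n d}. ?t d i \<omega>) \<in> M \<rightarrow>\<^sub>M PiM {..<n d} (\<lambda>_. sample_law \<alpha> P)"
      by (rule measurable_compose[OF Tm[OF d] Z])
    have "distr M (PiM {..<n d} (\<lambda>_. sample_law \<alpha> P)) (\<lambda>\<omega>. \<lambda>i\<in>{..<n d}. ?t d i \<omega>) =
      distr (distr M (instance_law d (n d) (\<mu> d) \<alpha> P) (T d)) (PiM {..<n d} (\<lambda>_. sample_law \<alpha> P)) (\<lambda>t. \<lambda>i\<in>{..<n d}. sample d t i)"
      by (simp add: distr_distr[OF Z Tm[OF d]] comp_def)
    also have "\<dots> = PiM {..<n d} (\<lambda>_. sample_law \<alpha> P)"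
      unfolding Tlaw[OF d] by (rule instance_sample_law[OF \<mu>[OF d] P Pb])
    finally show "distr M (PiM {..<n d} (\<lambda>_. sample_law \<alpha> P)) (\<lambda>\<omega>. \<lambda>i\<in>{..<n d}. ?t d i \<omega>) = PiM {..<n d} (\<lambda>_. sample_law \<alpha> P)" .
  qed

  \<comment> \<open>The averages of \<open>F1\<close>, \<open>F2\<close>, \<open>F3\<close> over the samples are \<open>A\<^sub>1\<close>, \<open>A\<^sub>2\<close> and \<open>V\<close>.\<close>
  define F1 F2 F3 :: "bool \<times> real \<times> real \<Rightarrow> real" where
    "F1 t = of_bool (fst t) * (fst (snd t) * h (snd t))" and
    "F2 t = (1 - of_bool (fst t)) * (fst (snd t) * h (snd t))" and
    "F3 t = (h (snd t))\<^sup>2" for t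
  have [measurable]: "F1 \<in> borel_measurable (sample_law \<alpha> P)" "F2 \<in> borel_measurable (sample_law \<alpha> P)" "F3 \<in> borel_measurable (sample_law \<alpha> P)"
    unfolding F1_def[abs_def] F2_def[abs_def] F3_def[abs_def] by measurable
  have GLh: "integrable (scalar_law P) (\<lambda>z. fst z * h z)" and mh: "(LINT z|scalar_law P. fst z * h z) = m"
    using GL by (simp_all add: h_def m_def mean_GL_def)
  have iF1: "integrable (sample_law \<alpha> P) F1" and eF1: "(LINT t|sample_law \<alpha> P. F1 t) = \<alpha> * m"
    using integral_sample_law[OF P \<alpha>, of "\<lambda>b z. of_bool b * (fst z * h z)"] GLh mh by (simp_all add: F1_def[abs_def])
  have iF2: "integrable (sample_law \<alpha> P) F2" and eF2: "(LINT t|sample_law \<alpha> P. F2 t) = (1 - \<alpha>) * m"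
    using integral_sample_law[OF P \<alpha>, of "\<lambda>b z. (1 - of_bool b) * (fst z * h z)"] GLh mh by (simp_all add: F2_def[abs_def])
  have S: "second_moment_L P q L = (\<integral>\<^sup>+z. ennreal ((h z)\<^sup>2) \<partial>scalar_law P)"
    by (simp add: second_moment_L_def h_def)
  have nnF3: "(\<integral>\<^sup>+t. ennreal (F3 t) \<partial>sample_law \<alpha> P) = second_moment_L P q L"
  proof -
    have "(\<integral>\<^sup>+t. ennreal (F3 t) \<partial>sample_law \<alpha> P) = (\<integral>\<^sup>+b. \<integral>\<^sup>+z. ennreal (F3 (b, z)) \<partial>scalar_law P \<partial>measure_pmf (bernoulli_pmf \<alpha>))"
      by (rule nn_integral_pair[OF PW]) measurable
    then show ?thesis by (simp only: F3_def snd_conv S nn_integral_const_prob[OF prob_space_measure_pmf])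
  qed
  define s where "s = enn2real (second_moment_L P q L)"
  have iF3: "integrable (sample_law \<alpha> P) F3" and eF3: "(LINT t|sample_law \<alpha> P. F3 t) = s"
    if fin: "second_moment_L P q L \<noteq> \<infinity>"
  proof -
    show "integrable (sample_law \<alpha> P) F3"
      using fin nnF3 by (intro integrableI_nonneg) (auto simp: F3_def less_top)
    show "(LINT t|sample_law \<alpha> P. F3 t) = s"
      unfolding s_def nnF3[symmetric] by (rule integral_eq_nn_integral) (auto simp: F3_def)
  qed
  \<comment> \<open>A vanishing second moment would force \<open>E[G L(Y)] = 0\<close>.\<close>
  have S0: "second_moment_L P q L \<noteq> 0"
  proof
    assume "second_moment_L P q L = 0"
    then have "AE z in scalar_law P. ennreal ((h z)\<^sup>2) = 0"
      unfolding S by (subst (asm) nn_integral_0_iff_AE) auto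
    then have "AE z in scalar_law P. fst z * h z = 0" by eventually_elim (simp add: ennreal_eq_0_iff)
    then have "(LINT z|scalar_law P. fst z * h z) = (LINT z|scalar_law P. 0)"
      by (intro integral_cong_AE) auto
    then show False using mh m0 by (simp add: m_def)
  qed

  \<comment> \<open>The only step in which it matters how the instances are coupled.\<close>
  have means: "(AE \<omega> in M. (\<lambda>d. ?avg F1 d \<omega>) \<longlonglongrightarrow> \<alpha> * m) \<and>
    (AE \<omega> in M. (\<lambda>d. ?avg F2 d \<omega>) \<longlonglongrightarrow> (1 - \<alpha>) * m) \<and>
    (AE \<omega> in M. if second_moment_L P q L = \<infinity> then filterlim (\<lambda>d. ?avg F3 d \<omega>) at_top sequentially
      else (\<lambda>d. ?avg F3 d \<omega>) \<longlonglongrightarrow> s)"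
    using coupling
  proof
    assume "coherent_samples M n x1 x2 a \<eta> \<epsilon>"
    then have "AE \<omega> in M. \<forall>d>0. \<forall>d'>0. \<forall>i. i < n d \<and> i < n d' \<longrightarrow> ?t d i \<omega> = ?t d' i \<omega>"
      unfolding coherent_samples_def
    proof eventually_elim
      case (elim \<omega>)
      have p: "?t d i \<omega> = (\<eta> d i \<omega>, predictor d (x1 d \<omega>) (x2 d \<omega>) (a d i \<omega>) (\<eta> d i \<omega>), \<epsilon> d i \<omega>)" if "i < n d" for d i
        using that by (simp add: T_def sample_predictor)
      show ?case
      proof (intro allI impI)
        fix d d' i assume d: "0 < d" "0 < d'" and i: "i < n d \<and> i < n d'"
        show "?t d i \<omega> = ?t d' i \<omega>"
          using elim[rule_format, OF d i] unfolding p[OF conjunct1[OF i]] p[OF conjunct2[OF i]] prod.inject by blast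
      qed
    qed
    from coherent_array_is_sequence[where t="\<lambda>d i \<omega>. sample d (T d \<omega>) i", OF P\<tau> Zm Zlaw n_lim this]
    obtain X where X: "\<And>m. (\<lambda>\<omega>. \<lambda>i\<in>{..<m}. X i \<omega>) \<in> M \<rightarrow>\<^sub>M PiM {..<m} (\<lambda>_. sample_law \<alpha> P)"
      "\<And>m. distr M (PiM {..<m} (\<lambda>_. sample_law \<alpha> P)) (\<lambda>\<omega>. \<lambda>i\<in>{..<m}. X i \<omega>) = PiM {..<m} (\<lambda>_. sample_law \<alpha> P)"
      and tX: "AE \<omega> in M. \<forall>d>0. \<forall>i<n d. ?t d i \<omega> = X i \<omega>"
      by blast
    have lim: "filterlim (\<lambda>d. ?avg F d \<omega>) G sequentially"
      if F: "filterlim (\<lambda>k. (\<Sum>i<k. F (X i \<omega>)) / real k) G sequentially" and "\<forall>d>0. \<forall>i<n d. ?t d i \<omega> = X i \<omega>"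
      for F :: "bool \<times> real \<times> real \<Rightarrow> real" and G \<omega>
    proof -
      have "\<forall>\<^sub>F d in sequentially. (\<Sum>i<n d. F (X i \<omega>)) / real (n d) = ?avg F d \<omega>"
        using eventually_gt_at_top[of 0] by eventually_elim (use that(2) in simp)
      with filterlim_compose[OF F n_lim] show ?thesis by (simp cong: filterlim_cong)
    qed
    have "AE \<omega> in M. (\<lambda>d. ?avg F d \<omega>) \<longlonglongrightarrow> (LINT t|sample_law \<alpha> P. F t)"
      if "integrable (sample_law \<alpha> P) F" for F
      using strong_law[OF P\<tau> X that] tX by eventually_elim (rule lim)
    moreover have "AE \<omega> in M. filterlim (\<lambda>d. ?avg F3 d \<omega>) at_top sequentially"
      if "second_moment_L P q L = \<infinity>"
    proof -
      have "AE \<omega> in M. filterlim (\<lambda>k. (\<Sum>i<k. F3 (X i \<omega>)) / real k) at_top sequentially"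
        by (rule strong_law_infinite[OF P\<tau> X]) (use that nnF3 in \<open>auto simp: F3_def\<close>)
      then show ?thesis using tX by eventually_elim (rule lim)
    qed
    ultimately show ?thesis
      using iF1 iF2 iF3 unfolding eF1[symmetric] eF2[symmetric]
      by (cases "second_moment_L P q L = \<infinity>") (simp_all add: eF3[symmetric])
  next
    assume h4: "integrable (scalar_law P) (\<lambda>z. (L (q z)) ^ 4)"
    interpret W: prob_space "scalar_law P" by (rule PW)
    have h4: "integrable (scalar_law P) (\<lambda>z. h z ^ 4)" using h4 by (simp add: h_def)
    have "integrable (distr (scalar_law P) gauss fst) (\<lambda>x. x ^ 4)"
      unfolding prob_space.distr_pair_fst[OF P] by (rule integrable_gauss_power)
    then have g4: "integrable (scalar_law P) (\<lambda>z. fst z ^ 4)" by (subst (asm) integrable_distr_eq) auto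
    \<comment> \<open>All three variables are square integrable, because \<open>2 (g h)\<^sup>2 \<le> g\<^sup>4 + h\<^sup>4\<close>.\<close>
    have gh: "integrable (scalar_law P) (\<lambda>z. (fst z * h z)\<^sup>2)"
    proof (rule Bochner_Integration.integrable_bound[OF Bochner_Integration.integrable_add[OF g4 h4]])
      have "\<bar>(x * y)\<^sup>2\<bar> \<le> \<bar>x ^ 4 + y ^ 4\<bar>" for x y :: real
      proof -
        have "2 * (x * y)\<^sup>2 \<le> x ^ 4 + y ^ 4"
          using zero_le_power2[of "x\<^sup>2 - y\<^sup>2"] by (simp add: power2_eq_square power4_eq_xxxx algebra_simps)
        then show ?thesis using zero_le_power2[of "x * y"] unfolding abs_power2 by linarith
      qed
      then show "AE z in scalar_law P. norm ((fst z * h z)\<^sup>2) \<le> norm (fst z ^ 4 + h z ^ 4)" by simp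
    qed measurable
    have "integrable (sample_law \<alpha> P) (\<lambda>t. (of_bool (fst t) * (fst (snd t) * h (snd t)))\<^sup>2)"
    proof (rule integral_sample_law(1)[OF P \<alpha>, of "\<lambda>b z. (of_bool b * (fst z * h z))\<^sup>2"])
      show "integrable (scalar_law P) (\<lambda>z. (of_bool b * (fst z * h z))\<^sup>2)" for b using gh by (cases b) simp_all
    qed
    moreover have "integrable (sample_law \<alpha> P) (\<lambda>t. ((1 - of_bool (fst t)) * (fst (snd t) * h (snd t)))\<^sup>2)"
    proof (rule integral_sample_law(1)[OF P \<alpha>, of "\<lambda>b z. ((1 - of_bool b) * (fst z * h z))\<^sup>2"])
      show "integrable (scalar_law P) (\<lambda>z. ((1 - of_bool b) * (fst z * h z))\<^sup>2)" for b using gh by (cases b) simp_all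
    qed
    moreover have "integrable (sample_law \<alpha> P) (\<lambda>t. ((h (snd t))\<^sup>2)\<^sup>2)"
      by (rule integral_sample_law(1)[OF P \<alpha>, of "\<lambda>b z. ((h z)\<^sup>2)\<^sup>2"]) (use h4 in simp)
    ultimately have sq: "integrable (sample_law \<alpha> P) (\<lambda>t. (F1 t)\<^sup>2)" "integrable (sample_law \<alpha> P) (\<lambda>t. (F2 t)\<^sup>2)"
      "integrable (sample_law \<alpha> P) (\<lambda>t. (F3 t)\<^sup>2)"
      unfolding F1_def F2_def F3_def .
    have "integrable (scalar_law P) (\<lambda>z. (h z)\<^sup>2)" by (rule W.integrable_power_le_4[OF hW h4]) simp
    then have fin: "second_moment_L P q L \<noteq> \<infinity>" unfolding S by (subst nn_integral_eq_integral) auto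
    have "AE \<omega> in M. (\<lambda>d. ?avg F d \<omega>) \<longlonglongrightarrow> (LINT t|sample_law \<alpha> P. F t)"
      if "F \<in> borel_measurable (sample_law \<alpha> P)" "integrable (sample_law \<alpha> P) (\<lambda>t. (F t)\<^sup>2)" for F
      using \<delta> by (intro array_mean_limit[OF P\<tau> Zm Zlaw that _ n_bounds]) auto
    from this[of F1] this[of F2] this[of F3] show ?thesis using sq fin eF1 eF2 eF3[OF fin] by simp
  qed

  \<comment> \<open>The limit of \<open>1 / sqrt V\<close>; the value \<open>0\<close> accounts for an infinite second moment.\<close>
  define \<kappa> where "\<kappa> = (if second_moment_L P q L = \<infinity> then 0 else 1 / sqrt s)"
  have s: "0 < s" if "second_moment_L P q L \<noteq> \<infinity>"
    using that S0 by (simp add: s_def enn2real_positive_iff less_top zero_less_iff_neq_zero)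
  have \<gamma>: "(\<lambda>d. real d / real (n d)) \<longlonglongrightarrow> 1 / \<delta>"
    using tendsto_inverse[OF nd] \<delta> by (simp add: inverse_eq_divide)
  have rho: "(\<lambda>d. ereal (f d)) \<longlonglongrightarrow> ereal (b * m) / n_lin \<alpha> \<delta> P q L"
    if f: "f \<longlonglongrightarrow> \<kappa> * (b * m) / sqrt (\<kappa>\<^sup>2 * ((\<alpha>\<^sup>2 + (1 - \<alpha>)\<^sup>2) * m\<^sup>2) + 1 / \<delta>)" for f :: "nat \<Rightarrow> real" and b
  proof -
    have "ereal (b * m) / n_lin \<alpha> \<delta> P q L = ereal (\<kappa> * (b * m) / sqrt (\<kappa>\<^sup>2 * ((\<alpha>\<^sup>2 + (1 - \<alpha>)\<^sup>2) * m\<^sup>2) + 1 / \<delta>))"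
    proof (cases "second_moment_L P q L = \<infinity>")
      case True
      then show ?thesis by (simp add: n_lin_def \<kappa>_def)
    next
      case False
      let ?Q = "(\<alpha>\<^sup>2 + (1 - \<alpha>)\<^sup>2) * m\<^sup>2"
      have Q: "0 \<le> ?Q" by simp
      have "?Q + s / \<delta> = s * (\<kappa>\<^sup>2 * ?Q + 1 / \<delta>)"
        using s[OF False] \<delta> False by (simp add: \<kappa>_def power_divide distrib_left)
      then have "sqrt (?Q + s / \<delta>) = sqrt s * sqrt (\<kappa>\<^sup>2 * ?Q + 1 / \<delta>)" by (simp add: real_sqrt_mult)
      moreover have "0 < \<kappa>\<^sup>2 * ?Q + 1 / \<delta>" using \<delta> by (intro add_nonneg_pos) auto
      moreover have "0 < ?Q + s / \<delta>" using Q s[OF False] \<delta> by (intro add_nonneg_pos) auto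
      ultimately show ?thesis
        using False s[OF False] by (simp add: n_lin_def m_def[symmetric] s_def[symmetric] \<kappa>_def)
    qed
    then show ?thesis using f by (simp add: lim_ereal)
  qed

  from means have "AE \<omega> in M. (\<lambda>d. ?avg F1 d \<omega>) \<longlonglongrightarrow> \<alpha> * m"
    "AE \<omega> in M. (\<lambda>d. ?avg F2 d \<omega>) \<longlonglongrightarrow> (1 - \<alpha>) * m"
    "AE \<omega> in M. if second_moment_L P q L = \<infinity> then filterlim (\<lambda>d. ?avg F3 d \<omega>) at_top sequentially
      else (\<lambda>d. ?avg F3 d \<omega>) \<longlonglongrightarrow> s" by auto
  then show ?thesis
    using R1 R2 R3 c_lim unit
  proof eventually_elim
    case (elim \<omega>)
    define A1 where "A1 d = ?avg F1 d \<omega>" for d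
    define A2 where "A2 d = ?avg F2 d \<omega>" for d
    define V where "V d = mean_square_weight d (n d) h (T d \<omega>)" for d
    have VF: "V d = ?avg F3 d \<omega>" for d
      by (simp add: V_def mean_square_weight_def weight_def F3_def)
    have V: "(\<lambda>d. 1 / sqrt (V d)) \<longlonglongrightarrow> \<kappa>" "\<forall>\<^sub>F d in sequentially. 0 < V d"
    proof -
      show "(\<lambda>d. 1 / sqrt (V d)) \<longlonglongrightarrow> \<kappa>"
      proof (cases "second_moment_L P q L = \<infinity>")
        case True
        then have "filterlim V at_top sequentially" using elim(3) by (simp add: VF[abs_def])
        then have "filterlim (\<lambda>d. sqrt (V d)) at_top sequentially" by (rule filterlim_compose[OF sqrt_at_top])
        then show ?thesis using True tendsto_divide_0[OF tendsto_const filterlim_at_top_imp_at_infinity] by (simp add: \<kappa>_def)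
      next
        case False
        then have "V \<longlonglongrightarrow> s" using elim(3) by (simp add: VF[abs_def])
        then show ?thesis using s[OF False] False unfolding \<kappa>_def by (auto intro!: tendsto_intros)
      qed
      show "\<forall>\<^sub>F d in sequentially. 0 < V d"
      proof (cases "second_moment_L P q L = \<infinity>")
        case True
        then have "filterlim V at_top sequentially" using elim(3) by (simp add: VF[abs_def])
        then show ?thesis by (simp add: filterlim_at_top_dense)
      next
        case False
        then have "V \<longlonglongrightarrow> s" using elim(3) by (simp add: VF[abs_def])
        then show ?thesis using s[OF False] by (rule order_tendstoD(1))
      qed
    qed
    let ?c = "\<lambda>d. ip d (x1 d \<omega>) (x2 d \<omega>)" and ?r1 = "\<lambda>d. scaled_residual_ip1 d (n d) h (T d \<omega>)" and ?r2 = "\<lambda>d. scaled_residual_ip2 d (n d) h (T d \<omega>)"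
      and ?r3 = "\<lambda>d. scaled_residual_norm_error d (n d) h (T d \<omega>)" and ?k = "\<lambda>d. 1 / sqrt (V d)" and ?\<gamma> = "\<lambda>d. real d / real (n d)"
    have dec: "xlin d \<omega> j = A1 d * x1 d \<omega> j + (A2 d * x2 d \<omega> j + instance_residual d (n d) h (T d \<omega>) j)" if "j < d" for d j
      unfolding xlin A1_def A2_def F1_def F2_def h_def
      by (rule lin_estimator_decomposition[OF that, where a="\<lambda>i. a d i \<omega>" and \<eta>="\<lambda>i. \<eta> d i \<omega>" and \<epsilon>="\<lambda>i. \<epsilon> d i \<omega>"])
         (simp_all add: T_def y)
    have dec': "xlin d \<omega> j = A2 d * x2 d \<omega> j + (A1 d * x1 d \<omega> j + instance_residual d (n d) h (T d \<omega>) j)" if "j < d" for d j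
      using dec[OF that] by simp
    have fstT: "fst (T d \<omega>) = x1 d \<omega>" "fst (snd (T d \<omega>)) = x2 d \<omega>" for d by (simp_all add: T_def)
    have rs: "?r1 d = ip d (instance_residual d (n d) h (T d \<omega>)) (x1 d \<omega>) / sqrt (V d)"
      "?r2 d = ip d (instance_residual d (n d) h (T d \<omega>)) (x2 d \<omega>) / sqrt (V d)"
      "?r3 d = (L2_set (instance_residual d (n d) h (T d \<omega>)) {..<d} - sqrt (V d * ?\<gamma> d)) / sqrt (V d)" for d
      by (simp_all add: scaled_residual_ip1_def scaled_residual_ip2_def scaled_residual_norm_error_def V_def fstT)
    have A: "A1 \<longlonglongrightarrow> \<alpha> * m" "A2 \<longlonglongrightarrow> (1 - \<alpha>) * m" using elim(1,2) by (simp_all add: A1_def[abs_def] A2_def[abs_def])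
    have g: "0 < 1 / \<delta>" using \<delta> by simp
    have Q: "\<kappa>\<^sup>2 * ((\<alpha> * m)\<^sup>2 + ((1 - \<alpha>) * m)\<^sup>2) = \<kappa>\<^sup>2 * ((\<alpha>\<^sup>2 + (1 - \<alpha>)\<^sup>2) * m\<^sup>2)"
      "\<kappa>\<^sup>2 * (((1 - \<alpha>) * m)\<^sup>2 + (\<alpha> * m)\<^sup>2) = \<kappa>\<^sup>2 * ((\<alpha>\<^sup>2 + (1 - \<alpha>)\<^sup>2) * m\<^sup>2)"
      by (simp_all add: power_mult_distrib distrib_right)
    have good: "\<forall>\<^sub>F d in sequentially. 0 < d \<and> 0 < V d"
      using V(2) eventually_gt_at_top[of 0] by eventually_elim simp
    have "(\<lambda>d. overlap d (xlin d \<omega>) (x1 d \<omega>)) \<longlonglongrightarrow> \<kappa> * (\<alpha> * m) / sqrt (\<kappa>\<^sup>2 * ((\<alpha>\<^sup>2 + (1 - \<alpha>)\<^sup>2) * m\<^sup>2) + 1 / \<delta>)"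
    proof (rule Lim_transform_eventually)
      show "\<forall>\<^sub>F d in sequentially. (?k d * (A1 d + A2 d * ?c d) + ?r1 d) /
        sqrt ((?k d)\<^sup>2 * ((A1 d)\<^sup>2 + (A2 d)\<^sup>2 + 2 * A1 d * A2 d * ?c d) + 2 * ?k d * (A1 d * ?r1 d + A2 d * ?r2 d) + (?r3 d + sqrt (?\<gamma> d))\<^sup>2) =
        overlap d (xlin d \<omega>) (x1 d \<omega>)"
        using good
      proof eventually_elim
        case d: (elim d)
        show ?case
          by (rule overlap_of_decomposition[OF _ _ dec _ refl rs, symmetric]) (use d elim(8) in auto)
      qed
    qed (use overlap_limit[OF V(1) A elim(7) elim(4,5,6) \<gamma> g] in \<open>simp only: Q\<close>)
    moreover have "(\<lambda>d. overlap d (xlin d \<omega>) (x2 d \<omega>)) \<longlonglongrightarrow> \<kappa> * ((1 - \<alpha>) * m) / sqrt (\<kappa>\<^sup>2 * ((\<alpha>\<^sup>2 + (1 - \<alpha>)\<^sup>2) * m\<^sup>2) + 1 / \<delta>)"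
    proof (rule Lim_transform_eventually)
      show "\<forall>\<^sub>F d in sequentially. (?k d * (A2 d + A1 d * ?c d) + ?r2 d) /
        sqrt ((?k d)\<^sup>2 * ((A2 d)\<^sup>2 + (A1 d)\<^sup>2 + 2 * A2 d * A1 d * ?c d) + 2 * ?k d * (A2 d * ?r2 d + A1 d * ?r1 d) + (?r3 d + sqrt (?\<gamma> d))\<^sup>2) =
        overlap d (xlin d \<omega>) (x2 d \<omega>)"
        using good
      proof eventually_elim
        case d: (elim d)
        show ?case
          by (rule overlap_of_decomposition[OF _ _ dec' _ ip_commute rs(2,1,3), symmetric]) (use d elim(8) in auto)
      qed
    qed (use overlap_limit[OF V(1) A(2,1) elim(7) elim(5,4,6) \<gamma> g] in \<open>simp only: Q\<close>)
    ultimately show ?case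
      unfolding rho1_lin_def rho2_lin_def m_def[symmetric] by (intro conjI rho)
  qed
qed

end
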